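(* Let $n\ge2$, $e\in\mathbb S^{n-1}$ and $E=e^\perp$. Then $$n\,\mathrm{MA}^*(u_1,\dots,u_{n-1},\mathbf I_{[o,e]};B)=\mathrm{MA}^*_E(\operatorname{proj}_Eu_1,\dots,\operatorname{proj}_Eu_{n-1};B\cap E)$$ for all $u_1,\dots,u_{n-1}\in\mathrm{Conv}_{sc}(\mathbb R^n)$ and all Borel sets $B\subseteq\mathbb R^n$.
   Context: $\mathrm{Conv}_{sc}(\mathbb R^n)$ is the set of lower semicontinuous, proper, convex $u:\mathbb R^n\to(-\infty,\infty]$ with $u(x)/|x|\to\infty$ as $|x|\to\infty$; $u^*(x)=\sup_y(\langle x,y\rangle-u(y))$ is the Legendre–Fenchel conjugate, which is finite-valued convex for such $u$. For convex $v:\mathbb R^n\to\mathbb R$, $\mathrm{MA}(v;B)=V_n(\bigcup_{b\in B}\partial v(b))$; the mixed Monge–Ampère measure is the unique symmetric family with $\mathrm{MA}(\sum_i\lambda_iv_i;\cdot)=\sum\lambda_{i_1}\cdots\lambda_{i_n}\mathrm{MA}(v_{i_1},\dots,v_{i_n};\cdot)$ for $\lambda_i\ge0$; the conjugate mixed Monge–Ampère measure is $\mathrm{MA}^*(u_1,\dots,u_n;\cdot)=\mathrm{MA}(u_1^*,\dots,u_n^*;\cdot)$, and $\mathrm{MA}^*_E$ denotes the same object in the ambient space $E$. $\mathbf I_K$ is the convex indicator function ($0$ on $K$, $+\infty$ outside), $[o,e]$ the segment from $o$ to $e$. For a linear subspace $E$, $\operatorname{proj}_Eu(x_E)=\min_{y\in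 E^\perp}u(x_E+y)$ for $x_E\in E$. *)

theory Defs
  imports "HOL-Analysis.Analysis" "HOL-Library.Extended_Real"
begin

definition lsc_fun :: "('a::euclidean_space \<Rightarrow> ereal) \<Rightarrow> bool" where
  "lsc_fun u \<longleftrightarrow> (\<forall>x. u x \<le> Liminf (at x) u)"

definition convex_ext :: "('a::euclidean_space \<Rightarrow> ereal) \<Rightarrow> bool" where
  "convex_ext u \<longleftrightarrow> (\<forall>x y t. 0 \<le> t \<and> t \<le> 1 \<longrightarrow>
      u ((1 - t) *\<^sub>R x + t *\<^sub>R y) \<le> ereal (1 - t) * u x + ereal t * u y)"

definition conv_sc :: "('a::euclidean_space \<Rightarrow> ereal) \<Rightarrow> bool" where
  "conv_sc u \<longleftrightarrow> lsc_fun u \<and> (\<forall>x. u x \<noteq> -\<infinity>) \<and> (\<exists>x. u x \<noteq> \<infinity>) \<and> convex_ext u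
     \<and> ((\<lambda>x. u x / ereal (norm x)) \<longlongrightarrow> \<infinity>) at_infinity"

definition conjugate :: "('a::euclidean_space \<Rightarrow> ereal) \<Rightarrow> 'a \<Rightarrow> ereal" where
  "conjugate u x = (SUP y. ereal (x \<bullet> y) - u y)"

definition ind_conv :: "'a::euclidean_space set \<Rightarrow> 'a \<Rightarrow> ereal" where
  "ind_conv K x = (if x \<in> K then 0 else \<infinity>)"

definition subdiff :: "('a::euclidean_space \<Rightarrow> real) \<Rightarrow> 'a \<Rightarrow> 'a set" where
  "subdiff v b = {z. \<forall>y. v b + z \<bullet> (y - b) \<le> v y}"

definition MA :: "('a::euclidean_space \<Rightarrow> real) \<Rightarrow> 'a set \<Rightarrow> ennreal" where
  "MA v B = emeasure lebesgue (\<Union>b\<in>B. subdiff v b)"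

text \<open>Characterisation of the mixed Monge--Ampere measures: a symmetric family of
  Borel measures, indexed by n-tuples (lists of length n = DIM('a)) of finite convex
  functions, satisfying the polynomial expansion identity for all nonnegative
  coefficients. Outside its domain the family is normalised to the zero measure
  (only to make the description unique).\<close>
definition is_mixed_MA :: "(('a::euclidean_space \<Rightarrow> real) list \<Rightarrow> 'a measure) \<Rightarrow> bool" where
  "is_mixed_MA F \<longleftrightarrow>
     (\<forall>vs. sets (F vs) = sets borel) \<and>
     (\<forall>vs. \<not> (length vs = DIM('a) \<and> (\<forall>v\<in>set vs. convex_on UNIV v)) \<longrightarrow> F vs = null_measure borel) \<and>
     (\<forall>vs ws. mset vs = mset ws \<longrightarrow> F vs = F ws) \<and>
     (\<forall>(m::nat) (vs::nat \<Rightarrow> 'a \<Rightarrow> real) (lam::nat \<Rightarrow> real).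
        (\<forall>i<m. convex_on UNIV (vs i) \<and> 0 \<le> lam i) \<longrightarrow>
        (\<forall>B\<in>sets borel.
           MA (\<lambda>x. \<Sum>i<m. lam i * vs i x) B =
           (\<Sum>is\<in>{is. length is = DIM('a) \<and> set is \<subseteq> {..<m}}.
               ennreal (prod_list (map lam is)) * emeasure (F (map vs is)) B)))"

definition mixed_MA :: "('a::euclidean_space \<Rightarrow> real) list \<Rightarrow> 'a measure" where
  "mixed_MA = (THE F. is_mixed_MA F)"

definition MA_conj :: "('a::euclidean_space \<Rightarrow> ereal) list \<Rightarrow> 'a set \<Rightarrow> ennreal" where
  "MA_conj us B = emeasure (mixed_MA (map (\<lambda>u x. real_of_ereal (conjugate u x)) us)) B"

definition proj_perp :: "'a::euclidean_space \<Rightarrow> ('a \<Rightarrow> ereal) \<Rightarrow> 'a \<Rightarrow> ereal" where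
  "proj_perp e u x = (INF t. u (x + t *\<^sub>R e))"

end

theory Submission
  imports Defs "HOL-Combinatorics.Multiset_Permutations"
begin

text \<open>Write \<open>v\<^sub>i\<close> for the conjugate of \<open>u\<^sub>i\<close>. The conjugate of the projection of \<open>u\<^sub>i\<close> is the restriction of
  \<open>v\<^sub>i\<close> to the hyperplane \<open>E\<close>, and the conjugate of the indicator of the segment is the ramp
  \<open>h x = max 0 (x \<bullet> e)\<close>. Off \<open>E\<close> the subdifferentials of \<open>v + h\<close> are translates of those of \<open>v\<close>. Over \<open>E\<close>,
  almost every line parallel to \<open>e\<close> meets the union of the subdifferentials in an interval, and adding
  \<open>h\<close> lengthens this interval by exactly one. By Fubini
  \<open>MA (v + h) B = MA v B + MA (v restricted to E) (B \<inter> E)\<close>, and polarization in \<open>v\<close> gives the theorem.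

  The mixed measure is defined by a definite description, so its existence and uniqueness are part
  of the proof. Uniqueness is polarization. For existence, the polarized alternating sum of
  Monge--Ampere measures has to be nonnegative and to satisfy the expansion formula. Both are linear
  inequalities between integrals of test functions, which are stable under weak convergence; for
  twice differentiable convex functions they follow from the corresponding facts about mixed
  discriminants of positive semidefinite matrices.\<close>

text \<open>The factor n is a quotient of factorials. Put the ramp last: the alternating sum over
  index sets S pairs S with S plus the last index, each pair is a difference of Monge--Ampere
  measures with and without the ramp, and what remains is the alternating sum for E, normalised by
  (n-1)! instead of n!. The lengthening is exactly one because a subgradient over E has a tangential
  part, which is a subgradient of the restriction, and a normal part confined between difference
  quotients taken from the two sides of E; the ramp adds one to the quotients on the positive side
  and nothing to the others. The obstacle to existence is that an alternating sum of measures shows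
  no positivity. It is overcome by one transfer principle, \<open>MA_measure_det_inequality\<close>:
  a linear inequality between determinants of nonnegative combinations of positive semidefinite
  matrices carries over to the Monge--Ampere measures of the same combinations of convex functions,
  on bounded Borel sets. Nonnegativity is one instance; the expansion formula is an equality, hence
  two instances of opposite sign.\<close>

declare emeasure_completion [simp del]

subsection \<open>The Monge--Ampere measure\<close>

definition subd :: "('a::euclidean_space \<Rightarrow> real) \<Rightarrow> 'a set \<Rightarrow> 'a set" where
  "subd v B = (\<Union>b\<in>B. subdiff v b)"

text \<open>For convex \<open>v\<close> these are the slopes at which the conjugate of
  \<open>v\<close> has more than one subgradient, so that the inverse of the subdifferential is
  ambiguous.\<close>

definition multi_subd :: "('a::euclidean_space \<Rightarrow> real) \<Rightarrow> 'a set" where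
  "multi_subd v = {z. \<exists>b b'. b \<noteq> b' \<and> z \<in> subdiff v b \<and> z \<in> subdiff v b'}"

definition loc_unif :: "(nat \<Rightarrow> 'a::euclidean_space \<Rightarrow> real) \<Rightarrow> ('a \<Rightarrow> real) \<Rightarrow> bool" where
  "loc_unif w v \<longleftrightarrow> (\<forall>K. compact K \<longrightarrow> uniform_limit K w v sequentially)"

section \<open>Subgradients: bounds, limits and measurability\<close>

lemma convex_UNIV_continuous:
  fixes v :: "'a::euclidean_space \<Rightarrow> real"
  shows "convex_on UNIV v \<Longrightarrow> continuous_on S v"
  by (meson continuous_on_subset convex_on_continuous open_UNIV subset_UNIV)

lemma subdiffD: "z \<in> subdiff v b \<Longrightarrow> v b + z \<bullet> (y - b) \<le> v y"
  by (simp add: subdiff_def)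

lemma subdiff_monotone:
  assumes "z \<in> subdiff v b" "z' \<in> subdiff v b'"
  shows "0 \<le> (z - z') \<bullet> (b - b')"
  using subdiffD[OF assms(1), of b'] subdiffD[OF assms(2), of b]
  by (simp add: inner_diff_left inner_diff_right)

text \<open>At the point \<open>y\<close> one unit away from \<open>b\<close> in the direction of
  \<open>z\<close>, the subgradient inequality reads \<open>v b + norm z \<le> v y\<close>.\<close>

lemma subdiff_norm_le:
  assumes z: "z \<in> subdiff v b" and M: "\<And>y. y \<in> cball b 1 \<Longrightarrow> \<bar>v y\<bar> \<le> M"
  shows "norm z \<le> 2 * M"
proof (cases "z = 0")
  case True
  then show ?thesis using M[of b] by simp
next
  case False
  let ?y = "b + z /\<^sub>R norm z"
  have "?y \<in> cball b 1" using False by (simp add: dist_norm)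
  then have "\<bar>v ?y\<bar> \<le> M" "\<bar>v b\<bar> \<le> M" using M by auto
  moreover have "z \<bullet> (?y - b) = norm z"
    using False by (simp add: dot_square_norm power2_eq_square)
  ultimately show ?thesis using subdiffD[OF z, of ?y] by linarith
qed

lemma loc_unif_const: "loc_unif (\<lambda>_. v) v"
  by (simp add: loc_unif_def uniform_limit_iff)

lemma loc_unif_tendsto:
  assumes w: "loc_unif w v" and v: "convex_on UNIV v" and b: "b \<longlonglongrightarrow> b0"
  shows "(\<lambda>k. w k (b k)) \<longlonglongrightarrow> v b0"
proof -
  have "bounded (range b)" using b convergent_imp_bounded convergent_def by blast
  then obtain r where r: "\<And>k. b k \<in> cball 0 r" by (auto simp: bounded_iff)
  have unif: "uniform_limit (cball 0 r) w v sequentially" using w by (simp add: loc_unif_def)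
  have "(\<lambda>k. w k (b k) - v (b k)) \<longlonglongrightarrow> 0"
    unfolding tendsto_iff
  proof (intro allI impI)
    fix e :: real assume "0 < e"
    with unif have "\<forall>\<^sub>F k in sequentially. \<forall>x\<in>cball 0 r. dist (w k x) (v x) < e"
      by (auto simp: uniform_limit_iff)
    then show "\<forall>\<^sub>F k in sequentially. dist (w k (b k) - v (b k)) 0 < e"
      by eventually_elim (metis dist_0_norm dist_commute dist_norm r)
  qed
  moreover have "(\<lambda>k. v (b k)) \<longlonglongrightarrow> v b0"
    by (rule continuous_on_tendsto_compose[OF convex_UNIV_continuous[OF v, of UNIV] b]) auto
  ultimately have "(\<lambda>k. (w k (b k) - v (b k)) + v (b k)) \<longlonglongrightarrow> 0 + v b0" by (rule tendsto_add)
  then show ?thesis by simp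
qed

text \<open>For fixed \<open>y\<close> every term of the subgradient inequality converges. This
  closed graph property is behind the compactness arguments in \<open>subd_compact\<close> and
  \<open>subdiff_escape\<close>.\<close>

lemma subdiff_limit:
  assumes w: "loc_unif w v" and v: "convex_on UNIV v"
    and b: "b \<longlonglongrightarrow> b0" and z: "z \<longlonglongrightarrow> z0"
    and zb: "\<And>k. z k \<in> subdiff (w k) (b k)"
  shows "z0 \<in> subdiff v b0"
  unfolding subdiff_def
proof (safe)
  fix y
  have "(\<lambda>k. w k (b k) + z k \<bullet> (y - b k)) \<longlonglongrightarrow> v b0 + z0 \<bullet> (y - b0)"
    by (intro tendsto_intros loc_unif_tendsto[OF w v] b z)
  moreover have "(\<lambda>k. w k y) \<longlonglongrightarrow> v y" by (rule loc_unif_tendsto[OF w v]) simp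
  ultimately show "v b0 + z0 \<bullet> (y - b0) \<le> v y"
    by (rule LIMSEQ_le) (auto intro: subdiffD[OF zb])
qed

lemma loc_unif_bounded:
  assumes w: "loc_unif w v" and v: "convex_on UNIV v" and K: "bounded K"
  shows "\<exists>M. \<forall>\<^sub>F k in sequentially. \<forall>x\<in>K. \<bar>w k x\<bar> \<le> M"
proof -
  obtain r where r: "K \<subseteq> cball 0 r" using bounded_subset_ballD[OF K, of 0] ball_subset_cball by (metis order_trans)
  have "compact (v ` cball 0 r)"
    by (rule compact_continuous_image[OF convex_UNIV_continuous[OF v] compact_cball])
  then obtain M where M: "\<And>x. x \<in> cball 0 r \<Longrightarrow> \<bar>v x\<bar> \<le> M"
    unfolding compact_eq_bounded_closed bounded_iff by (metis image_eqI real_norm_def)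
  have "uniform_limit (cball 0 r) w v sequentially" using w by (simp add: loc_unif_def)
  then have "\<forall>\<^sub>F k in sequentially. \<forall>x\<in>cball 0 r. dist (w k x) (v x) < 1"
    by (auto simp: uniform_limit_iff)
  then have "\<forall>\<^sub>F k in sequentially. \<forall>x\<in>K. \<bar>w k x\<bar> \<le> M + 1"
  proof eventually_elim
    case (elim k)
    show ?case
    proof
      fix x assume "x \<in> K"
      then have "x \<in> cball 0 r" using r by blast
      then show "\<bar>w k x\<bar> \<le> M + 1" using elim M[of x] by (fastforce simp: dist_real_def)
    qed
  qed
  then show ?thesis by blast
qed

text \<open>\<open>subdiff_norm_le\<close> looks one unit beyond the base point, so the functions
  have to be bounded on the ball of radius \<open>r + 1\<close>. The uniformity in \<open>k\<close>
  later supplies a dominating function.\<close>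

lemma loc_unif_subd_bounded:
  assumes w: "loc_unif w v" and v: "convex_on UNIV v" and K: "bounded K"
  shows "\<exists>R. \<forall>\<^sub>F k in sequentially. subd (w k) K \<subseteq> cball 0 R"
proof -
  obtain r where r: "K \<subseteq> cball 0 r" using bounded_subset_ballD[OF K, of 0] ball_subset_cball by (metis order_trans)
  obtain M where M: "\<forall>\<^sub>F k in sequentially. \<forall>x\<in>cball 0 (r+1). \<bar>w k x\<bar> \<le> M"
    using loc_unif_bounded[OF w v bounded_cball] by blast
  have "\<forall>\<^sub>F k in sequentially. subd (w k) K \<subseteq> cball 0 (2 * M)"
    using M
  proof eventually_elim
    case (elim k)
    have "norm z \<le> 2 * M" if "b \<in> K" "z \<in> subdiff (w k) b" for z b
    proof (rule subdiff_norm_le[OF that(2)])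
      fix y assume "y \<in> cball b 1"
      then have "norm y \<le> norm b + 1" using norm_triangle_sub[of y b] by (simp add: dist_norm norm_minus_commute)
      then have "y \<in> cball 0 (r+1)" using r that(1) by (auto simp: subset_iff intro: order_trans)
      then show "\<bar>w k y\<bar> \<le> M" using elim by blast
    qed
    then show ?case by (auto simp: subd_def)
  qed
  then show ?thesis by blast
qed

lemma subd_bounded:
  assumes "convex_on UNIV v" "bounded K"
  shows "bounded (subd v K)"
  using loc_unif_subd_bounded[OF loc_unif_const assms] bounded_subset bounded_cball
  by auto

lemma subd_compact:
  assumes v: "convex_on UNIV v" and K: "compact K"
  shows "compact (subd v K)"
proof -
  have "closed (subd v K)"
    unfolding closed_sequential_limits
  proof (safe)
    fix z l assume z: "\<forall>n. z n \<in> subd v K" and l: "z \<longlonglongrightarrow> l"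
    have "\<forall>n. \<exists>b. b \<in> K \<and> z n \<in> subdiff v b" using z by (auto simp: subd_def)
    then obtain b where b: "\<And>n. b n \<in> K" "\<And>n. z n \<in> subdiff v (b n)" by metis
    obtain r b0 where r: "b0 \<in> K" "strict_mono (r::nat\<Rightarrow>nat)" "(b \<circ> r) \<longlonglongrightarrow> b0"
      using K b(1) unfolding compact_def by meson
    have "l \<in> subdiff v b0"
      by (rule subdiff_limit[OF loc_unif_const v r(3) LIMSEQ_subseq_LIMSEQ[OF l r(2)]]) (simp add: b)
    then show "l \<in> subd v K" using r(1) by (auto simp: subd_def)
  qed
  then show ?thesis using subd_bounded[OF v] K by (simp add: compact_eq_bounded_closed)
qed

lemma subd_UN: "subd v (\<Union>i\<in>I. B i) = (\<Union>i\<in>I. subd v (B i))"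
  by (auto simp: subd_def)

lemma subd_mono: "A \<subseteq> B \<Longrightarrow> subd v A \<subseteq> subd v B"
  by (auto simp: subd_def)

lemma subd_open_lebesgue:
  assumes v: "convex_on UNIV v" and U: "open U"
  shows "subd v U \<in> sets lebesgue"
proof -
  obtain C :: "nat \<Rightarrow> 'a set" where C: "\<And>n. compact (C n)" "\<Union> (range C) = U"
    using open_Union_compact_subsets[OF U] by metis
  have "subd v (\<Union>n. C n) \<in> sets lebesgue"
    unfolding subd_UN using subd_compact[OF v C(1)] by (auto simp: compact_imp_closed)
  then show ?thesis using C by simp
qed

text \<open>Translates of a bounded piece of \<open>S\<close> along \<open>e\<close> by different
  small amounts are disjoint, have equal measure and stay in one ball; infinitely many of them fit
  only if that measure is zero.\<close>

lemma negligible_if_lines_meet_once: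
  fixes e :: "'a::euclidean_space"
  assumes S: "S \<in> sets lebesgue"
    and e: "\<And>z t. z \<in> S \<Longrightarrow> 0 < t \<Longrightarrow> z + t *\<^sub>R e \<notin> S"
  shows "negligible S"
proof -
  have bdd: "negligible S" if S: "S \<in> sets lebesgue" "bounded S"
    and e: "\<And>z t. z \<in> S \<Longrightarrow> 0 < t \<Longrightarrow> z + t *\<^sub>R e \<notin> S" for S :: "'a set"
  proof -
    obtain r where r: "S \<subseteq> cball 0 r" using bounded_subset_ballD[OF S(2), of 0] ball_subset_cball by (metis order_trans)
    define A where "A k = (+) ((1 / real (Suc k)) *\<^sub>R e) ` S" for k
    have lm: "S \<in> lmeasurable" using S bounded_set_imp_lmeasurable by blast
    have Am: "A k \<in> lmeasurable" for k unfolding A_def by (rule measurable_translation[OF lm])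
    have mA: "measure lebesgue (A k) = measure lebesgue S" for k
      unfolding A_def by (rule measure_translation)
    have disj: "A j \<inter> A k = {}" if "j < k" for j k
    proof -
      { fix x y assume xy: "x \<in> S" "y \<in> S"
          "(1 / real (Suc j)) *\<^sub>R e + x = (1 / real (Suc k)) *\<^sub>R e + y"
        have "1 / real (Suc j) - 1 / real (Suc k) > 0" using that by (simp add: frac_less2)
        moreover have "y = x + (1 / real (Suc j) - 1 / real (Suc k)) *\<^sub>R e"
          using xy(3) by (simp add: algebra_simps)
        ultimately have False using e[OF xy(1)] xy(2) by blast }
      then show ?thesis unfolding A_def by blast
    qed
    have sub: "A k \<subseteq> cball 0 (r + norm e)" for k
    proof
      fix x assume "x \<in> A k"
      then obtain y where y: "y \<in> S" "x = (1 / real (Suc k)) *\<^sub>R e + y" by (auto simp: A_def)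
      have "norm ((1 / real (Suc k)) *\<^sub>R e) \<le> norm e"
        by (simp add: divide_le_eq mult_le_cancel_left1)
      moreover have "norm x \<le> norm ((1 / real (Suc k)) *\<^sub>R e) + norm y"
        unfolding y(2) by (rule norm_triangle_ineq)
      moreover have "norm y \<le> r" using r y(1) by auto
      ultimately show "x \<in> cball 0 (r + norm e)" by simp
    qed
    have "real n * measure lebesgue S \<le> measure lebesgue (cball (0::'a) (r + norm e))" for n
    proof -
      have "measure lebesgue (\<Union>k<n. A k) = (\<Sum>k<n. measure lebesgue (A k))"
      proof (rule measure_finite_Union)
        show "disjoint_family_on A {..<n}"
          unfolding disjoint_family_on_def using disj by (metis Int_commute linorder_neqE_nat)
      qed (use Am in \<open>auto simp: fmeasurable_def less_top\<close>)
      also have "\<dots> = real n * measure lebesgue S" by (simp add: mA)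
      finally have "real n * measure lebesgue S = measure lebesgue (\<Union>k<n. A k)" by simp
      also have "\<dots> \<le> measure lebesgue (cball (0::'a) (r + norm e))"
        using sub Am by (intro measure_mono_fmeasurable) (auto simp: fmeasurableD)
      finally show ?thesis .
    qed
    then have le: "\<And>n. real n * measure lebesgue S \<le> measure lebesgue (cball (0::'a) (r + norm e))" .
    have "measure lebesgue S \<le> 0"
    proof (rule ccontr)
      assume "\<not> measure lebesgue S \<le> 0"
      then show False
        using reals_Archimedean3[of "measure lebesgue S"] le by (metis not_le)
    qed
    then show ?thesis using lm by (simp add: negligible_iff_measure measure_le_0_iff)
  qed
  have "negligible (\<Union>n::nat. S \<inter> cball 0 (real n))"
    by (intro negligible_countable_Union) (auto intro!: bdd S simp: e)
  moreover have "(\<Union>n::nat. S \<inter> cball 0 (real n)) = S"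
    using real_arch_simple by auto
  ultimately show ?thesis by simp
qed

text \<open>Two base points of one slope differ in some coordinate \<open>i\<close>, and a rational
  \<open>q\<close> separates these coordinates. A line in direction \<open>i\<close> meets
  \<open>N i q\<close> at most once: of two such slopes the larger would have a base point below
  \<open>q\<close> and the smaller one above it, against monotonicity.\<close>

lemma negligible_multi_subd:
  assumes v: "convex_on UNIV v"
  shows "negligible (multi_subd v)"
proof -
  define N where "N i q = subd v {b. b \<bullet> i < q} \<inter> subd v {b. b \<bullet> i > q}" for i :: 'a and q :: real
  have N: "negligible (N i q)" for i q
  proof (rule negligible_if_lines_meet_once)
    have "open {b::'a. b \<bullet> i < q}" "open {b::'a. b \<bullet> i > q}"
      by (auto intro!: open_Collect_less continuous_intros)
    then show "N i q \<in> sets lebesgue"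
      unfolding N_def using subd_open_lebesgue[OF v] by blast
  next
    fix z and t :: real assume z: "z \<in> N i q" and t: "0 < t"
    obtain b where b: "b \<bullet> i > q" "z \<in> subdiff v b" using z by (auto simp: N_def subd_def)
    show "z + t *\<^sub>R i \<notin> N i q"
    proof
      assume "z + t *\<^sub>R i \<in> N i q"
      then obtain c where c: "c \<bullet> i < q" "z + t *\<^sub>R i \<in> subdiff v c" by (auto simp: N_def subd_def)
      have "0 \<le> t * (i \<bullet> (c - b))" using subdiff_monotone[OF c(2) b(2)] by simp
      then have "b \<bullet> i \<le> c \<bullet> i" using t by (simp add: zero_le_mult_iff inner_diff_right inner_commute)
      then show False using b c by simp
    qed
  qed
  have "multi_subd v \<subseteq> (\<Union>i\<in>Basis. \<Union>q\<in>\<rat>. N i q)"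
  proof
    fix z assume "z \<in> multi_subd v"
    then obtain b b' where b: "b \<noteq> b'" "z \<in> subdiff v b" "z \<in> subdiff v b'"
      by (auto simp: multi_subd_def)
    then obtain i where i: "i \<in> Basis" "b \<bullet> i \<noteq> b' \<bullet> i" using euclidean_eqI by blast
    show "z \<in> (\<Union>i\<in>Basis. \<Union>q\<in>\<rat>. N i q)"
    proof (cases "b \<bullet> i < b' \<bullet> i")
      case True
      then obtain q where "q \<in> \<rat>" "b \<bullet> i < q" "q < b' \<bullet> i" using Rats_dense_in_real by blast
      then show ?thesis using b i by (auto simp: N_def subd_def)
    next
      case False
      then have "b' \<bullet> i < b \<bullet> i" using i by simp
      then obtain q where "q \<in> \<rat>" "b' \<bullet> i < q" "q < b \<bullet> i" using Rats_dense_in_real by blast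
      then show ?thesis using b i by (auto simp: N_def subd_def)
    qed
  qed
  moreover have "negligible (\<Union>i\<in>(Basis::'a set). \<Union>q\<in>\<rat>. N i q)"
    using N by (intro negligible_Union finite_imageI finite_Basis; clarify)
       (auto intro!: negligible_countable_Union countable_rat N)
  ultimately show ?thesis using negligible_subset by blast
qed

text \<open>The images of complementary sets overlap only in the null set
  \<open>multi_subd v\<close>, so the sets with measurable image are closed under complements, and
  the induction over Borel sets can start from open sets.\<close>

lemma subd_lebesgue:
  assumes v: "convex_on UNIV v" and B: "B \<in> sets borel"
  shows "subd v B \<in> sets lebesgue"
proof -
  have Diff: "subd v (UNIV - A) \<in> sets lebesgue" if A: "subd v A \<in> sets lebesgue" for A
  proof -
    have "subd v (UNIV - A) = (subd v UNIV - subd v A) \<union> (multi_subd v \<inter> (subd v A \<inter> subd v (UNIV - A)))"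
      (is "?L = ?R")
    proof (rule set_eqI)
      fix z
      have "z \<in> subd v UNIV" if "z \<in> subd v X" for X using that subd_mono[of X UNIV v] by blast
      moreover have "z \<in> subd v A \<or> z \<in> subd v (UNIV - A)" if "z \<in> subd v UNIV"
        using that unfolding subd_def by blast
      moreover have "z \<in> multi_subd v" if zA: "z \<in> subd v A" "z \<in> subd v (UNIV - A)"
      proof -
        obtain b where b: "b \<in> A" "z \<in> subdiff v b" using zA(1) unfolding subd_def by blast
        obtain c where c: "c \<notin> A" "z \<in> subdiff v c" using zA(2) unfolding subd_def by blast
        have "b \<noteq> c" using b c by blast
        then show ?thesis using b c unfolding multi_subd_def by blast
      qed
      ultimately show "z \<in> ?L \<longleftrightarrow> z \<in> ?R" by blast
    qed
    moreover have "multi_subd v \<inter> (subd v A \<inter> subd v (UNIV - A)) \<in> sets lebesgue"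
      by (rule negligible_imp_sets[OF negligible_subset[OF negligible_multi_subd[OF v]]]) blast
    moreover have "subd v UNIV \<in> sets lebesgue" by (rule subd_open_lebesgue[OF v open_UNIV])
    ultimately show ?thesis using A by (metis sets.Diff sets.Un)
  qed
  have "B \<in> sigma_sets UNIV {S::'a set. open S}" using B by (simp add: borel_def)
  then show ?thesis
  proof (induction rule: sigma_sets.induct)
    case (Union a)
    then show ?case unfolding subd_UN by (intro sets.countable_UN) auto
  qed (use Diff subd_open_lebesgue[OF v] in \<open>auto simp: subd_def\<close>)
qed

definition argsub :: "('a::euclidean_space \<Rightarrow> real) \<Rightarrow> 'a \<Rightarrow> 'a" where
  "argsub v z = (SOME b. z \<in> subdiff v b)"

lemma argsub_mem: "z \<in> subd v UNIV \<Longrightarrow> z \<in> subdiff v (argsub v z)"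
  unfolding subd_def argsub_def by (auto intro: someI)

lemma argsub_eq: "z \<in> subdiff v b \<Longrightarrow> z \<notin> multi_subd v \<Longrightarrow> argsub v z = b"
  using argsub_mem[of z v] by (auto simp: multi_subd_def subd_def)

text \<open>The multivalued inverse of the subdifferential is single valued off a null set, so
  \<^const>\<open>MA\<close> is the image of Lebesgue measure under it.\<close>
definition MA_measure :: "('a::euclidean_space \<Rightarrow> real) \<Rightarrow> 'a measure" where
  "MA_measure v = distr (restrict_space lebesgue (subd v UNIV - multi_subd v)) borel (argsub v)"

text \<open>A set of infinite measure would get the value 0 here, so the arguments are kept
  bounded.\<close>

abbreviation MA_real :: "('a::euclidean_space \<Rightarrow> real) \<Rightarrow> 'a set \<Rightarrow> real" where
  "MA_real v \<equiv> measure (MA_measure v)"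

lemma sets_MA_measure [simp]: "sets (MA_measure v) = sets borel"
  and space_MA_measure [simp]: "space (MA_measure v) = UNIV"
  by (simp_all add: MA_measure_def)

lemma argsub_vimage:
  "argsub v -` B \<inter> (subd v UNIV - multi_subd v) = subd v B - multi_subd v"
proof -
  have "argsub v z \<in> B \<longleftrightarrow> z \<in> subd v B" if "z \<in> subd v UNIV" "z \<notin> multi_subd v" for z
    unfolding subd_def UN_iff using argsub_mem[OF that(1)] argsub_eq[OF _ that(2)] by blast
  then show ?thesis using subd_mono[of B UNIV v] by auto
qed

lemma subd_diff_lebesgue:
  assumes "convex_on UNIV v" "B \<in> sets borel"
  shows "subd v B - multi_subd v \<in> sets lebesgue"
  using subd_lebesgue[OF assms] negligible_multi_subd[OF assms(1)] negligible_imp_sets by blast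

lemma argsub_measurable:
  assumes v: "convex_on UNIV v"
  shows "argsub v \<in> restrict_space lebesgue (subd v UNIV - multi_subd v) \<rightarrow>\<^sub>M borel"
proof (rule measurableI)
  fix B :: "'a set" assume "B \<in> sets borel"
  then show "argsub v -` B \<inter> space (restrict_space lebesgue (subd v UNIV - multi_subd v))
      \<in> sets (restrict_space lebesgue (subd v UNIV - multi_subd v))"
    using subd_diff_lebesgue[OF v] subd_mono[of B UNIV v] 
    by (auto simp: space_restrict_space argsub_vimage sets_restrict_space_iff)
qed simp

lemma emeasure_MA_measure:
  assumes v: "convex_on UNIV v" and B: "B \<in> sets borel"
  shows "emeasure (MA_measure v) B = MA v B"
proof -
  have "emeasure (MA_measure v) B = emeasure lebesgue (subd v B - multi_subd v)"
    unfolding MA_measure_def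
    using subd_diff_lebesgue[OF v] subd_mono[of B UNIV v] B
    by (subst emeasure_distr[OF argsub_measurable[OF v]])
       (auto simp: space_restrict_space argsub_vimage intro!: emeasure_restrict_space)
  also have "\<dots> = emeasure lebesgue (subd v B)"
    using negligible_multi_subd[OF v] subd_lebesgue[OF v B]
    by (intro emeasure_Diff_null_set) (auto simp: negligible_iff_null_sets)
  finally show ?thesis by (simp add: MA_def subd_def)
qed

lemma emeasure_MA_measure_finite:
  assumes v: "convex_on UNIV v" and B: "bounded B"
  shows "emeasure (MA_measure v) B < \<infinity>"
proof (cases "B \<in> sets borel")
  case True
  have "emeasure (MA_measure v) B = emeasure lebesgue (subd v B)"
    using emeasure_MA_measure[OF v True] by (simp add: MA_def subd_def)
  then show ?thesis
    using bounded_set_imp_lmeasurable[OF subd_bounded[OF v B] subd_lebesgue[OF v True]]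
    by (simp add: fmeasurable_def)
qed (simp add: emeasure_notin_sets)

subsection \<open>Weak convergence\<close>

text \<open>Turns an integral against \<open>MA_measure v\<close> into a Lebesgue integral over
  slopes. The measures vary with \<open>v\<close> but Lebesgue measure does not, which makes
  dominated convergence applicable.\<close>

definition pull_sub :: "('a::euclidean_space \<Rightarrow> real) \<Rightarrow> ('a \<Rightarrow> real) \<Rightarrow> 'a \<Rightarrow> real" where
  "pull_sub v \<phi> z = (if z \<in> subd v UNIV - multi_subd v then \<phi> (argsub v z) else 0)"

lemma subdiff_iff_minimum: "z \<in> subdiff v b \<longleftrightarrow> (\<forall>y. v b - z \<bullet> b \<le> v y - z \<bullet> y)"
  by (auto simp: subdiff_def inner_diff_right algebra_simps)

lemma pull_sub_measurable:
  assumes v: "convex_on UNIV v" and \<phi>: "\<phi> \<in> borel_measurable borel"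
  shows "pull_sub v \<phi> \<in> borel_measurable lebesgue"
proof -
  have "(\<lambda>z. \<phi> (argsub v z)) \<in> borel_measurable (restrict_space lebesgue (subd v UNIV - multi_subd v))"
    using argsub_measurable[OF v] \<phi> by (rule measurable_compose)
  moreover have "(subd v UNIV - multi_subd v) \<inter> space lebesgue \<in> sets lebesgue"
    using subd_diff_lebesgue[OF v, of UNIV] by simp
  ultimately show ?thesis
    unfolding pull_sub_def by (subst (asm) measurable_restrict_space_iff[where c=0]) auto
qed

lemma pull_sub_bound:
  assumes \<phi>: "continuous_on UNIV \<phi>" and K: "compact K" "\<And>x. x \<notin> K \<Longrightarrow> \<phi> x = 0"
  shows "\<exists>C. \<forall>v z. norm (pull_sub v \<phi> z) \<le> C * indicator (subd v K) z"
proof -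
  have "compact (\<phi> ` K)" by (rule compact_continuous_image[OF continuous_on_subset[OF \<phi>] K(1)]) simp
  then obtain C where C: "\<And>x. x \<in> K \<Longrightarrow> \<bar>\<phi> x\<bar> \<le> C"
    unfolding compact_eq_bounded_closed bounded_iff by (metis image_eqI real_norm_def)
  have "norm (pull_sub v \<phi> z) \<le> \<bar>C\<bar> * indicator (subd v K) z" for v z
  proof (cases "z \<in> subd v UNIV \<and> argsub v z \<in> K")
    case True
    then have "z \<in> subd v K" using argsub_mem[of z v] by (auto simp: subd_def)
    moreover have "\<bar>\<phi> (argsub v z)\<bar> \<le> \<bar>C\<bar>" using C True by force
    ultimately show ?thesis by (simp add: pull_sub_def)
  next
    case False
    then have "pull_sub v \<phi> z = 0" using K(2) by (auto simp: pull_sub_def)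
    then show ?thesis by simp
  qed
  then show ?thesis by blast
qed

lemma integral_MA_measure:
  assumes v: "convex_on UNIV v" and \<phi>: "\<phi> \<in> borel_measurable borel"
  shows "integral\<^sup>L (MA_measure v) \<phi> = (\<integral>z. pull_sub v \<phi> z \<partial>lebesgue)"
proof -
  have "(subd v UNIV - multi_subd v) \<inter> space lebesgue \<in> sets lebesgue"
    using subd_diff_lebesgue[OF v, of UNIV] by simp
  then show ?thesis
    unfolding MA_measure_def
    by (subst integral_distr[OF argsub_measurable[OF v] \<phi>], subst integral_restrict_space)
       (auto intro!: Bochner_Integration.integral_cong simp: pull_sub_def indicator_def)
qed

text \<open>A slope outside \<open>multi_subd v\<close> has \<open>b\<close> as strict minimiser of
  \<open>v y - z \<bullet> y\<close>, with a positive gap on the sphere around \<open>b\<close>. A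
  function uniformly close to \<open>v\<close> keeps a minimiser inside the ball, and by convexity
  this local minimiser is a global one.\<close>

lemma subdiff_stable:
  assumes w: "loc_unif w v" and v: "convex_on UNIV v" and wc: "\<And>k. convex_on UNIV (w k)"
    and z: "z \<in> subdiff v b" "z \<notin> multi_subd v" and e: "0 < e"
  shows "\<forall>\<^sub>F k in sequentially. \<exists>b'\<in>ball b e. z \<in> subdiff (w k) b'"
proof -
  define f where "f x = v x - z \<bullet> x" for x
  have cf: "continuous_on S f" for S
    unfolding f_def by (intro continuous_intros convex_UNIV_continuous[OF v])
  obtain i :: 'a where i: "i \<in> Basis" using nonempty_Basis by blast
  have "b + e *\<^sub>R i \<in> sphere b e" using i e by (simp add: dist_norm)
  then have "sphere b e \<noteq> {}" by blast
  then obtain s where s: "s \<in> sphere b e" "\<And>y. y \<in> sphere b e \<Longrightarrow> f s \<le> f y"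
    using continuous_attains_inf[OF compact_sphere _ cf] by metis
  have fb: "f b \<le> f y" for y using z(1) by (auto simp: subdiff_iff_minimum f_def)
  have "f b < f s"
  proof (rule ccontr)
    assume "\<not> f b < f s"
    then have "f s \<le> f y" for y using fb[of y] by simp
    then have "z \<in> subdiff v s" by (auto simp: subdiff_iff_minimum f_def)
    moreover have "s \<noteq> b" using s(1) e by auto
    ultimately show False using z unfolding multi_subd_def by blast
  qed
  \<comment> \<open>Errors below half the gap cannot reverse the order of the values on the sphere
    and at \<open>b\<close>.\<close>
  define d where "d = (f s - f b) / 2"
  have d: "d > 0" using \<open>f b < f s\<close> by (simp add: d_def)
  have "uniform_limit (cball b e) w v sequentially" using w by (simp add: loc_unif_def)
  then have "\<forall>\<^sub>F k in sequentially. \<forall>x\<in>cball b e. dist (w k x) (v x) < d"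
    using d by (auto simp: uniform_limit_iff)
  then show ?thesis
  proof eventually_elim
    case (elim k)
    define g where "g x = w k x - z \<bullet> x" for x
    have close: "\<bar>g x - f x\<bar> < d" if "x \<in> cball b e" for x
      using elim that by (simp add: g_def f_def dist_real_def)
    have cg: "continuous_on (cball b e) g"
      unfolding g_def by (intro continuous_intros convex_UNIV_continuous[OF wc])
    have "cball b e \<noteq> {}" using e by simp
    then obtain m where m: "m \<in> cball b e" "\<And>y. y \<in> cball b e \<Longrightarrow> g m \<le> g y"
      using continuous_attains_inf[OF compact_cball _ cg] by metis
    have "m \<in> ball b e"
    proof (rule ccontr)
      assume "m \<notin> ball b e"
      then have "m \<in> sphere b e" using m(1) by auto
      then have "f s \<le> f m" by (rule s(2))
      moreover have "g m \<le> g b" using m(2)[of b] e by simp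
      moreover have "\<bar>g m - f m\<bar> < d" "\<bar>g b - f b\<bar> < d" using close m(1) e by auto
      moreover have "2 * d = f s - f b" by (simp add: d_def)
      ultimately show False by linarith
    qed
    then obtain r where r: "r > 0" "ball m r \<subseteq> ball b e"
      using open_ball openE by metis
    have "convex_on UNIV g"
      unfolding g_def
      by (intro convex_on_diff wc) (auto simp: concave_on_def convex_on_def inner_add_right algebra_simps)
    moreover have "\<forall>y\<in>ball m r. g m \<le> g y" using m(2) r(2) ball_subset_cball by blast
    ultimately have "\<forall>y\<in>UNIV. g m \<le> g y"
      using convex_local_global_minimum[OF r(1), of UNIV g m] by simp
    then have "z \<in> subdiff (w k) m" by (auto simp: subdiff_iff_minimum g_def)
    then show ?case using \<open>m \<in> ball b e\<close> by blast
  qed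
qed

lemma loc_unif_subseq:
  assumes "loc_unif w v" "strict_mono r"
  shows "loc_unif (\<lambda>k. w (r k)) v"
  unfolding loc_unif_def uniform_limit_iff
proof (intro allI impI)
  fix K :: "'a set" and e :: real assume "compact K" "0 < e"
  then have "\<forall>\<^sub>F k in sequentially. \<forall>x\<in>K. dist (w k x) (v x) < e"
    using assms(1) by (simp add: loc_unif_def uniform_limit_iff)
  from eventually_subseq[OF assms(2) this]
  show "\<forall>\<^sub>F k in sequentially. \<forall>x\<in>K. dist (w (r k) x) (v x) < e" .
qed

text \<open>Otherwise base points in \<open>K\<close> would accumulate along a subsequence, and
  \<open>z\<close> would be a subgradient of \<open>v\<close> at the limit point.\<close>

lemma subdiff_escape:
  assumes w: "loc_unif w v" and v: "convex_on UNIV v" and K: "compact K" and z: "z \<notin> subd v UNIV"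
  shows "\<forall>\<^sub>F k in sequentially. z \<notin> subd (w k) K"
proof (rule ccontr)
  assume "\<not> ?thesis"
  then obtain r :: "nat \<Rightarrow> nat" where r: "strict_mono r" "\<And>n. z \<in> subd (w (r n)) K"
    by (auto dest!: not_eventually_sequentiallyD)
  then have "\<forall>n. \<exists>b. b \<in> K \<and> z \<in> subdiff (w (r n)) b" by (auto simp: subd_def)
  then obtain b where b: "\<And>n. b n \<in> K" "\<And>n. z \<in> subdiff (w (r n)) (b n)" by metis
  obtain s b0 where s: "b0 \<in> K" "strict_mono (s::nat\<Rightarrow>nat)" "(b \<circ> s) \<longlonglongrightarrow> b0"
    using K b(1) unfolding compact_def by meson
  have "loc_unif (\<lambda>k. w (r (s k))) v"
    using loc_unif_subseq[OF loc_unif_subseq[OF w r(1)] s(2)] .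
  then have "z \<in> subdiff v b0"
    by (rule subdiff_limit[OF _ v s(3) tendsto_const]) (simp add: b)
  then show False using z by (auto simp: subd_def)
qed

text \<open>If \<open>z\<close> is a slope of \<open>v\<close>, its base points for
  \<open>w k\<close> converge to the one for \<open>v\<close>. If not, they leave the compact set
  that carries \<open>\<phi>\<close>, and the left side is eventually 0 like the right.\<close>

lemma pull_sub_tendsto:
  assumes w: "loc_unif w v" and v: "convex_on UNIV v" and wc: "\<And>k. convex_on UNIV (w k)"
    and \<phi>: "continuous_on UNIV \<phi>" and K: "compact K" "\<And>x. x \<notin> K \<Longrightarrow> \<phi> x = 0"
    and z: "z \<notin> multi_subd v" "\<And>k. z \<notin> multi_subd (w k)"
  shows "(\<lambda>k. pull_sub (w k) \<phi> z) \<longlonglongrightarrow> pull_sub v \<phi> z"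
proof (cases "z \<in> subd v UNIV")
  case True
  then obtain b where b: "z \<in> subdiff v b" by (auto simp: subd_def)
  have eq: "pull_sub u \<phi> z = \<phi> c" if "z \<in> subdiff u c" "z \<notin> multi_subd u" for u c
    using that argsub_eq[OF that] by (auto simp: pull_sub_def subd_def)
  show ?thesis
    unfolding eq[OF b z(1)] tendsto_iff
  proof (intro allI impI)
    fix e :: real assume "0 < e"
    obtain d where d: "d > 0" "\<And>x. dist x b < d \<Longrightarrow> dist (\<phi> x) (\<phi> b) < e"
      using \<phi> \<open>0 < e\<close> by (metis UNIV_I continuous_on_iff)
    have "\<forall>\<^sub>F k in sequentially. \<exists>b'\<in>ball b d. z \<in> subdiff (w k) b'"
      by (rule subdiff_stable[OF w v wc b z(1) d(1)])
    then show "\<forall>\<^sub>F k in sequentially. dist (pull_sub (w k) \<phi> z) (\<phi> b) < e"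
    proof eventually_elim
      case (elim k)
      then obtain b' where "b' \<in> ball b d" "z \<in> subdiff (w k) b'" by blast
      then show ?case using eq[OF _ z(2)] d(2) by (metis dist_commute mem_ball)
    qed
  qed
next
  case False
  have "\<forall>\<^sub>F k in sequentially. pull_sub (w k) \<phi> z = 0"
    using subdiff_escape[OF w v K(1) False]
  proof eventually_elim
    case (elim k)
    then have "argsub (w k) z \<notin> K" if "z \<in> subd (w k) UNIV" 
      using argsub_mem[OF that] by (auto simp: subd_def)
    then show ?case using K(2) by (auto simp: pull_sub_def)
  qed
  moreover have "pull_sub v \<phi> z = 0" using False by (simp add: pull_sub_def)
  ultimately show ?thesis by (simp add: tendsto_eventually)
qed

theorem MA_measure_weak_convergence:
  fixes v :: "'a::euclidean_space \<Rightarrow> real"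
    and \<phi> :: "'a \<Rightarrow> real"
  assumes w: "loc_unif w v" and v: "convex_on UNIV v" and wc: "\<And>k. convex_on UNIV (w k)"
    and \<phi>: "continuous_on UNIV \<phi>" and K: "compact K" "\<And>x. x \<notin> K \<Longrightarrow> \<phi> x = 0"
  shows "(\<lambda>k. integral\<^sup>L (MA_measure (w k)) \<phi>) \<longlonglongrightarrow> integral\<^sup>L (MA_measure v) \<phi>"
proof -
  have \<phi>m: "\<phi> \<in> borel_measurable borel" using \<phi> borel_measurable_continuous_onI by blast
  obtain R where R: "\<forall>\<^sub>F k in sequentially. subd (w k) K \<subseteq> cball 0 R"
    using loc_unif_subd_bounded[OF w v compact_imp_bounded[OF K(1)]] by blast
  then obtain N where N: "\<And>k. k \<ge> N \<Longrightarrow> subd (w k) K \<subseteq> cball 0 R"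
    unfolding eventually_sequentially by blast
  obtain C where C: "\<And>v z. norm (pull_sub v \<phi> z) \<le> C * indicator (subd v K) z"
    using pull_sub_bound[OF \<phi> K] by blast
  \<comment> \<open>The dominating function controls only the terms with index at least
    \<open>N\<close>.\<close>
  have "(\<lambda>k. \<integral>z. pull_sub (w (k + N)) \<phi> z \<partial>lebesgue) \<longlonglongrightarrow> (\<integral>z. pull_sub v \<phi> z \<partial>lebesgue)"
  proof (rule integral_dominated_convergence[where w = "\<lambda>z. \<bar>C\<bar> * indicator (cball 0 R) z"
        and s = "\<lambda>k. pull_sub (w (k + N)) \<phi>"])
    show "integrable lebesgue (\<lambda>z::'a. \<bar>C\<bar> * indicator (cball 0 R) z)"
      using lmeasurable_cball[of "0::'a" R]
      by (intro integrable_mult_right integrable_real_indicator) (simp_all add: fmeasurable_def)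
    show "AE z in lebesgue. (\<lambda>k. pull_sub (w (k + N)) \<phi> z) \<longlonglongrightarrow> pull_sub v \<phi> z"
    proof -
      have "negligible (multi_subd v \<union> (\<Union>k. multi_subd (w k)))"
        by (intro negligible_Un negligible_countable_Union negligible_multi_subd v)
           (auto intro: negligible_multi_subd wc)
      then have "AE z in lebesgue. z \<notin> multi_subd v \<union> (\<Union>k. multi_subd (w k))"
        unfolding negligible_iff_null_sets by (rule AE_not_in)
      then show ?thesis
      proof eventually_elim
        case (elim z)
        then have "(\<lambda>k. pull_sub (w k) \<phi> z) \<longlonglongrightarrow> pull_sub v \<phi> z"
          by (intro pull_sub_tendsto[OF w v wc \<phi> K]) auto
        then show ?case by (rule LIMSEQ_ignore_initial_segment)
      qed
    qed
    fix k
    have "norm (pull_sub (w (k + N)) \<phi> z) \<le> \<bar>C\<bar> * indicator (cball 0 R) z" for z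
    proof (cases "z \<in> subd (w (k + N)) K")
      case True
      then have "z \<in> cball 0 R" using N[of "k + N"] by auto
      then show ?thesis using True C[of "w (k + N)" z] by simp
    next
      case False
      then show ?thesis using C[of "w (k + N)" z] by simp
    qed
    then show "AE z in lebesgue. norm (pull_sub (w (k + N)) \<phi> z) \<le> \<bar>C\<bar> * indicator (cball 0 R) z" by simp
    show "pull_sub (w (k + N)) \<phi> \<in> borel_measurable lebesgue"
      by (rule pull_sub_measurable[OF wc \<phi>m])
  qed (rule pull_sub_measurable[OF v \<phi>m])
  then have "(\<lambda>k. integral\<^sup>L (MA_measure (w (k + N))) \<phi>) \<longlonglongrightarrow> integral\<^sup>L (MA_measure v) \<phi>"
    unfolding integral_MA_measure[OF wc \<phi>m] integral_MA_measure[OF v \<phi>m] .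
  then show ?thesis by (rule LIMSEQ_offset[of "\<lambda>k. integral\<^sup>L (MA_measure (w k)) \<phi>"])
qed

section \<open>Test functions and approximation by compact sets\<close>

lemma measurable_MA_measure [simp]: "MA_measure v \<rightarrow>\<^sub>M N = borel \<rightarrow>\<^sub>M N"
  by (rule measurable_cong_sets) simp_all

text \<open>Continuous functions tending to the indicator of a compact \<open>K\<close>. The factor
  \<open>Suc j\<close> is at least 1, which keeps all supports within distance 1 of
  \<open>K\<close>. For empty \<open>K\<close> the value of \<open>infdist\<close> is 0 and the
  function is constantly 1, hence the hypothesis \<open>K \<noteq> {}\<close> below.\<close>

definition bump :: "'a::euclidean_space set \<Rightarrow> nat \<Rightarrow> 'a \<Rightarrow> real" where
  "bump K j x = max 0 (1 - real (Suc j) * infdist x K)"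

definition test_fun :: "('a::euclidean_space \<Rightarrow> real) \<Rightarrow> bool" where
  "test_fun \<phi> \<longleftrightarrow> continuous_on UNIV \<phi> \<and> (\<forall>x. 0 \<le> \<phi> x) \<and> (\<exists>K. compact K \<and> (\<forall>x. x \<notin> K \<longrightarrow> \<phi> x = 0))"

lemma bump_support:
  fixes K :: "'a::euclidean_space set"
  assumes "compact K" "K \<noteq> {}"
  shows "\<exists>L. compact L \<and> (\<forall>j x. x \<notin> L \<longrightarrow> bump K j x = 0)"
proof -
  obtain r where r: "K \<subseteq> ball 0 r"
    using bounded_subset_ballD[OF compact_imp_bounded[OF assms(1)], of 0] by blast
  have "bump K j x = 0" if "x \<notin> cball 0 (r + 1)" for j x
  proof -
    obtain y where y: "y \<in> K" "infdist x K = dist x y"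
      using infdist_attains_inf[OF compact_imp_closed[OF assms(1)] assms(2)] by blast
    have "norm x \<le> norm (x - y) + norm y" by (metis norm_triangle_sub add.commute)
    moreover have "norm y < r" using r y(1) by auto
    ultimately have "1 \<le> infdist x K" using that y(2) by (simp add: dist_norm)
    then have "1 * 1 \<le> real (Suc j) * infdist x K" by (intro mult_mono) auto
    then show ?thesis by (simp add: bump_def)
  qed
  then show ?thesis using compact_cball by blast
qed

lemma test_fun_bump:
  fixes K :: "'a::euclidean_space set"
  assumes "compact K" "K \<noteq> {}"
  shows "test_fun (bump K j)"
  unfolding test_fun_def
  using bump_support[OF assms]
  by (auto simp: bump_def[abs_def] intro!: continuous_intros)

lemma bump_tendsto:
  fixes K :: "'a::euclidean_space set"
  assumes "compact K" "K \<noteq> {}"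
  shows "(\<lambda>j. bump K j x) \<longlonglongrightarrow> indicator K x"
proof (cases "x \<in> K")
  case True
  then show ?thesis by (simp add: bump_def)
next
  case False
  then have d: "infdist x K > 0"
    using assms by (metis compact_imp_closed in_closed_iff_infdist_zero infdist_nonneg less_eq_real_def)
  obtain n where n: "1 < real n * infdist x K" using reals_Archimedean3[OF d] by blast
  have "bump K j x = 0" if "j \<ge> n" for j
  proof -
    have "real n * infdist x K \<le> real (Suc j) * infdist x K" using that d by (intro mult_right_mono) auto
    then show ?thesis using n by (simp add: bump_def)
  qed
  then have "\<forall>\<^sub>F j in sequentially. bump K j x = 0" unfolding eventually_sequentially by blast
  then show ?thesis using False by (simp add: tendsto_eventually)
qed

lemma integral_bump_tendsto:
  fixes K :: "'a::euclidean_space set"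
  assumes v: "convex_on UNIV v" and K: "compact K" "K \<noteq> {}"
  shows "(\<lambda>j. integral\<^sup>L (MA_measure v) (bump K j)) \<longlonglongrightarrow> MA_real v K"
proof -
  obtain L where L: "compact L" "\<And>j x. x \<notin> L \<Longrightarrow> bump K j x = 0" using bump_support[OF K] by blast
  have Km: "K \<in> sets (MA_measure v)" "L \<in> sets (MA_measure v)" using K L by (auto intro: borel_compact)
  have "(\<lambda>j. integral\<^sup>L (MA_measure v) (bump K j)) \<longlonglongrightarrow> (\<integral>x. indicator K x \<partial>MA_measure v)"
  proof (rule integral_dominated_convergence[where w = "indicator L"])
    show "integrable (MA_measure v) (indicator L :: 'a \<Rightarrow> real)"
      using Km emeasure_MA_measure_finite[OF v compact_imp_bounded[OF L(1)]]
      by (intro integrable_real_indicator) (auto simp: less_top)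
    show "bump K j \<in> borel_measurable (MA_measure v)" for j
      unfolding bump_def[abs_def] measurable_MA_measure
      by (intro borel_measurable_continuous_onI continuous_intros)
    show "AE x in MA_measure v. norm (bump K j x) \<le> indicator L x" for j
    proof (rule AE_I2)
      fix x show "norm (bump K j x) \<le> indicator L x"
        using L(2)[of x j] infdist_nonneg[of x K] by (cases "x \<in> L") (auto simp: bump_def)
    qed
    show "AE x in MA_measure v. (\<lambda>j. bump K j x) \<longlonglongrightarrow> indicator K x"
      by (intro AE_I2 bump_tendsto K)
  qed (use Km in auto)
  then show ?thesis using Km by simp
qed

text \<open>Every compact set between \<open>K\<close> and \<open>B\<close> approximates, so
  finitely many measures share an approximating set, namely the union of the individual
  ones.\<close>

lemma MA_measure_inner_regular:
  assumes v: "convex_on UNIV v" and B: "B \<in> sets borel" "bounded B" and e: "0 < e"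
  shows "\<exists>K\<subseteq>B. compact K \<and> (\<forall>K'. K \<subseteq> K' \<longrightarrow> K' \<subseteq> B \<longrightarrow> compact K' \<longrightarrow>
            \<bar>MA_real v K' - MA_real v B\<bar> < e)"
proof -
  \<comment> \<open>Inner regularity asks for a finite measure, and \<open>MA_measure v\<close> is
    known to be finite on bounded sets only.\<close>
  define M where "M = density (MA_measure v) (indicator B)"
  have Bm: "B \<in> sets (MA_measure v)" using B by simp
  have fin: "emeasure (MA_measure v) B < \<infinity>" using emeasure_MA_measure_finite[OF v B(2)] .
  have M: "emeasure M A = emeasure (MA_measure v) A" if "A \<subseteq> B" "A \<in> sets borel" for A
  proof -
    have "emeasure M A = emeasure (MA_measure v) (B \<inter> A)"
      unfolding M_def using that B by (subst emeasure_density) (auto simp: borel_measurable_indicator simp flip: indicator_inter_arith)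
    moreover have "B \<inter> A = A" using that by blast
    ultimately show ?thesis by simp
  qed
  have "emeasure M (space M) = emeasure (MA_measure v) B"
    unfolding M_def using B by (subst emeasure_density) (auto simp: borel_measurable_indicator)
  then have "emeasure M (space M) \<noteq> \<infinity>" using fin by simp
  moreover have "sets M = sets borel" by (simp add: M_def)
  ultimately have "emeasure M B = (SUP K\<in>{K. K \<subseteq> B \<and> compact K}. emeasure M K)"
    using inner_regular[of M B] B by blast
  then have S: "emeasure (MA_measure v) B = (SUP K\<in>{K. K \<subseteq> B \<and> compact K}. emeasure (MA_measure v) K)"
    using M[OF _ borel_compact] M[OF order_refl B(1)] by simp
  show ?thesis
  proof (cases "MA_real v B = 0")
    case True
    have "MA_real v K' = 0" if "K' \<subseteq> B" "compact K'" for K'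
      using measure_mono_fmeasurable[OF that(1), of "MA_measure v"] True Bm fin that(2)
      by (simp add: fmeasurable_def borel_compact measure_le_0_iff)
    then show ?thesis using True e by (intro exI[of _ "{}"]) auto
  next
    case False
    then have pos: "0 < MA_real v B" by (simp add: zero_less_measure_iff)
    have "ennreal (MA_real v B - e) < ennreal (MA_real v B)"
      using pos e by (intro ennreal_lessI) auto
    also have "\<dots> = emeasure (MA_measure v) B" using fin by (simp add: emeasure_eq_ennreal_measure less_top)
    finally obtain K where K: "K \<subseteq> B" "compact K" "ennreal (MA_real v B - e) < emeasure (MA_measure v) K"
      unfolding S less_SUP_iff by blast
    have "\<bar>MA_real v K' - MA_real v B\<bar> < e"
      if "K \<subseteq> K'" "K' \<subseteq> B" "compact K'" for K'
    proof -
      have K'm: "K' \<in> sets (MA_measure v)" using that(3) by (simp add: borel_compact)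
      have "emeasure (MA_measure v) K \<le> emeasure (MA_measure v) K'" by (rule emeasure_mono[OF that(1) K'm])
      moreover have "emeasure (MA_measure v) K' = ennreal (MA_real v K')"
        using emeasure_mono[OF that(2) Bm] fin by (intro emeasure_eq_ennreal_measure) auto
      ultimately have "ennreal (MA_real v B - e) < ennreal (MA_real v K')"
        using K(3) by simp
      then have "MA_real v B - e < MA_real v K'"
        by (metis ennreal_leI not_le)
      moreover have "MA_real v K' \<le> MA_real v B"
        using measure_mono_fmeasurable[OF that(2) K'm] Bm fin by (simp add: fmeasurable_def)
      ultimately show ?thesis by simp
    qed
    then show ?thesis using K by blast
  qed
qed

text \<open>Both the nonnegativity and the polynomial expansion of mixed measures are finite signed
  combinations of Monge--Ampere measures, hence can be checked on test functions.\<close>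
theorem signed_MA_nonneg:
  fixes v :: "'k \<Rightarrow> 'a::euclidean_space \<Rightarrow> real"
  assumes I: "finite I" and v: "\<And>i. i \<in> I \<Longrightarrow> convex_on UNIV (v i)"
    and \<phi>: "\<And>\<phi>. test_fun \<phi> \<Longrightarrow> 0 \<le> (\<Sum>i\<in>I. c i * integral\<^sup>L (MA_measure (v i)) \<phi>)"
    and B: "B \<in> sets borel" "bounded B"
  shows "0 \<le> (\<Sum>i\<in>I. c i * MA_real (v i) B)"
proof -
  have cpt: "0 \<le> (\<Sum>i\<in>I. c i * MA_real (v i) K)" if K: "compact K" for K
  proof (cases "K = {}")
    case False
    have "(\<lambda>j. \<Sum>i\<in>I. c i * integral\<^sup>L (MA_measure (v i)) (bump K j))
        \<longlonglongrightarrow> (\<Sum>i\<in>I. c i * MA_real (v i) K)"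
      by (intro tendsto_sum tendsto_mult tendsto_const integral_bump_tendsto v K False)
    then show ?thesis
      by (rule LIMSEQ_le_const) (use \<phi> test_fun_bump[OF K False] in blast)
  qed simp
  show ?thesis
  proof (rule field_le_epsilon)
    fix e :: real assume e: "0 < e"
    define C where "C = (\<Sum>i\<in>I. \<bar>c i\<bar>) + 1"
    have C: "C > 0" unfolding C_def by (intro add_nonneg_pos sum_nonneg) auto
    have "\<forall>i\<in>I. \<exists>K\<subseteq>B. compact K \<and> (\<forall>K'. K \<subseteq> K' \<longrightarrow> K' \<subseteq> B \<longrightarrow> compact K' \<longrightarrow>
            \<bar>MA_real (v i) K' - MA_real (v i) B\<bar> < e / C)"
      using MA_measure_inner_regular[OF v B] e C by (meson divide_pos_pos)
    then obtain K where K: "\<And>i. i \<in> I \<Longrightarrow> K i \<subseteq> B" "\<And>i. i \<in> I \<Longrightarrow> compact (K i)"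
      "\<And>i K'. i \<in> I \<Longrightarrow> K i \<subseteq> K' \<Longrightarrow> K' \<subseteq> B \<Longrightarrow> compact K' \<Longrightarrow>
          \<bar>MA_real (v i) K' - MA_real (v i) B\<bar> < e / C"
      by metis
    define L where "L = (\<Union>i\<in>I. K i)"
    have L: "compact L" "L \<subseteq> B" unfolding L_def using K I by (auto intro: compact_UN)
    have close: "\<bar>MA_real (v i) L - MA_real (v i) B\<bar> \<le> e / C" if "i \<in> I" for i
      using K(3)[OF that _ L(2,1)] that by (force simp: L_def)
    have "(\<Sum>i\<in>I. c i * MA_real (v i) L) - (\<Sum>i\<in>I. c i * MA_real (v i) B)
        = (\<Sum>i\<in>I. c i * (MA_real (v i) L - MA_real (v i) B))"
      by (simp add: sum_subtractf right_diff_distrib)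
    also have "\<dots> \<le> (\<Sum>i\<in>I. \<bar>c i\<bar> * (e / C))"
    proof (rule sum_mono)
      fix i assume "i \<in> I"
      have "c i * (MA_real (v i) L - MA_real (v i) B)
          \<le> \<bar>c i\<bar> * \<bar>MA_real (v i) L - MA_real (v i) B\<bar>"
        by (metis abs_ge_self abs_mult)
      also have "\<dots> \<le> \<bar>c i\<bar> * (e / C)" using close[OF \<open>i \<in> I\<close>] by (intro mult_left_mono) auto
      finally show "c i * (MA_real (v i) L - MA_real (v i) B) \<le> \<bar>c i\<bar> * (e / C)" .
    qed
    also have "\<dots> = (C - 1) * (e / C)" by (simp add: C_def sum_distrib_right sum_divide_distrib)
    also have "\<dots> \<le> C * (e / C)" using C e by (intro mult_right_mono) auto
    also have "\<dots> = e" using C by simp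
    finally show "0 \<le> (\<Sum>i\<in>I. c i * MA_real (v i) B) + e" using cpt[OF L(1)] by simp
  qed
qed

subsection \<open>Polarization and mixed discriminants\<close>

definition idx_lists :: "nat \<Rightarrow> nat set \<Rightarrow> nat list set" where
  "idx_lists n S = {is. length is = n \<and> set is \<subseteq> S}"

lemma finite_idx_lists [simp]: "finite S \<Longrightarrow> finite (idx_lists n S)"
  unfolding idx_lists_def using finite_lists_length_eq[of S n] by (simp add: conj_commute)

text \<open>Expand the product over \<open>x\<close> in \<open>N\<close> of
  \<open>1 + (if x \<in> A then 0 else -1)\<close>. A subset \<open>S\<close> that does not contain
  \<open>A\<close> contributes 0, and the whole product vanishes as soon as some \<open>x\<close> in
  \<open>N\<close> lies outside \<open>A\<close>.\<close>

lemma sum_superset_sign: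
  fixes N :: "nat set"
  assumes "finite N" "A \<subseteq> N"
  shows "(\<Sum>S | S \<subseteq> N \<and> A \<subseteq> S. (-1) ^ (card N - card S)) = (if A = N then 1 else (0::real))"
proof -
  have "(\<Prod>x\<in>N. 1 + (if x \<in> A then 0 else -1)) =
      (\<Sum>S\<in>Pow N. (\<Prod>x\<in>S. 1) * (\<Prod>x\<in>N-S. if x \<in> A then 0 else (-1::real)))"
    by (rule prod_add[OF assms(1)])
  also have "\<dots> = (\<Sum>S\<in>Pow N. if A \<subseteq> S then (-1) ^ (card N - card S) else 0)"
  proof (rule sum.cong[OF refl])
    fix S assume S: "S \<in> Pow N"
    then have fS: "finite S" using assms finite_subset by auto
    show "(\<Prod>x\<in>S. 1) * (\<Prod>x\<in>N-S. if x \<in> A then 0 else (-1::real)) = (if A \<subseteq> S then (-1) ^ (card N - card S) else 0)"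
    proof (cases "A \<subseteq> S")
      case True
      then have "(\<Prod>x\<in>N-S. if x \<in> A then 0 else (-1::real)) = (\<Prod>x\<in>N-S. -1)" by (intro prod.cong) auto
      then show ?thesis using True S fS by (simp add: card_Diff_subset)
    next
      case False
      then obtain x where "x \<in> A" "x \<notin> S" by blast
      then have "\<exists>x\<in>N-S. (if x \<in> A then 0 else (-1::real)) = 0" using assms by auto
      then show ?thesis using False assms(1) by (simp add: prod_zero_iff)
    qed
  qed
  also have "\<dots> = (\<Sum>S | S \<subseteq> N \<and> A \<subseteq> S. (-1) ^ (card N - card S))"
    using assms(1) by (simp add: sum.inter_filter[symmetric] Pow_def)
  finally have "(\<Sum>S | S \<subseteq> N \<and> A \<subseteq> S. (-1) ^ (card N - card S)) = (\<Prod>x\<in>N. if x \<in> A then 1 else (0::real))"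
    by (simp add: if_distrib[of "\<lambda>t. 1 + t"] cong: if_cong)
  also have "\<dots> = (if A = N then 1 else 0)"
  proof (cases "A = N")
    case False
    then obtain x where "x \<in> N" "x \<notin> A" using assms by blast
    then have "\<exists>x\<in>N. (if x \<in> A then 1 else (0::real)) = 0" by auto
    then have "(\<Prod>x\<in>N. if x \<in> A then 1 else (0::real)) = 0" by (rule prod_zero[OF assms(1)])
    then show ?thesis using False by simp
  qed simp
  finally show ?thesis .
qed

text \<open>After exchanging the sums, a list is weighted by the signed number of sets
  \<open>S\<close> that contain its entries, which is 0 unless the entries exhaust
  \<open>{..<n}\<close>. The lists that remain are the \<open>fact n\<close> permutations of
  \<open>[0..<n]\<close>, on which \<open>c\<close> is constant.\<close>

lemma polarization:
  fixes c :: "nat list \<Rightarrow> real"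
  assumes c: "\<And>is js. length is = n \<Longrightarrow> set is \<subseteq> {..<n} \<Longrightarrow> mset is = mset js \<Longrightarrow> c is = c js"
  shows "(\<Sum>S\<in>Pow {..<n}. (-1) ^ (n - card S) * (\<Sum>is\<in>idx_lists n S. c is)) = fact n * c [0..<n]"
proof -
  let ?L = "idx_lists n {..<n}"
  have "(\<Sum>is\<in>idx_lists n S. c is) = (\<Sum>is\<in>?L. if set is \<subseteq> S then c is else 0)" if "S \<in> Pow {..<n}" for S
  proof -
    have "idx_lists n S = {is \<in> ?L. set is \<subseteq> S}" using that by (auto simp: idx_lists_def)
    then show ?thesis by (simp add: sum.inter_filter)
  qed
  then have "(\<Sum>S\<in>Pow {..<n}. (-1) ^ (n - card S) * (\<Sum>is\<in>idx_lists n S. c is)) =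
      (\<Sum>S\<in>Pow {..<n}. \<Sum>is\<in>?L. if set is \<subseteq> S then (-1) ^ (n - card S) * c is else 0)"
    by (simp add: sum_distrib_left if_distrib[of "\<lambda>t. _ * t"] cong: if_cong)
  also have "\<dots> = (\<Sum>is\<in>?L. \<Sum>S\<in>Pow {..<n}. if set is \<subseteq> S then (-1) ^ (n - card S) * c is else 0)"
    by (rule sum.swap)
  also have "\<dots> = (\<Sum>is\<in>?L. if set is = {..<n} then c is else 0)"
  proof (rule sum.cong[OF refl])
    fix "is" assume "is": "is \<in> ?L"
    have "(\<Sum>S\<in>Pow {..<n}. if set is \<subseteq> S then (-1) ^ (n - card S) * c is else 0)
       = (\<Sum>S | S \<subseteq> {..<n} \<and> set is \<subseteq> S. (-1) ^ (card {..<n} - card S)) * c is"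
      by (simp add: sum.inter_filter[symmetric] Pow_def sum_distrib_right)
    also have "\<dots> = (if set is = {..<n} then c is else 0)"
      using "is" by (subst sum_superset_sign) (auto simp: idx_lists_def)
    finally show "(\<Sum>S\<in>Pow {..<n}. if set is \<subseteq> S then (-1) ^ (n - card S) * c is else 0) = (if set is = {..<n} then c is else 0)" .
  qed
  also have "\<dots> = (\<Sum>is | is \<in> ?L \<and> set is = {..<n}. c is)"
    by (simp add: sum.inter_filter)
  also have "{is. is \<in> ?L \<and> set is = {..<n}} = permutations_of_set {..<n}"
  proof (rule set_eqI)
    fix xs
    have "distinct xs \<longleftrightarrow> length xs = n" if "set xs = {..<n}"
      using that card_distinct[of xs] distinct_card[of xs] by auto
    then show "xs \<in> {is. is \<in> ?L \<and> set is = {..<n}} \<longleftrightarrow> xs \<in> permutations_of_set {..<n}"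
      by (auto simp: idx_lists_def permutations_of_set_def)
  qed
  also have "(\<Sum>is\<in>permutations_of_set {..<n}. c is) = (\<Sum>is\<in>permutations_of_set {..<n}. c [0..<n])"
  proof (rule sum.cong[OF refl])
    fix "is" assume "is \<in> permutations_of_set {..<n}"
    then have 1: "set is = {..<n}" "distinct is" by (auto simp: permutations_of_set_def)
    then have "mset is = mset [0..<n]"
      using set_eq_iff_mset_eq_distinct[of "is" "[0..<n]"] by (simp add: atLeast0LessThan)
    then show "c is = c [0..<n]" using 1 distinct_card[OF 1(2)] by (intro c) auto
  qed
  finally show ?thesis by simp
qed

section \<open>Mixed discriminants\<close>

definition row_idx :: "'n::finite \<Rightarrow> nat" where
  "row_idx = (SOME f. bij_betw f UNIV {..<CARD('n)})"

lemma bij_row_idx: "bij_betw (row_idx :: 'n::finite \<Rightarrow> nat) UNIV {..<CARD('n)}"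
proof -
  have "\<exists>f. bij_betw f (UNIV :: 'n set) {..<CARD('n)}"
    using ex_bij_betw_finite_nat[of "UNIV :: 'n set"] by (simp add: atLeast0LessThan)
  then show ?thesis unfolding row_idx_def by (rule someI_ex)
qed

lemma row_idx_less: "row_idx (r :: 'n::finite) < CARD('n)"
  using bij_row_idx by (auto simp: bij_betw_def)

text \<open>Row \<open>r\<close> is taken from the matrix with number \<open>row_idx (p r)\<close>,
  and the determinants are averaged over all assignments \<open>p\<close>. For copies of a single
  matrix this is its determinant.\<close>

definition mixed_disc :: "(real^'n^'n) list \<Rightarrow> real" where
  "mixed_disc As = (\<Sum>p | p permutes (UNIV :: 'n set). det (\<chi> r. As ! row_idx (p r) $ r)) / fact CARD('n)"

text \<open>Reordering the list amounts to composing all assignments with one fixed permutation,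
  obtained by carrying \<open>q\<close> from list positions to row indices.\<close>

lemma mixed_disc_mset:
  fixes As Bs :: "(real^'n^'n) list"
  assumes "mset As = mset Bs" "length Bs = CARD('n)"
  shows "mixed_disc As = mixed_disc Bs"
proof -
  obtain q where q: "q permutes {..<length Bs}" "permute_list q Bs = As"
    using mset_eq_permutation[OF assms(1)] by blast
  define t where "t = inv_into (UNIV :: 'n set) row_idx \<circ> q \<circ> (row_idx :: 'n \<Rightarrow> nat)"
  have q': "bij_betw q {..<CARD('n)} {..<CARD('n)}" using q assms by (metis permutes_imp_bij)
  have "bij t" unfolding t_def
    using bij_betw_trans[OF bij_betw_trans[OF bij_row_idx q'] bij_betw_inv_into[OF bij_row_idx]] by (simp add: comp_assoc bij_betw_def)
  then have t: "t permutes UNIV" by (intro bij_imp_permutes) auto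
  have eq: "As ! row_idx r = Bs ! row_idx (t r)" for r
  proof -
    have "q (row_idx r) \<in> row_idx ` (UNIV :: 'n set)"
      using q' bij_row_idx[where 'n='n] row_idx_less[of r] by (metis bij_betw_def imageI lessThan_iff)
    then have "row_idx (t r) = q (row_idx r)" by (simp add: t_def f_inv_into_f)
    then show ?thesis using q assms(2) row_idx_less[of r] by (metis permute_list_nth)
  qed
  show ?thesis
    unfolding mixed_disc_def eq by (subst (2) setum_permutations_compose_left[OF t]) simp
qed

lemma det_rows_sum:
  fixes a :: "'n::finite \<Rightarrow> 'k \<Rightarrow> real^'n"
  assumes "finite S"
  shows "det (\<chi> r. \<Sum>k\<in>S. a r k) = (\<Sum>f | \<forall>r. f r \<in> S. det (\<chi> r. a r (f r)))"
proof -
  have "{f. \<forall>r. f r \<in> S} = PiE (UNIV :: 'n set) (\<lambda>_. S)" by auto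
  then have "(\<Prod>r\<in>UNIV. \<Sum>k\<in>S. a r k $ p r) = (\<Sum>f | \<forall>r. f r \<in> S. \<Prod>r\<in>UNIV. a r (f r) $ p r)" for p
    using prod_sum_PiE[of "UNIV :: 'n set" "\<lambda>_. S" "\<lambda>r k. a r k $ p r"] assms by simp
  then show ?thesis
    by (simp add: det_def sum_distrib_left sum.swap[of _ "{f. \<forall>r. f r \<in> S}"])
qed

text \<open>Multilinearity in the rows gives a sum over maps \<open>f\<close> from rows to
  \<open>{..<m}\<close>. For every \<open>p\<close> the index lists encode exactly these maps
  through \<open>is ! row_idx (p r)\<close>, so each \<open>p\<close> yields the full sum and
  averaging over \<open>p\<close> does not change it.\<close>

lemma det_sum_expansion:
  fixes A :: "nat \<Rightarrow> real^'n^'n"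
  shows "det (\<Sum>i<m. lam i *\<^sub>R A i) =
    (\<Sum>is\<in>idx_lists CARD('n) {..<m}. prod_list (map lam is) * mixed_disc (map A is))"
proof -
  define G where "G f = (\<Prod>r\<in>UNIV. lam (f r)) * det (\<chi> r. A (f r) $ r)" for f :: "'n \<Rightarrow> nat"
  let ?F = "{f :: 'n \<Rightarrow> nat. \<forall>r. f r \<in> {..<m}}"
  have "det (\<Sum>i<m. lam i *\<^sub>R A i) = det (\<chi> r. \<Sum>i<m. lam i *s (A i $ r))"
    by (intro arg_cong[where f=det]) (simp add: vec_eq_iff)
  also have "\<dots> = (\<Sum>f\<in>?F. det (\<chi> r. lam (f r) *s (A (f r) $ r)))"
    using det_rows_sum[of "{..<m}" "\<lambda>r i. lam i *s (A i $ r)"] by simp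
  also have "\<dots> = sum G ?F" by (simp add: det_rows_mul G_def)
  finally have 1: "det (\<Sum>i<m. lam i *\<^sub>R A i) = sum G ?F" .
  have 2: "(\<Sum>is\<in>idx_lists CARD('n) {..<m}. prod_list (map lam is) * det (\<chi> r. map A is ! row_idx (p r) $ r)) = sum G ?F"
    if p: "p permutes UNIV" for p :: "'n \<Rightarrow> 'n"
  proof (rule sum.reindex_bij_witness[where
        i = "\<lambda>f. map (\<lambda>j. f (inv p (inv_into UNIV row_idx j))) [0..<CARD('n)]" and j = "\<lambda>is r. is ! row_idx (p r)"])
    fix "is" assume "is": "is \<in> idx_lists CARD('n) {..<m}"
    then have len: "length is = CARD('n)" by (simp add: idx_lists_def)
    show "map (\<lambda>j. is ! row_idx (p (inv p (inv_into UNIV row_idx j)))) [0..<CARD('n)] = is"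
    proof (rule nth_equalityI)
      fix j assume "j < length (map (\<lambda>j. is ! row_idx (p (inv p (inv_into UNIV row_idx j)))) [0..<CARD('n)])"
      then have j: "j < CARD('n)" by simp
      then have "j \<in> row_idx ` (UNIV :: 'n set)" using bij_row_idx[where 'n='n] by (simp add: bij_betw_def)
      then show "map (\<lambda>j. is ! row_idx (p (inv p (inv_into UNIV row_idx j)))) [0..<CARD('n)] ! j = is ! j"
        using j p by (simp add: permutes_inverses f_inv_into_f)
    qed (simp add: len)
    show "(\<lambda>r. is ! row_idx (p r)) \<in> ?F"
      using "is" len row_idx_less[where 'n='n] by (auto simp: idx_lists_def subset_iff)
    have "prod_list (map lam is) = (\<Prod>j<CARD('n). lam (is ! j))"
      using len by (simp add: prod.list_conv_set_nth atLeast0LessThan)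
    also have "\<dots> = (\<Prod>r\<in>(UNIV::'n set). lam (is ! row_idx r))"
      using prod.reindex_bij_betw[OF bij_row_idx[where 'n='n], of "\<lambda>j. lam (is ! j)"] by simp
    also have "\<dots> = (\<Prod>r\<in>(UNIV::'n set). lam (is ! row_idx (p r)))"
      using prod.permute[OF p, of "\<lambda>r. lam (is ! row_idx r)"] by (simp add: comp_def)
    finally show "G (\<lambda>r. is ! row_idx (p r)) = prod_list (map lam is) * det (\<chi> r. map A is ! row_idx (p r) $ r)"
      using row_idx_less[where 'n='n] len by (simp add: G_def)
  next
    fix f assume f: "f \<in> ?F"
    show "(\<lambda>r. map (\<lambda>j. f (inv p (inv_into UNIV row_idx j))) [0..<CARD('n)] ! row_idx (p r)) = f"
      using p row_idx_less[where 'n='n] bij_row_idx[where 'n='n]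
      by (simp add: permutes_inverses bij_betw_def inv_into_f_f fun_eq_iff)
    show "map (\<lambda>j. f (inv p (inv_into UNIV row_idx j))) [0..<CARD('n)] \<in> idx_lists CARD('n) {..<m}"
      using f by (auto simp: idx_lists_def)
  qed
  have "(\<Sum>is\<in>idx_lists CARD('n) {..<m}. prod_list (map lam is) * mixed_disc (map A is))
    = (\<Sum>p | p permutes (UNIV :: 'n set). \<Sum>is\<in>idx_lists CARD('n) {..<m}.
        prod_list (map lam is) * det (\<chi> r. map A is ! row_idx (p r) $ r)) / fact CARD('n)"
    unfolding mixed_disc_def
    by (subst sum.swap) (simp add: sum_distrib_left sum_divide_distrib)
  also have "\<dots> = (\<Sum>p | p permutes (UNIV :: 'n set). sum G ?F) / fact CARD('n)"
    using 2 by simp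
  also have "\<dots> = sum G ?F" by (simp add: card_permutations[OF refl])
  finally show ?thesis using 1 by simp
qed

section \<open>Positive semidefinite matrices\<close>

definition psd :: "real^'n^'n \<Rightarrow> bool" where
  "psd A \<longleftrightarrow> transpose A = A \<and> (\<forall>x. 0 \<le> x \<bullet> (A *v x))"

text \<open>Symmetric Gaussian elimination, one index at a time.\<close>
lemma psd_sum_rank_one_on:
  fixes A :: "real^'n^'n"
  assumes "finite S" "psd A" "\<And>i j. A $ i $ j \<noteq> 0 \<Longrightarrow> i \<in> S \<and> j \<in> S"
  shows "\<exists>a. \<forall>i j. A $ i $ j = (\<Sum>k\<in>S. a k $ i * a k $ j)"
  using assms
proof (induction S arbitrary: A rule: finite_induct)
  case empty
  then show ?case by auto
next
  case (insert s S)
  have sym: "A $ i $ j = A $ j $ i" for i j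
    using insert.prems(1) unfolding psd_def transpose_def by (metis vec_lambda_beta)
  define c where "c = A *v axis s 1"
  have c: "c $ i = A $ i $ s" for i by (simp add: c_def matrix_vector_mul_component inner_axis)
  have Ax: "axis s 1 \<bullet> (A *v x) = c \<bullet> x" for x
    unfolding inner_axis' by (simp add: matrix_vector_mult_def inner_vec_def c sym[of s])
  have q: "(x + t *\<^sub>R axis s 1) \<bullet> (A *v (x + t *\<^sub>R axis s 1)) = x \<bullet> (A *v x) + 2 * t * (c \<bullet> x) + t\<^sup>2 * A $ s $ s" for x t
  proof -
    have 1: "A *v (x + t *\<^sub>R axis s 1) = A *v x + t *\<^sub>R c"
      by (simp add: c_def matrix_vector_right_distrib matrix_vector_mult_scaleR)
    have 2: "axis s 1 \<bullet> c = A $ s $ s" by (simp add: inner_axis' c)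
    show ?thesis
      unfolding 1 by (simp add: inner_add_left inner_add_right Ax 2 inner_commute[of x c] power2_eq_square algebra_simps)
  qed
  have pos: "0 \<le> x \<bullet> (A *v x) + 2 * t * (c \<bullet> x) + t\<^sup>2 * A $ s $ s" for x t
    using insert.prems(1) q[of x t] unfolding psd_def by metis
  show ?case
  proof (cases "A $ s $ s = 0")
    case True
    \<comment> \<open>With a zero pivot the form is affine in \<open>t\<close>, so nonnegativity
      forces its linear coefficient to vanish; the \<open>t\<close> chosen below would make the form
      equal to -1.\<close>
    have "c \<bullet> x = 0" for x
    proof (rule ccontr)
      assume ne: "c \<bullet> x \<noteq> 0"
      have "2 * (- (x \<bullet> (A *v x) + 1) / (2 * (c \<bullet> x))) * (c \<bullet> x) = - (x \<bullet> (A *v x) + 1)"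
        using ne by (simp add: field_simps)
      then show False
        using pos[of x "- (x \<bullet> (A *v x) + 1) / (2 * (c \<bullet> x))"] True by simp
    qed
    then have "c = 0" using inner_eq_zero_iff by blast
    then have z: "A $ i $ s = 0" "A $ s $ i = 0" for i using c[of i] sym[of s i] by simp_all
    have "\<And>i j. A $ i $ j \<noteq> 0 \<Longrightarrow> i \<in> S \<and> j \<in> S" using insert.prems(2) z by (metis insertE)
    then obtain a where a: "\<forall>i j. A $ i $ j = (\<Sum>k\<in>S. a k $ i * a k $ j)"
      using insert.IH[OF insert.prems(1)] by blast
    show ?thesis
    proof (intro exI allI)
      fix i j
      have "(\<Sum>k\<in>S. (a(s := 0)) k $ i * (a(s := 0)) k $ j) = (\<Sum>k\<in>S. a k $ i * a k $ j)"
        using insert.hyps by (intro sum.cong) auto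
      then show "A $ i $ j = (\<Sum>k\<in>insert s S. (a(s := 0)) k $ i * (a(s := 0)) k $ j)"
        using a insert.hyps by simp
    qed
  next
    case False
    have d: "A $ s $ s > 0"
    proof -
      have "0 \<le> A $ s $ s" using pos[of 0 1] by simp
      then show ?thesis using False by simp
    qed
    \<comment> \<open>Scaled so that the rank one matrix of \<open>b\<close> has the same row and
      column \<open>s\<close> as \<open>A\<close>; then \<open>A'\<close> is the Schur complement of
      the pivot.\<close>
    define b where "b = (1 / sqrt (A $ s $ s)) *\<^sub>R c"
    have bij: "b $ i * b $ j = A $ i $ s * A $ j $ s / A $ s $ s" for i j
      using d by (simp add: b_def c)
    define A' where "A' = (\<chi> i j. A $ i $ j - b $ i * b $ j)"
    have A'x: "x \<bullet> (A' *v x) = x \<bullet> (A *v x) - (c \<bullet> x)\<^sup>2 / A $ s $ s" for x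
    proof -
      have "A' *v x = A *v x - (b \<bullet> x) *\<^sub>R b"
        by (simp add: vec_eq_iff A'_def matrix_vector_mult_def inner_vec_def right_diff_distrib
            sum_subtractf sum_distrib_left mult_ac)
      moreover have "(b \<bullet> x) * (x \<bullet> b) = (c \<bullet> x)\<^sup>2 / A $ s $ s"
        using d by (simp add: b_def power2_eq_square inner_commute)
      ultimately show ?thesis by (simp add: inner_diff_right)
    qed
    have "0 \<le> x \<bullet> (A' *v x)" for x
    proof -
      \<comment> \<open>This value of \<open>t\<close> minimises the quadratic polynomial in
        \<open>pos\<close>.\<close>
      have "0 \<le> x \<bullet> (A *v x) + 2 * (- (c \<bullet> x) / A $ s $ s) * (c \<bullet> x) + (- (c \<bullet> x) / A $ s $ s)\<^sup>2 * A $ s $ s"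
        by (rule pos)
      also have "\<dots> = x \<bullet> (A' *v x)"
        using d by (simp add: A'x power2_eq_square field_simps)
      finally show ?thesis .
    qed
    moreover have "transpose A' = A'"
      by (simp add: vec_eq_iff transpose_def A'_def sym mult.commute)
    ultimately have "psd A'" by (simp add: psd_def)
    moreover have "A' $ i $ j \<noteq> 0 \<Longrightarrow> i \<in> S \<and> j \<in> S" for i j
    proof -
      assume ne: "A' $ i $ j \<noteq> 0"
      have "i \<noteq> s" "j \<noteq> s" using ne d by (auto simp: A'_def bij sym)
      moreover have "A $ i $ j \<noteq> 0 \<or> A $ i $ s \<noteq> 0 \<and> A $ j $ s \<noteq> 0" using ne by (auto simp: A'_def bij)
      ultimately show "i \<in> S \<and> j \<in> S" using insert.prems(2) by blast
    qed
    ultimately obtain a where a: "\<forall>i j. A' $ i $ j = (\<Sum>k\<in>S. a k $ i * a k $ j)"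
      using insert.IH by blast
    show ?thesis
    proof (intro exI allI)
      fix i j
      have "(\<Sum>k\<in>S. (a(s := b)) k $ i * (a(s := b)) k $ j) = (\<Sum>k\<in>S. a k $ i * a k $ j)"
        using insert.hyps by (intro sum.cong) auto
      moreover have "A $ i $ j = A' $ i $ j + b $ i * b $ j" by (simp add: A'_def)
      ultimately show "A $ i $ j = (\<Sum>k\<in>insert s S. (a(s := b)) k $ i * (a(s := b)) k $ j)"
        using a insert.hyps by simp
    qed
  qed
qed

text \<open>For rank one matrices the mixed discriminant is a squared determinant.\<close>
lemma mixed_disc_nonneg:
  fixes As :: "(real^'n^'n) list"
  assumes psd: "\<And>A. A \<in> set As \<Longrightarrow> psd A" and len: "length As = CARD('n)"
  shows "0 \<le> mixed_disc As"
proof -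
  have "\<forall>s::'n. \<exists>a. \<forall>i j. (As ! row_idx s) $ i $ j = (\<Sum>k\<in>(UNIV::'n set). a k $ i * a k $ j)"
    using psd len row_idx_less by (intro allI psd_sum_rank_one_on) (auto intro!: psd nth_mem)
  then obtain a :: "'n \<Rightarrow> 'n \<Rightarrow> real^'n" where
    a: "\<And>s i j. (As ! row_idx s) $ i $ j = (\<Sum>k\<in>UNIV. a s k $ i * a s k $ j)"
    by metis
  define M where "M h = (\<chi> s. a s (h s))" for h :: "'n \<Rightarrow> 'n"
  have "det (\<chi> r. As ! row_idx (p r) $ r) = (\<Sum>h\<in>UNIV. (\<Prod>r\<in>UNIV. M h $ p r $ r) * (of_int (sign p) * det (M h)))"
    if p: "p permutes UNIV" for p :: "'n \<Rightarrow> 'n"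
  proof -
    have "(\<chi> r. As ! row_idx (p r) $ r) = (\<chi> r. \<Sum>k\<in>UNIV. (a (p r) k $ r) *s a (p r) k)"
      by (simp add: vec_eq_iff a)
    then have "det (\<chi> r. As ! row_idx (p r) $ r) =
        (\<Sum>g | \<forall>r. g r \<in> UNIV. det (\<chi> r. (a (p r) (g r) $ r) *s a (p r) (g r)))"
      by (simp only: det_linear_rows_sum[OF finite])
    also have "\<dots> = (\<Sum>g\<in>UNIV. (\<Prod>r\<in>UNIV. a (p r) (g r) $ r) * det (\<chi> r. a (p r) (g r)))"
      by (simp add: det_rows_mul)
    \<comment> \<open>With \<open>h = g \<circ> inv p\<close> the rows depend on \<open>p\<close>
      only through their order, which then contributes a sign.\<close>
    also have "\<dots> = (\<Sum>h\<in>UNIV. (\<Prod>r\<in>UNIV. M h $ p r $ r) * det (\<chi> r. M h $ p r))"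
      by (rule sum.reindex_bij_witness[where i = "\<lambda>h. h \<circ> p" and j = "\<lambda>g. g \<circ> inv p"])
         (use p in \<open>auto simp: M_def permutes_inverses fun_eq_iff\<close>)
    also have "\<dots> = (\<Sum>h\<in>UNIV. (\<Prod>r\<in>UNIV. M h $ p r $ r) * (of_int (sign p) * det (M h)))"
      by (simp add: det_permute_rows[OF p])
    finally show ?thesis .
  qed
  then have "(\<Sum>p | p permutes (UNIV :: 'n set). det (\<chi> r. As ! row_idx (p r) $ r)) =
     (\<Sum>p | p permutes (UNIV :: 'n set). \<Sum>h\<in>UNIV. (\<Prod>r\<in>UNIV. M h $ p r $ r) * (of_int (sign p) * det (M h)))"
    by simp
  also have "\<dots> = (\<Sum>h\<in>UNIV. \<Sum>p | p permutes (UNIV :: 'n set). (\<Prod>r\<in>UNIV. M h $ p r $ r) * (of_int (sign p) * det (M h)))"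
    by (rule sum.swap)
  \<comment> \<open>Summed over \<open>p\<close>, the signs and the products of entries assemble a
    second determinant of the same matrix.\<close>
  also have "\<dots> = (\<Sum>h\<in>UNIV. det (transpose (M h)) * det (M h))"
    unfolding det_def[of "transpose _"] by (simp add: transpose_def sum_distrib_left mult_ac)
  also have "\<dots> \<ge> 0" by (intro sum_nonneg) (simp add: det_transpose)
  finally show ?thesis by (simp add: mixed_disc_def)
qed

lemma det_psd_nonneg:
  fixes A :: "real^'n^'n"
  assumes "psd A" shows "0 \<le> det A"
proof -
  have "det A = (\<Sum>is\<in>idx_lists CARD('n) {..<1}. prod_list (map (\<lambda>_. 1) is) * mixed_disc (map (\<lambda>_. A) is))"
    using det_sum_expansion[of "\<lambda>_. 1" "\<lambda>_. A" 1] by simp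
  also have "\<dots> \<ge> 0"
    using assms by (intro sum_nonneg mult_nonneg_nonneg mixed_disc_nonneg prod_list_nonneg) (auto simp: idx_lists_def)
  finally show ?thesis .
qed

text \<open>Coefficients 0 and 1 in \<open>det_sum_expansion\<close> keep exactly the lists with
  entries in \<open>S\<close>, which brings the left side into the form treated by
  \<open>polarization\<close>.\<close>

lemma det_polarization:
  fixes As :: "(real^'n^'n) list"
  assumes "length As = CARD('n)"
  shows "(\<Sum>S\<in>Pow {..<CARD('n)}. (-1) ^ (CARD('n) - card S) * det (\<Sum>i\<in>S. As ! i)) = fact CARD('n) * mixed_disc As"
proof -
  let ?n = "CARD('n)"
  have "det (\<Sum>i\<in>S. As ! i) = (\<Sum>is\<in>idx_lists ?n S. mixed_disc (map ((!) As) is))" if S: "S \<in> Pow {..<?n}" for S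
  proof -
    have "(\<Sum>i\<in>S. As ! i) = (\<Sum>i<?n. (if i \<in> S then 1 else 0) *\<^sub>R As ! i)"
    proof -
      have "S = {i \<in> {..<?n}. i \<in> S}" using S by auto
      then have "(\<Sum>i\<in>S. As ! i) = (\<Sum>i<?n. if i \<in> S then As ! i else 0)"
        using sum.inter_filter[of "{..<?n}" "(!) As" "\<lambda>i. i \<in> S"] by simp
      also have "\<dots> = (\<Sum>i<?n. (if i \<in> S then 1 else 0) *\<^sub>R As ! i)" by (intro sum.cong) auto
      finally show ?thesis .
    qed
    then have "det (\<Sum>i\<in>S. As ! i) = (\<Sum>is\<in>idx_lists ?n {..<?n}.
        prod_list (map (\<lambda>i. if i \<in> S then 1 else 0) is) * mixed_disc (map ((!) As) is))"
      by (simp only: det_sum_expansion)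
    also have "\<dots> = (\<Sum>is\<in>idx_lists ?n {..<?n}. if set is \<subseteq> S then mixed_disc (map ((!) As) is) else 0)"
    proof (rule sum.cong[OF refl])
      fix "is"
      have "prod_list (map (\<lambda>i. if i \<in> S then 1 else (0::real)) is) = (if set is \<subseteq> S then 1 else 0)"
        by (induction "is") auto
      then show "prod_list (map (\<lambda>i. if i \<in> S then 1 else 0) is) * mixed_disc (map ((!) As) is)
        = (if set is \<subseteq> S then mixed_disc (map ((!) As) is) else 0)" by simp
    qed
    also have "\<dots> = (\<Sum>is | is \<in> idx_lists ?n {..<?n} \<and> set is \<subseteq> S. mixed_disc (map ((!) As) is))"
      by (simp add: sum.inter_filter)
    also have "{is. is \<in> idx_lists ?n {..<?n} \<and> set is \<subseteq> S} = idx_lists ?n S"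
      using S by (auto simp: idx_lists_def)
    finally show ?thesis .
  qed
  then have "(\<Sum>S\<in>Pow {..<?n}. (-1) ^ (?n - card S) * det (\<Sum>i\<in>S. As ! i)) =
     (\<Sum>S\<in>Pow {..<?n}. (-1) ^ (?n - card S) * (\<Sum>is\<in>idx_lists ?n S. mixed_disc (map ((!) As) is)))"
    by simp
  also have "\<dots> = fact ?n * mixed_disc (map ((!) As) [0..<?n])"
  proof (rule polarization)
    fix "is" js :: "nat list" assume "length is = ?n" "mset is = mset js"
    then show "mixed_disc (map ((!) As) is) = mixed_disc (map ((!) As) js)"
      by (intro mixed_disc_mset) (auto simp: mset_map dest: mset_eq_length)
  qed
  also have "map ((!) As) [0..<?n] = As" using assms map_nth[of As] by simp
  finally show ?thesis .
qed

subsection \<open>Smooth approximation\<close>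

lemma compact_support_integral:
  fixes f :: "'a::euclidean_space \<Rightarrow> 'b::euclidean_space"
  assumes f: "continuous_on UNIV f" and z: "\<And>x. x \<notin> cbox a b \<Longrightarrow> f x = 0"
  shows "f integrable_on UNIV" "integral UNIV f = integral (cbox a b) f"
proof -
  have "f integrable_on cbox a b"
    by (rule integrable_continuous[OF continuous_on_subset[OF f subset_UNIV]])
  then have "(f has_integral integral (cbox a b) f) UNIV"
    by (rule has_integral_on_superset[OF integrable_integral z subset_UNIV])
  then show "f integrable_on UNIV" "integral UNIV f = integral (cbox a b) f"
    by (auto intro: integral_unique)
qed

lemma compact_support_integral_shift:
  fixes f :: "'a::euclidean_space \<Rightarrow> 'b::euclidean_space"
  assumes f: "continuous_on UNIV f" and z: "\<And>x. x \<notin> cbox a b \<Longrightarrow> f x = 0"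
  shows "integral UNIV (\<lambda>x. f (x + c)) = integral UNIV f"
proof -
  have "(f has_integral integral (cbox a b) f) (cbox a b)"
    by (rule integrable_integral, rule integrable_continuous[OF continuous_on_subset[OF f subset_UNIV]])
  from has_integral_affinity'[OF this, of 1 c]
  have "((\<lambda>x. f (x + c)) has_integral integral (cbox a b) f) (cbox (a - c) (b - c))" by simp
  then have "((\<lambda>x. f (x + c)) has_integral integral (cbox a b) f) UNIV"
  proof (rule has_integral_on_superset)
    fix x assume "x \<notin> cbox (a - c) (b - c)"
    then have "x + c \<notin> cbox a b" by (auto simp: mem_box algebra_simps)
    then show "f (x + c) = 0" by (rule z)
  qed simp
  then show ?thesis using compact_support_integral(2)[OF f z] by (simp add: integral_unique)
qed

text \<open>Differentiation under the integral; the derivative falls on the kernel while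
  \<open>v\<close> is merely continuous. With values of \<open>Q\<close> in any Euclidean space, the
  lemma yields the gradient of a mollification and, applied to the gradient of the kernel, its
  Hessian.\<close>

lemma conv_has_derivative:
  fixes v :: "'a::euclidean_space \<Rightarrow> real" and Q :: "'a \<Rightarrow> 'b::euclidean_space"
  assumes v: "continuous_on UNIV v"
    and Q: "\<And>x. (Q has_derivative Q' x) (at x)"
    and Q': "\<And>h. continuous_on UNIV (\<lambda>x. Q' x h)"
    and z: "\<And>x. r \<le> norm x \<Longrightarrow> Q x = 0" "\<And>x h. r \<le> norm x \<Longrightarrow> Q' x h = 0"
  shows "((\<lambda>x. integral UNIV (\<lambda>y. v y *\<^sub>R Q (x - y))) has_derivative
      (\<lambda>h. integral UNIV (\<lambda>y. v y *\<^sub>R Q' (x0 - y) h))) (at x0)"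
proof -
  define U where "U = ball x0 1"
  \<comment> \<open>Outside this one box the integrand vanishes for every \<open>x\<close> in
    \<open>U\<close>, so the domain of integration is fixed.\<close>
  obtain a :: 'a where a: "cball 0 (norm x0 + 1 + \<bar>r\<bar>) \<subseteq> cbox (-a) a"
    using bounded_subset_cbox_symmetric[OF bounded_cball] by metis
  have far: "r \<le> norm (x - y)" if "x \<in> U" "y \<notin> cbox (-a) a" for x y :: 'a
  proof -
    have "norm x < norm x0 + 1"
      using that(1) norm_triangle_sub[of x x0] by (simp add: U_def dist_norm norm_minus_commute)
    moreover have "norm y > norm x0 + 1 + \<bar>r\<bar>" using that(2) a by (auto simp: subset_iff not_le[symmetric])
    moreover have "norm y \<le> norm x + norm (x - y)" by (metis norm_minus_commute norm_triangle_sub)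
    ultimately show ?thesis by linarith
  qed
  have cQ: "continuous_on UNIV Q"
    by (rule continuous_at_imp_continuous_on) (metis Q has_derivative_continuous)
  have cc: "continuous_on S (\<lambda>y. v y *\<^sub>R Q (x - y))" for S x
    by (intro continuous_on_scaleR continuous_on_subset[OF v] continuous_on_compose2[OF cQ] continuous_intros) auto
  have cc': "continuous_on S (\<lambda>y. v y *\<^sub>R Q' (x - y) h)" for S x h
    by (intro continuous_on_scaleR continuous_on_subset[OF v] continuous_on_compose2[OF Q'] continuous_intros) auto
  have W: "integral UNIV (\<lambda>y. v y *\<^sub>R Q (x - y)) = integral (cbox (-a) a) (\<lambda>y. v y *\<^sub>R Q (x - y))"
    if "x \<in> U" for x
    using far[OF that] z(1) by (intro compact_support_integral(2) cc) auto
  define D where "D x y = Blinfun (\<lambda>h. v y *\<^sub>R Q' (x - y) h)" for x y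
  have blQ: "bounded_linear (Q' x)" for x using Q has_derivative_bounded_linear by blast
  have D: "blinfun_apply (D x y) h = v y *\<^sub>R Q' (x - y) h" for x y h
    unfolding D_def by (subst bounded_linear_Blinfun_apply) (auto intro: bounded_linear_const_scaleR blQ)
  have cD: "continuous_on (U \<times> cbox (-a) a) (\<lambda>(x, y). D x y)"
    unfolding split_beta
    by (intro continuous_on_blinfun_componentwise, unfold D)
       (intro continuous_on_scaleR continuous_on_compose2[OF v] continuous_on_compose2[OF Q'] continuous_intros; auto)
  have "((\<lambda>x. integral (cbox (-a) a) (\<lambda>y. v y *\<^sub>R Q (x - y))) has_derivative
      blinfun_apply (integral (cbox (-a) a) (D x0))) (at x0 within U)"
  proof (rule leibniz_rule)
    fix x y
    have "((\<lambda>x. v y *\<^sub>R Q (x - y)) has_derivative (\<lambda>h. v y *\<^sub>R Q' (x - y) h)) (at x within U)"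
      by (intro has_derivative_scaleR_right has_derivative_compose[of "\<lambda>x. x - y" "\<lambda>h. h", OF _ Q])
         (auto intro!: derivative_eq_intros)
    moreover have "blinfun_apply (D x y) = (\<lambda>h. v y *\<^sub>R Q' (x - y) h)" using D by blast
    ultimately show "((\<lambda>x. v y *\<^sub>R Q (x - y)) has_derivative blinfun_apply (D x y)) (at x within U)" by simp
    show "(\<lambda>y. v y *\<^sub>R Q (x - y)) integrable_on cbox (-a) a" by (rule integrable_continuous[OF cc])
  qed (use cD in \<open>auto simp: U_def\<close>)
  moreover have "blinfun_apply (integral (cbox (-a) a) (D x0)) = (\<lambda>h. integral UNIV (\<lambda>y. v y *\<^sub>R Q' (x0 - y) h))"
  proof
    fix h
    have "continuous_on (cbox (-a) a) (\<lambda>y. D x0 y)"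
      using continuous_on_compose2[OF cD, of "cbox (-a) a" "\<lambda>y. (x0, y)"]
      by (simp add: U_def continuous_on_Pair image_subset_iff)
    then have "D x0 integrable_on cbox (-a) a" by (rule integrable_continuous)
    then have "blinfun_apply (integral (cbox (-a) a) (D x0)) h = integral (cbox (-a) a) (\<lambda>y. v y *\<^sub>R Q' (x0 - y) h)"
      by (simp add: blinfun_apply_integral D)
    also have "\<dots> = integral UNIV (\<lambda>y. v y *\<^sub>R Q' (x0 - y) h)"
      using far[of x0] z(2) by (intro compact_support_integral(2)[symmetric] cc') (auto simp: U_def)
    finally show "blinfun_apply (integral (cbox (-a) a) (D x0)) h = integral UNIV (\<lambda>y. v y *\<^sub>R Q' (x0 - y) h)" .
  qed
  ultimately have "((\<lambda>x. integral (cbox (-a) a) (\<lambda>y. v y *\<^sub>R Q (x - y))) has_derivative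
      (\<lambda>h. integral UNIV (\<lambda>y. v y *\<^sub>R Q' (x0 - y) h))) (at x0 within U)" by simp
  then have "((\<lambda>x. integral (cbox (-a) a) (\<lambda>y. v y *\<^sub>R Q (x - y))) has_derivative
      (\<lambda>h. integral UNIV (\<lambda>y. v y *\<^sub>R Q' (x0 - y) h))) (at x0)"
    using at_within_open[of x0 U] by (simp add: U_def)
  then show ?thesis
    by (rule has_derivative_transform_within_open[of _ _ _ _ U]) (auto simp: U_def W[unfolded U_def])
qed

section \<open>The kernel and mollification\<close>

lemma has_real_derivative_pos_part_power:
  "((\<lambda>t::real. max 0 t ^ Suc (Suc n)) has_real_derivative real (Suc (Suc n)) * max 0 t ^ Suc n) (at t)"
proof -
  consider "t < 0" | "t = 0" | "t > 0" by linarith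
  then show ?thesis
  proof cases
    case 1
    have "((\<lambda>t::real. 0) has_real_derivative 0) (at t)" by simp
    then have "((\<lambda>t::real. max 0 t ^ Suc (Suc n)) has_real_derivative 0) (at t)"
      by (rule has_field_derivative_transform_within_open[of _ _ _ "{..<0}"]) (use 1 in auto)
    then show ?thesis using 1 by simp
  next
    case 2
    have "((\<lambda>h. max 0 h ^ Suc n) \<longlongrightarrow> max 0 0 ^ Suc n) (at (0::real))"
      by (intro tendsto_intros)
    moreover have "\<forall>\<^sub>F h in at (0::real). max 0 h ^ Suc n = (max 0 (0 + h) ^ Suc (Suc n) - max 0 0 ^ Suc (Suc n)) / h"
      unfolding eventually_at_filter by (intro always_eventually) (auto simp: max_def)
    ultimately have "((\<lambda>h. (max 0 (0 + h) ^ Suc (Suc n) - max 0 0 ^ Suc (Suc n)) / h) \<longlongrightarrow> 0) (at (0::real))"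
      by (simp add: filterlim_cong)
    then show ?thesis using 2 by (simp add: DERIV_def)
  next
    case 3
    have "((\<lambda>t::real. t ^ Suc (Suc n)) has_real_derivative real (Suc (Suc n)) * t ^ Suc n) (at t)"
      by (rule derivative_eq_intros refl | simp)+
    then have "((\<lambda>t::real. max 0 t ^ Suc (Suc n)) has_real_derivative real (Suc (Suc n)) * t ^ Suc n) (at t)"
      by (rule has_field_derivative_transform_within_open[of _ _ _ "{0<..}"]) (use 3 in auto)
    then show ?thesis using 3 by simp
  qed
qed

text \<open>For positive \<open>e\<close>, 3 is the smallest integer power that makes the kernel
  twice continuously differentiable across the sphere of radius \<open>e\<close>. The total mass is
  divided out in \<open>mollify\<close>.\<close>

definition kern :: "real \<Rightarrow> 'a::euclidean_space \<Rightarrow> real" where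
  "kern e x = max 0 (e\<^sup>2 - x \<bullet> x) ^ 3"

definition kern_grad :: "real \<Rightarrow> 'a::euclidean_space \<Rightarrow> 'a" where
  "kern_grad e x = (- 6 * max 0 (e\<^sup>2 - x \<bullet> x) ^ 2) *\<^sub>R x"

definition kern_hess :: "real \<Rightarrow> 'a::euclidean_space \<Rightarrow> 'a \<Rightarrow> 'a" where
  "kern_hess e x h = (24 * max 0 (e\<^sup>2 - x \<bullet> x) * (x \<bullet> h)) *\<^sub>R x - (6 * max 0 (e\<^sup>2 - x \<bullet> x) ^ 2) *\<^sub>R h"

lemma kern_zero:
  assumes "0 < e" "e \<le> norm x"
  shows "kern e x = 0" "kern_grad e x = 0" "kern_hess e x h = 0"
proof -
  have "e\<^sup>2 \<le> x \<bullet> x" using assms by (simp add: power2_norm_eq_inner[symmetric] power_mono)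
  then have "max 0 (e\<^sup>2 - x \<bullet> x) = 0" by simp
  then show "kern e x = 0" "kern_grad e x = 0" "kern_hess e x h = 0"
    by (simp_all add: kern_def kern_grad_def kern_hess_def)
qed

lemma kern_has_derivative: "(kern e has_derivative (\<lambda>h. kern_grad e x \<bullet> h)) (at x)"
proof -
  have "((\<lambda>x. e\<^sup>2 - x \<bullet> x) has_derivative (\<lambda>h. - (2 * (x \<bullet> h)))) (at x)"
    by (auto intro!: derivative_eq_intros simp: inner_commute)
  from has_derivative_compose[OF this has_real_derivative_pos_part_power[of 1 "e\<^sup>2 - x \<bullet> x", unfolded has_field_derivative_def]]
  show ?thesis
    by (simp add: kern_def[abs_def] kern_grad_def numeral_3_eq_3 numeral_2_eq_2 algebra_simps)
qed

lemma kern_grad_has_derivative: "(kern_grad e has_derivative kern_hess e x) (at x)"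
proof -
  have "((\<lambda>x. e\<^sup>2 - x \<bullet> x) has_derivative (\<lambda>h. - (2 * (x \<bullet> h)))) (at x)"
    by (auto intro!: derivative_eq_intros simp: inner_commute)
  from has_derivative_compose[OF this has_real_derivative_pos_part_power[of 0 "e\<^sup>2 - x \<bullet> x", unfolded has_field_derivative_def]]
  have "((\<lambda>x. max 0 (e\<^sup>2 - x \<bullet> x) ^ 2) has_derivative (\<lambda>h. - 4 * max 0 (e\<^sup>2 - x \<bullet> x) * (x \<bullet> h))) (at x)"
    by (simp add: numeral_2_eq_2 mult_ac)
  then have "((\<lambda>x. (- 6 * max 0 (e\<^sup>2 - x \<bullet> x) ^ 2) *\<^sub>R x) has_derivative
     (\<lambda>h. (- 6 * max 0 (e\<^sup>2 - x \<bullet> x) ^ 2) *\<^sub>R h + (- 6 * (- 4 * max 0 (e\<^sup>2 - x \<bullet> x) * (x \<bullet> h))) *\<^sub>R x)) (at x)"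
    by (intro has_derivative_scaleR has_derivative_mult_right has_derivative_ident)
  then show ?thesis
    by (simp add: kern_grad_def[abs_def] kern_hess_def[abs_def] algebra_simps)
qed

lemma continuous_kern: "continuous_on S (kern e)"
  and continuous_kern_grad: "continuous_on S (kern_grad e)"
  and continuous_kern_hess: "continuous_on S (\<lambda>x. kern_hess e x h)"
  unfolding kern_def[abs_def] kern_grad_def[abs_def] kern_hess_def[abs_def]
  by (intro continuous_intros)+

lemma kern_nonneg: "0 \<le> kern e x" by (simp add: kern_def)

lemma kern_minus: "kern e (- x) = kern e x" by (simp add: kern_def)

lemma kern_box: "\<exists>a::'a::euclidean_space. \<forall>x. x \<notin> cbox (-a) a \<longrightarrow> e \<le> norm x"
  using bounded_subset_cbox_symmetric[OF bounded_cball[of "0::'a" e]]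
  by (metis linorder_linear mem_cball_0 subsetD)

lemma kern_mult_integrable:
  fixes f :: "'a::euclidean_space \<Rightarrow> 'b::euclidean_space"
  assumes "continuous_on UNIV f" "0 < e"
  shows "(\<lambda>x. kern e x *\<^sub>R f x) integrable_on UNIV"
proof -
  obtain a :: 'a where "\<forall>x. x \<notin> cbox (-a) a \<longrightarrow> e \<le> norm x" using kern_box by blast
  then show ?thesis using assms
    by (intro compact_support_integral(1)[of _ "-a" a] continuous_intros continuous_kern) (auto simp: kern_zero)
qed

lemma kern_mass_pos:
  assumes "0 < e"
  shows "0 < integral UNIV (kern e :: 'a::euclidean_space \<Rightarrow> real)"
proof -
  obtain a :: 'a where a: "\<forall>x. x \<notin> cbox (-a) a \<longrightarrow> e \<le> norm x" using kern_box by blast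
  \<comment> \<open>The enlarged box has 0 in its interior, where the kernel is positive.\<close>
  define b where "b = (\<Sum>i\<in>Basis. (\<bar>a \<bullet> i\<bar> + 1) *\<^sub>R i)"
  have bi: "b \<bullet> i = \<bar>a \<bullet> i\<bar> + 1" if "i \<in> Basis" for i
    using that by (simp add: b_def)
  have "x \<in> cbox (-b) b" if "x \<in> cbox (-a) a" for x
    using that bi by (fastforce simp: mem_box)
  then have out: "kern e x = 0" if "x \<notin> cbox (-b) b" for x using that a assms kern_zero(1) by blast
  have int: "integral UNIV (kern e :: 'a \<Rightarrow> real) = integral (cbox (-b) b) (kern e)"
    by (rule compact_support_integral(2)[OF continuous_kern]) (rule out)
  have ge: "0 \<le> integral (cbox (-b) b) (kern e)"
    by (intro integral_nonneg integrable_continuous continuous_kern kern_nonneg)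
  have "integral (cbox (-b) b) (kern e) \<noteq> 0"
  proof
    assume "integral (cbox (-b) b) (kern e) = 0"
    then have "(kern e has_integral 0) (cbox (-b) b)"
      using integrable_integral[OF integrable_continuous[OF continuous_kern]] by metis
    moreover have "0 \<in> box (-b) b" using bi by (auto simp: mem_box)
    then have "box (-b) b \<noteq> {}" by blast
    moreover have "0 \<in> cbox (-b) b" using bi by (auto simp: mem_box)
    ultimately have "kern e (0::'a) = 0"
      by (intro has_integral_0_cbox_imp_0[OF continuous_kern]) (auto simp: kern_nonneg)
    then show False using assms by (simp add: kern_def)
  qed
  then show ?thesis using int ge by simp
qed

definition mollify :: "real \<Rightarrow> ('a::euclidean_space \<Rightarrow> real) \<Rightarrow> 'a \<Rightarrow> real" where
  "mollify e v x = integral UNIV (\<lambda>y. v y *\<^sub>R kern e (x - y)) / integral UNIV (kern e :: 'a \<Rightarrow> real)"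

text \<open>The definition keeps \<open>x\<close> in the kernel, where it can be differentiated.
  Moved into \<open>v\<close>, it displays the mollification as a weighted mean of translates, from
  which convexity and convergence are read off.\<close>

lemma mollify_average:
  fixes v :: "'a::euclidean_space \<Rightarrow> real"
  assumes v: "continuous_on UNIV v" and e: "0 < e"
  shows "mollify e v x = integral UNIV (\<lambda>u. kern e u *\<^sub>R v (x + u)) / integral UNIV (kern e :: 'a \<Rightarrow> real)"
proof -
  obtain a :: 'a where a: "cball x e \<subseteq> cbox (-a) a"
    using bounded_subset_cbox_symmetric[OF bounded_cball] by metis
  have "integral UNIV (\<lambda>u. v (u + x) *\<^sub>R kern e (x - (u + x))) = integral UNIV (\<lambda>y. v y *\<^sub>R kern e (x - y))"
  proof (rule compact_support_integral_shift)
    show "continuous_on UNIV (\<lambda>y. v y *\<^sub>R kern e (x - y))"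
      by (intro continuous_on_scaleR v continuous_on_compose2[OF continuous_kern] continuous_intros) auto
    fix y assume "y \<notin> cbox (-a) a"
    then have "e \<le> norm (x - y)" using a by (force simp: dist_norm)
    then show "v y *\<^sub>R kern e (x - y) = 0" using kern_zero(1)[OF e, of "x - y"] by simp
  qed
  moreover have "v (u + x) *\<^sub>R kern e (x - (u + x)) = kern e u *\<^sub>R v (x + u)" for u
    using kern_minus[of e u] by (simp add: add.commute)
  ultimately show ?thesis by (simp add: mollify_def)
qed

lemma mollify_convex:
  assumes v: "convex_on UNIV v" and e: "0 < e"
  shows "convex_on UNIV (mollify e v)"
proof
  fix t :: real and x y :: 'a assume t: "0 < t" "t < 1"
  have cv: "continuous_on UNIV (\<lambda>u. v (z + u))" for z
    by (intro continuous_on_compose2[OF convex_UNIV_continuous[OF v, of UNIV]] continuous_intros) auto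
  have I: "(\<lambda>u. kern e u *\<^sub>R v (z + u)) integrable_on UNIV" for z
    by (rule kern_mult_integrable[OF cv e])
  have "integral UNIV (\<lambda>u. kern e u *\<^sub>R v ((1 - t) *\<^sub>R x + t *\<^sub>R y + u))
     \<le> integral UNIV (\<lambda>u. (1 - t) *\<^sub>R (kern e u *\<^sub>R v (x + u)) + t *\<^sub>R (kern e u *\<^sub>R v (y + u)))"
  proof (rule integral_le[OF I])
    show "(\<lambda>u. (1 - t) *\<^sub>R (kern e u *\<^sub>R v (x + u)) + t *\<^sub>R (kern e u *\<^sub>R v (y + u))) integrable_on UNIV"
      by (intro integrable_add integrable_cmul I)
    fix u
    have "(1 - t) *\<^sub>R x + t *\<^sub>R y + u = (1 - t) *\<^sub>R (x + u) + t *\<^sub>R (y + u)"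
      by (simp add: algebra_simps)
    then have "v ((1 - t) *\<^sub>R x + t *\<^sub>R y + u) \<le> (1 - t) * v (x + u) + t * v (y + u)"
      using convex_onD[OF v, of t "x + u" "y + u"] t by simp
    from mult_left_mono[OF this kern_nonneg[of e u]]
    show "kern e u *\<^sub>R v ((1 - t) *\<^sub>R x + t *\<^sub>R y + u) \<le> (1 - t) *\<^sub>R (kern e u *\<^sub>R v (x + u)) + t *\<^sub>R (kern e u *\<^sub>R v (y + u))"
      by (simp add: algebra_simps)
  qed
  also have "\<dots> = (1 - t) * integral UNIV (\<lambda>u. kern e u *\<^sub>R v (x + u)) + t * integral UNIV (\<lambda>u. kern e u *\<^sub>R v (y + u))"
    by (subst integral_add[OF integrable_cmul[OF I] integrable_cmul[OF I]]) (simp only: integral_cmul, simp)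
  finally have "integral UNIV (\<lambda>u. kern e u *\<^sub>R v ((1 - t) *\<^sub>R x + t *\<^sub>R y + u)) / integral UNIV (kern e :: 'a \<Rightarrow> real)
     \<le> ((1 - t) * integral UNIV (\<lambda>u. kern e u *\<^sub>R v (x + u)) + t * integral UNIV (\<lambda>u. kern e u *\<^sub>R v (y + u)))
       / integral UNIV (kern e :: 'a \<Rightarrow> real)"
    using kern_mass_pos[OF e, where 'a='a] by (intro divide_right_mono) auto
  then show "mollify e v ((1 - t) *\<^sub>R x + t *\<^sub>R y) \<le> (1 - t) * mollify e v x + t * mollify e v y"
    by (simp add: mollify_average[OF convex_UNIV_continuous[OF v] e] add_divide_distrib)
qed simp

lemma mollify_close:
  assumes v: "continuous_on UNIV v" and e: "0 < e"
    and d: "\<And>u. norm u < e \<Longrightarrow> \<bar>v (x + u) - v x\<bar> \<le> d"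
  shows "\<bar>mollify e v x - v x\<bar> \<le> d"
proof -
  let ?c = "integral UNIV (kern e :: 'a \<Rightarrow> real)"
  have c: "0 < ?c" by (rule kern_mass_pos[OF e])
  have cv: "continuous_on UNIV (\<lambda>u. v (x + u))"
    by (intro continuous_on_compose2[OF v] continuous_intros) auto
  have I: "(\<lambda>u. kern e u *\<^sub>R v (x + u)) integrable_on UNIV" by (rule kern_mult_integrable[OF cv e])
  have Ik: "(\<lambda>u::'a. kern e u *\<^sub>R k) integrable_on UNIV" for k :: real
    by (intro kern_mult_integrable e continuous_intros)
  have ck: "integral UNIV (\<lambda>u::'a. kern e u *\<^sub>R k) = ?c * k" for k :: real by simp
  have "mollify e v x - v x = (integral UNIV (\<lambda>u. kern e u *\<^sub>R v (x + u)) - ?c * v x) / ?c"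
    using c by (simp add: mollify_average[OF v e] diff_divide_distrib)
  also have "\<dots> = integral UNIV (\<lambda>u. kern e u *\<^sub>R v (x + u) - kern e u *\<^sub>R v x) / ?c"
    by (simp only: integral_diff[OF I Ik] ck)
  finally have eq: "\<bar>mollify e v x - v x\<bar> = \<bar>integral UNIV (\<lambda>u. kern e u *\<^sub>R v (x + u) - kern e u *\<^sub>R v x)\<bar> / ?c"
    using c by simp
  have "norm (integral UNIV (\<lambda>u. kern e u *\<^sub>R v (x + u) - kern e u *\<^sub>R v x)) \<le> integral UNIV (\<lambda>u::'a. kern e u *\<^sub>R d)"
  proof (rule integral_norm_bound_integral[OF integrable_diff[OF I Ik] Ik])
    fix u
    have "norm (kern e u *\<^sub>R v (x + u) - kern e u *\<^sub>R v x) = kern e u * \<bar>v (x + u) - v x\<bar>"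
      using kern_nonneg[of e u] by (simp add: abs_mult flip: right_diff_distrib)
    also have "\<dots> \<le> kern e u * d"
      using d[of u] kern_nonneg[of e u] kern_zero(1)[OF e, of u] by (cases "norm u < e") (auto intro: mult_left_mono)
    finally show "norm (kern e u *\<^sub>R v (x + u) - kern e u *\<^sub>R v x) \<le> kern e u *\<^sub>R d" by simp
  qed
  then show ?thesis using c unfolding eq ck by (simp add: divide_le_eq mult.commute)
qed

lemma loc_unif_mollify:
  assumes v: "continuous_on UNIV v"
  shows "loc_unif (\<lambda>k. mollify (1 / real (Suc k)) v) v"
  unfolding loc_unif_def uniform_limit_iff
proof (intro allI impI)
  fix K :: "'a set" and d :: real assume K: "compact K" and d: "0 < d"
  obtain R where R: "K \<subseteq> ball 0 R" using bounded_subset_ballD[OF compact_imp_bounded[OF K], of 0] by blast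
  have "uniformly_continuous_on (cball 0 (R + 1)) v"
    by (rule compact_uniformly_continuous[OF continuous_on_subset[OF v] compact_cball]) simp
  then obtain r where r: "r > 0" "\<And>x y. x \<in> cball 0 (R + 1) \<Longrightarrow> y \<in> cball 0 (R + 1) \<Longrightarrow> dist y x < r \<Longrightarrow> dist (v y) (v x) < d/2"
    using d unfolding uniformly_continuous_on_def by (metis half_gt_zero)
  obtain N where N: "1 / real (Suc N) < r" using r(1) nat_approx_posE by blast
  have "\<forall>x\<in>K. dist (mollify (1 / real (Suc k)) v x) (v x) < d" if k: "N \<le> k" for k
  proof
    fix x assume x: "x \<in> K"
    have "\<bar>mollify (1 / real (Suc k)) v x - v x\<bar> \<le> d / 2"
    proof (rule mollify_close[OF v])
      fix u :: 'a assume u: "norm u < 1 / real (Suc k)"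
      have "1 / real (Suc k) \<le> 1 / real (Suc N)" using k by (intro divide_left_mono) auto
      then have "norm u < r" using u N by linarith
      moreover have "1 / real (Suc k) \<le> 1" by simp
      then have "norm u \<le> 1" using u by linarith
      moreover have "norm x < R" using R x by auto
      moreover have "norm (x + u) \<le> norm x + norm u" by (rule norm_triangle_ineq)
      ultimately have "dist (v (x + u)) (v x) < d / 2" by (intro r(2)) (auto simp: dist_norm[of "x + u" x])
      then show "\<bar>v (x + u) - v x\<bar> \<le> d / 2" by (simp add: dist_real_def)
    qed simp
    then show "dist (mollify (1 / real (Suc k)) v x) (v x) < d" using d by (simp add: dist_real_def)
  qed
  then show "\<forall>\<^sub>F k in sequentially. \<forall>x\<in>K. dist (mollify (1 / real (Suc k)) v x) (v x) < d"
    unfolding eventually_sequentially by blast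
qed

text \<open>Gradient and Hessian are carried along as explicit data. Symmetry of the Hessian is
  included because a mollification inherits it from the kernel.\<close>

definition C2_data :: "('a::euclidean_space \<Rightarrow> real) \<Rightarrow> ('a \<Rightarrow> 'a) \<Rightarrow> ('a \<Rightarrow> 'a \<Rightarrow> 'a) \<Rightarrow> bool" where
  "C2_data v g H \<longleftrightarrow> (\<forall>x. (v has_derivative (\<lambda>h. g x \<bullet> h)) (at x)) \<and>
     (\<forall>x. (g has_derivative H x) (at x)) \<and> (\<forall>x h k. H x h \<bullet> k = h \<bullet> H x k)"

lemma C2_mollify:
  assumes v: "continuous_on UNIV v" and e: "0 < e"
  shows "\<exists>g H. C2_data (mollify e v) g H"
proof -
  let ?c = "integral UNIV (kern e :: 'a \<Rightarrow> real)"
  have int: "(\<lambda>y. v y *\<^sub>R Q (x - y)) integrable_on UNIV"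
    if Q: "continuous_on UNIV Q" "\<And>x. e \<le> norm x \<Longrightarrow> Q x = 0" for Q :: "'a \<Rightarrow> 'b::euclidean_space" and x
  proof -
    obtain a :: 'a where a: "cball x e \<subseteq> cbox (-a) a"
      using bounded_subset_cbox_symmetric[OF bounded_cball] by metis
    show ?thesis
    proof (rule compact_support_integral(1))
      show "continuous_on UNIV (\<lambda>y. v y *\<^sub>R Q (x - y))"
        by (intro continuous_on_scaleR v continuous_on_compose2[OF Q(1)] continuous_intros) auto
      fix y assume "y \<notin> cbox (-a) a"
      then have "e \<le> norm (x - y)" using a by (force simp: dist_norm)
      then show "v y *\<^sub>R Q (x - y) = 0" using Q(2) by simp
    qed
  qed
  define g where "g x = (1 / ?c) *\<^sub>R integral UNIV (\<lambda>y. v y *\<^sub>R kern_grad e (x - y))" for x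
  define H where "H x h = (1 / ?c) *\<^sub>R integral UNIV (\<lambda>y. v y *\<^sub>R kern_hess e (x - y) h)" for x h
  have Ig: "(\<lambda>y. v y *\<^sub>R kern_grad e (x - y)) integrable_on UNIV" for x
    by (rule int[OF continuous_kern_grad kern_zero(2)[OF e]])
  have IH: "(\<lambda>y. v y *\<^sub>R kern_hess e (x - y) h) integrable_on UNIV" for x h
    by (rule int[of "\<lambda>x. kern_hess e x h", OF continuous_kern_hess kern_zero(3)[OF e]])
  have "(mollify e v has_derivative (\<lambda>h. g x \<bullet> h)) (at x)" for x
  proof -
    have "((\<lambda>x. integral UNIV (\<lambda>y. v y *\<^sub>R kern e (x - y))) has_derivative
      (\<lambda>h. integral UNIV (\<lambda>y. v y *\<^sub>R (kern_grad e (x - y) \<bullet> h)))) (at x)"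
      by (rule conv_has_derivative[OF v kern_has_derivative, where r = e])
         (auto intro!: continuous_intros continuous_kern_grad simp: kern_zero[OF e])
    then have "((\<lambda>x. (1 / ?c) *\<^sub>R integral UNIV (\<lambda>y. v y *\<^sub>R kern e (x - y))) has_derivative
      (\<lambda>h. (1 / ?c) *\<^sub>R integral UNIV (\<lambda>y. v y *\<^sub>R (kern_grad e (x - y) \<bullet> h)))) (at x)"
      by (rule has_derivative_scaleR_right)
    moreover have "(1 / ?c) *\<^sub>R integral UNIV (\<lambda>y. v y *\<^sub>R (kern_grad e (x - y) \<bullet> h)) = g x \<bullet> h" for h
      using integral_component_eq[OF Ig[of x], of h] by (simp add: g_def)
    moreover have "(\<lambda>x. (1 / ?c) *\<^sub>R integral UNIV (\<lambda>y. v y *\<^sub>R kern e (x - y))) = mollify e v"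
      by (simp add: mollify_def[abs_def])
    ultimately show ?thesis by simp
  qed
  moreover have "(g has_derivative H x) (at x)" for x
    unfolding g_def[abs_def] H_def[abs_def]
    by (intro has_derivative_scaleR_right conv_has_derivative[OF v kern_grad_has_derivative continuous_kern_hess, where r = e])
       (auto simp: kern_zero[OF e])
  moreover have "H x h \<bullet> k = h \<bullet> H x k" for x h k
  proof -
    have sym: "kern_hess e z h \<bullet> k = kern_hess e z k \<bullet> h" for z
      by (simp add: kern_hess_def inner_diff_left inner_commute algebra_simps)
    have "H x h \<bullet> k = (1 / ?c) * integral UNIV (\<lambda>y. v y *\<^sub>R kern_hess e (x - y) h \<bullet> k)"
      using integral_component_eq[OF IH] by (simp add: H_def)
    also have "\<dots> = (1 / ?c) * integral UNIV (\<lambda>y. v y *\<^sub>R kern_hess e (x - y) k \<bullet> h)"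
      by (simp add: sym)
    also have "\<dots> = H x k \<bullet> h" using integral_component_eq[OF IH] by (simp add: H_def)
    finally show ?thesis by (simp add: inner_commute)
  qed
  ultimately show ?thesis unfolding C2_data_def by blast
qed

text \<open>Along each line through \<open>x\<close> a convex function lies above its tangent, so
  the gradient is a subgradient. Any subgradient \<open>z\<close> makes \<open>x\<close> a minimum
  of \<open>v y - z \<bullet> y\<close>, where the derivative vanishes.\<close>

lemma C2_gradient_subdiff:
  assumes v: "convex_on UNIV v" and d: "C2_data v g H"
  shows "subdiff v x = {g x}"
proof -
  have dv: "(v has_derivative (\<lambda>h. g x \<bullet> h)) (at x)" for x using d by (simp add: C2_data_def)
  have "v x + g x \<bullet> (y - x) \<le> v y" for y
  proof -
    define f where "f t = v (x + t *\<^sub>R (y - x))" for t :: real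
    have "convex_on UNIV f"
    proof
      fix t a b :: real assume t: "0 < t" "t < 1"
      have "x + ((1 - t) *\<^sub>R a + t *\<^sub>R b) *\<^sub>R (y - x) = (1 - t) *\<^sub>R (x + a *\<^sub>R (y - x)) + t *\<^sub>R (x + b *\<^sub>R (y - x))"
        by (simp add: algebra_simps)
      then show "f ((1 - t) *\<^sub>R a + t *\<^sub>R b) \<le> (1 - t) * f a + t * f b"
        using convex_onD[OF v, of t "x + a *\<^sub>R (y - x)" "x + b *\<^sub>R (y - x)"] t by (simp add: f_def)
    qed simp
    moreover have "(f has_field_derivative g x \<bullet> (y - x)) (at 0)"
    proof -
      have "((\<lambda>t. x + t *\<^sub>R (y - x)) has_derivative (\<lambda>t. t *\<^sub>R (y - x))) (at 0)"
        by (auto intro!: derivative_eq_intros)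
      from has_derivative_compose[OF this, of v "\<lambda>h. g x \<bullet> h"] dv[of x]
      show ?thesis by (simp add: f_def[abs_def] has_field_derivative_def mult_commute_abs)
    qed
    ultimately have "f 1 - f 0 \<ge> g x \<bullet> (y - x) * (1 - 0)"
      by (intro convex_on_imp_above_tangent[of UNIV]) auto
    then show ?thesis by (simp add: f_def)
  qed
  then have "g x \<in> subdiff v x" by (simp add: subdiff_def)
  moreover have "z = g x" if z: "z \<in> subdiff v x" for z
  proof -
    have "((\<lambda>y. v y - z \<bullet> y) has_derivative (\<lambda>h. g x \<bullet> h - z \<bullet> h)) (at x)"
      by (intro has_derivative_diff dv bounded_linear_imp_has_derivative bounded_linear_inner_right)
    moreover have "\<forall>\<^sub>F y in at x. v x - z \<bullet> x \<le> v y - z \<bullet> y"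
      using z by (simp add: subdiff_iff_minimum)
    ultimately have "(\<lambda>h. g x \<bullet> h - z \<bullet> h) = (\<lambda>h. 0)" by (rule has_derivative_local_min)
    then have "(g x - z) \<bullet> (g x - z) = 0" by (metis inner_diff_left)
    then show ?thesis by simp
  qed
  ultimately show ?thesis by blast
qed

text \<open>The gradient is monotone, being a selection of subgradients, so
  \<open>g (x + t *\<^sub>R h) \<bullet> h\<close> is nondecreasing in \<open>t\<close>; its
  derivative at 0 is the quadratic form.\<close>

lemma C2_hessian_psd:
  fixes v :: "real^'n \<Rightarrow> real"
  assumes v: "convex_on UNIV v" and d: "C2_data v g H"
  shows "psd (matrix (H x))"
proof -
  have dg: "(g has_derivative H x) (at x)" and sym: "H x h \<bullet> k = h \<bullet> H x k" for x h k
    using d by (auto simp: C2_data_def)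
  have bl: "bounded_linear (H x)" using dg has_derivative_bounded_linear by blast
  then have mH: "matrix (H x) *v h = H x h" for h
    by (intro matrix_works) (simp add: linear_conv_bounded_linear[symmetric] linear_matrix_vector_mul_eq)
  have "transpose (matrix (H x)) = matrix (H x)"
  proof -
    have "H x (axis j 1) $ i = H x (axis i 1) $ j" for i j
      using sym[of x "axis j 1" "axis i 1"] by (simp add: inner_axis inner_axis')
    then show ?thesis by (simp add: vec_eq_iff transpose_def matrix_def)
  qed
  moreover have "0 \<le> h \<bullet> (matrix (H x) *v h)" for h
  proof -
    define f where "f t = g (x + t *\<^sub>R h) \<bullet> h" for t :: real
    have "mono_on UNIV f"
    proof (rule mono_onI)
      fix s t :: real assume st: "s \<le> t"
      have "0 \<le> (g (x + t *\<^sub>R h) - g (x + s *\<^sub>R h)) \<bullet> ((x + t *\<^sub>R h) - (x + s *\<^sub>R h))"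
        by (rule subdiff_monotone[of _ v]) (simp_all add: C2_gradient_subdiff[OF v d])
      also have "\<dots> = (t - s) * (f t - f s)"
        by (simp add: f_def inner_diff_left algebra_simps flip: scaleR_diff_left)
      finally show "f s \<le> f t" using st by (cases "s = t") (auto simp: zero_le_mult_iff)
    qed
    moreover have "(f has_real_derivative H x h \<bullet> h) (at 0)"
    proof -
      have "((\<lambda>t. x + t *\<^sub>R h) has_derivative (\<lambda>t. t *\<^sub>R h)) (at 0)"
        by (auto intro!: derivative_eq_intros)
      from has_derivative_inner_left[OF has_derivative_compose[OF this, of g "H x"], of h] dg[of x]
      show ?thesis
        using linear_scale[OF bounded_linear.linear[OF bl]]
        by (simp add: f_def[abs_def] has_field_derivative_def mult_commute_abs)
    qed
    ultimately have "H x h \<bullet> h \<ge> 0" by (rule mono_on_imp_deriv_nonneg) simp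
    then show ?thesis by (simp add: mH inner_commute)
  qed
  ultimately show ?thesis by (simp add: psd_def)
qed

lemma integrable_pull_sub:
  assumes v: "convex_on UNIV v" and \<phi>: "test_fun \<phi>"
  shows "integrable lebesgue (pull_sub v \<phi>)"
proof -
  have c\<phi>: "continuous_on UNIV \<phi>" using \<phi> by (simp add: test_fun_def)
  obtain K where K: "compact K" "\<And>x. x \<notin> K \<Longrightarrow> \<phi> x = 0" using \<phi> by (auto simp: test_fun_def)
  obtain C where C: "\<And>v z. norm (pull_sub v \<phi> z) \<le> C * indicator (subd v K) z"
    using pull_sub_bound[OF c\<phi> K] by blast
  have lm: "subd v K \<in> lmeasurable"
    using subd_compact[OF v K(1)] by (rule lmeasurable_compact)
  show ?thesis
  proof (rule Bochner_Integration.integrable_bound)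
    show "integrable lebesgue (\<lambda>z. \<bar>C\<bar> * indicator (subd v K) z)"
      using lm by (intro integrable_mult_right integrable_real_indicator) (simp_all add: fmeasurable_def)
    show "pull_sub v \<phi> \<in> borel_measurable lebesgue"
      by (rule pull_sub_measurable[OF v borel_measurable_continuous_onI[OF c\<phi>]])
    have "norm (pull_sub v \<phi> z) \<le> norm (\<bar>C\<bar> * indicator (subd v K) z)" for z
      using C[of v z] by (auto simp: indicator_def split: if_splits)
    then show "AE z in lebesgue. norm (pull_sub v \<phi> z) \<le> norm (\<bar>C\<bar> * indicator (subd v K) z)" by simp
  qed
qed

text \<open>Injectivity of \<open>g\<close> empties \<open>multi_subd v\<close>, and the
  substitution \<open>z = g x\<close> in the integral over slopes produces the Jacobian of the
  gradient, which is nonnegative.\<close>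

lemma MA_measure_C2:
  fixes v :: "real^'n::{finite,wellorder} \<Rightarrow> real"
  assumes v: "convex_on UNIV v" and d: "C2_data v g H" and inj: "inj g" and \<phi>: "test_fun \<phi>"
  shows "(\<lambda>x. det (matrix (H x)) * \<phi> x) integrable_on UNIV"
    and "integral\<^sup>L (MA_measure v) \<phi> = integral UNIV (\<lambda>x. det (matrix (H x)) * \<phi> x)"
proof -
  have subd: "subd v B = g ` B" for B by (auto simp: subd_def C2_gradient_subdiff[OF v d])
  have multi: "multi_subd v = {}"
    using inj by (auto simp: multi_subd_def C2_gradient_subdiff[OF v d] inj_def)
  have arg: "argsub v (g x) = x" for x
    by (rule argsub_eq) (auto simp: C2_gradient_subdiff[OF v d] multi)
  have pull: "pull_sub v \<phi> (g x) = \<phi> x" for x by (simp add: pull_sub_def subd multi arg)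
  have det: "\<bar>det (matrix (H x))\<bar> = det (matrix (H x))" for x
    using det_psd_nonneg[OF C2_hessian_psd[OF v d]] by simp
  have \<phi>m: "\<phi> \<in> borel_measurable borel"
    using \<phi> by (auto simp: test_fun_def intro: borel_measurable_continuous_onI)
  have off: "pull_sub v \<phi> z = 0" if "z \<notin> range g" for z using that by (simp add: pull_sub_def subd)
  have ind: "(\<lambda>z. indicator (range g) z *\<^sub>R pull_sub v \<phi> z) = pull_sub v \<phi>"
    using off by (auto simp: fun_eq_iff indicator_def)
  have ai: "pull_sub v \<phi> absolutely_integrable_on range g"
    unfolding set_integrable_def ind by (rule integrable_pull_sub[OF v \<phi>])
  have b: "integral (range g) (pull_sub v \<phi>) = integral\<^sup>L (MA_measure v) \<phi>"
    using set_lebesgue_integral_eq_integral(2)[OF ai]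
    unfolding set_lebesgue_integral_def ind integral_MA_measure[OF v \<phi>m] by simp
  let ?b = "integral\<^sup>L (MA_measure v) \<phi>"
  \<comment> \<open>The change of variables formula is stated for vector valued functions, so the
    integrand is viewed in \<open>real^1\<close>.\<close>
  have "(\<lambda>x. \<bar>det (matrix (H x))\<bar> *\<^sub>R (vec (pull_sub v \<phi> (g x)) :: real^1)) absolutely_integrable_on UNIV \<and>
        integral UNIV (\<lambda>x. \<bar>det (matrix (H x))\<bar> *\<^sub>R (vec (pull_sub v \<phi> (g x)) :: real^1)) = vec ?b \<longleftrightarrow>
        (\<lambda>z. vec (pull_sub v \<phi> z) :: real^1) absolutely_integrable_on (g ` UNIV) \<and>
        integral (g ` UNIV) (\<lambda>z. vec (pull_sub v \<phi> z) :: real^1) = vec ?b"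
    using d inj by (intro has_absolute_integral_change_of_variables) (auto simp: C2_data_def)
  then have "(\<lambda>x. det (matrix (H x)) * \<phi> x) absolutely_integrable_on UNIV \<and>
      integral UNIV (\<lambda>x. det (matrix (H x)) * \<phi> x) = ?b"
    using ai b by (simp add: absolutely_integrable_on_1_iff integral_on_1_eq pull det)
  then show "(\<lambda>x. det (matrix (H x)) * \<phi> x) integrable_on UNIV"
    and "?b = integral UNIV (\<lambda>x. det (matrix (H x)) * \<phi> x)"
    by (auto intro: set_lebesgue_integral_eq_integral(1))
qed

text \<open>The only slope is 0, and it lies in \<open>multi_subd\<close> because it is attained
  everywhere. The zero function arises when all coefficients vanish, as for the empty index set in
  polarization.\<close>

lemma MA_measure_zero:
  fixes \<phi> :: "'a::euclidean_space \<Rightarrow> real"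
  assumes "\<phi> \<in> borel_measurable borel"
  shows "integral\<^sup>L (MA_measure (\<lambda>x::'a. 0)) \<phi> = 0"
proof -
  obtain i :: 'a where "i \<in> Basis" using nonempty_Basis by blast
  then have i: "i \<noteq> 0" by auto
  have s: "subdiff (\<lambda>x::'a. 0) b = {0}" for b
  proof -
    have "z = 0" if "z \<in> subdiff (\<lambda>x::'a. 0) b" for z
    proof -
      have "z \<bullet> z \<le> 0" using subdiffD[OF that, of "b + z"] by simp
      then show ?thesis by (metis antisym inner_eq_zero_iff inner_ge_zero)
    qed
    then show ?thesis by (auto simp: subdiff_def)
  qed
  have "multi_subd (\<lambda>x::'a. 0) = {0}" using i by (auto simp: multi_subd_def s)
  then have "pull_sub (\<lambda>x::'a. 0) \<phi> z = 0" for z by (auto simp: pull_sub_def subd_def s)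
  then have "pull_sub (\<lambda>x::'a. 0) \<phi> = (\<lambda>_. 0)" by blast
  then show ?thesis using integral_MA_measure[of "\<lambda>x::'a. 0" \<phi>] assms by (simp add: convex_on_const)
qed

text \<open>Strict monotonicity of the gradient implies injectivity and, unlike injectivity,
  survives nonnegative combinations with some positive coefficient.\<close>

definition strong_C2 :: "('a::euclidean_space \<Rightarrow> real) \<Rightarrow> ('a \<Rightarrow> 'a) \<Rightarrow> ('a \<Rightarrow> 'a \<Rightarrow> 'a) \<Rightarrow> bool" where
  "strong_C2 v g H \<longleftrightarrow> convex_on UNIV v \<and> C2_data v g H \<and> (\<forall>x y. x \<noteq> y \<longrightarrow> 0 < (g x - g y) \<bullet> (x - y))"

lemma convex_on_lincomb:
  assumes "\<And>i. i \<in> I \<Longrightarrow> convex_on S (v i)" "\<And>i. i \<in> I \<Longrightarrow> 0 \<le> lam i" "convex S"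
  shows "convex_on S (\<lambda>x. \<Sum>i\<in>I. lam i * v i x)"
  using assms
proof (induction I rule: infinite_finite_induct)
  case (insert i I)
  then show ?case by (simp, intro convex_on_add convex_on_cmul) auto
qed (simp_all add: convex_on_const)

text \<open>Mollification provides smoothness and keeps convexity. The added term
  \<open>e k * (x \<bullet> x)\<close> makes the gradient strictly monotone and vanishes locally
  uniformly.\<close>

lemma strong_C2_approx:
  assumes v: "convex_on UNIV v"
  shows "\<exists>w g H. (\<forall>k. strong_C2 (w k) (g k) (H k)) \<and> loc_unif w v"
proof -
  define e where "e k = 1 / real (Suc k)" for k
  have e: "0 < e k" for k by (simp add: e_def)
  obtain g H where gH: "\<And>k. C2_data (mollify (e k) v) (g k) (H k)"
    using C2_mollify[OF convex_UNIV_continuous[OF v] e] by metis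
  define w where "w k x = mollify (e k) v x + e k * (x \<bullet> x)" for k x
  have sq: "convex_on UNIV (\<lambda>x::'a. x \<bullet> x)"
  proof
    fix t :: real and x y :: 'a assume t: "0 < t" "t < 1"
    have "(1 - t) * (x \<bullet> x) + t * (y \<bullet> y) - ((1 - t) *\<^sub>R x + t *\<^sub>R y) \<bullet> ((1 - t) *\<^sub>R x + t *\<^sub>R y) = t * (1 - t) * ((x - y) \<bullet> (x - y))"
      by (simp add: inner_diff_left inner_diff_right inner_add_left inner_add_right inner_commute algebra_simps)
    also have "\<dots> \<ge> 0" using t by simp
    finally show "((1 - t) *\<^sub>R x + t *\<^sub>R y) \<bullet> ((1 - t) *\<^sub>R x + t *\<^sub>R y) \<le> (1 - t) * (x \<bullet> x) + t * (y \<bullet> y)" by simp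
  qed simp
  have mc: "convex_on UNIV (mollify (e k) v)" for k by (rule mollify_convex[OF v e])
  have "strong_C2 (w k) (\<lambda>x. g k x + (2 * e k) *\<^sub>R x) (\<lambda>x h. H k x h + (2 * e k) *\<^sub>R h)" for k
    unfolding strong_C2_def
  proof (intro conjI allI impI)
    show "convex_on UNIV (w k)" unfolding w_def
      using e[of k] by (intro convex_on_add mc convex_on_cmul sq) simp
    show "C2_data (w k) (\<lambda>x. g k x + (2 * e k) *\<^sub>R x) (\<lambda>x h. H k x h + (2 * e k) *\<^sub>R h)"
      unfolding C2_data_def
    proof (intro conjI allI)
      fix x h l
      have "((\<lambda>x. mollify (e k) v x + e k * (x \<bullet> x)) has_derivative (\<lambda>h. g k x \<bullet> h + e k * (x \<bullet> h + h \<bullet> x))) (at x)"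
        using gH[of k] unfolding C2_data_def
        by (intro has_derivative_add has_derivative_mult_right has_derivative_inner has_derivative_ident) auto
      then show "(w k has_derivative (\<lambda>h. (g k x + (2 * e k) *\<^sub>R x) \<bullet> h)) (at x)"
        by (simp add: w_def[abs_def] inner_add_left inner_commute algebra_simps)
      show "((\<lambda>x. g k x + (2 * e k) *\<^sub>R x) has_derivative (\<lambda>h. H k x h + (2 * e k) *\<^sub>R h)) (at x)"
        using gH[of k] unfolding C2_data_def
        by (intro has_derivative_add has_derivative_scaleR_right has_derivative_ident) auto
      show "(H k x h + (2 * e k) *\<^sub>R h) \<bullet> l = h \<bullet> (H k x l + (2 * e k) *\<^sub>R l)"
        using gH[of k] unfolding C2_data_def by (simp add: inner_add_left inner_add_right)
    qed
    fix x y :: 'a assume "x \<noteq> y"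
    have "0 \<le> (g k x - g k y) \<bullet> (x - y)"
      by (rule subdiff_monotone[of _ "mollify (e k) v"]) (simp_all add: C2_gradient_subdiff[OF mc gH])
    moreover have "0 < (2 * e k) * ((x - y) \<bullet> (x - y))" using \<open>x \<noteq> y\<close> e[of k] by simp
    moreover have "(g k x + (2 * e k) *\<^sub>R x - (g k y + (2 * e k) *\<^sub>R y)) \<bullet> (x - y)
        = (g k x - g k y) \<bullet> (x - y) + (2 * e k) * ((x - y) \<bullet> (x - y))"
      by (simp add: inner_diff_left inner_add_left algebra_simps)
    ultimately show "0 < (g k x + (2 * e k) *\<^sub>R x - (g k y + (2 * e k) *\<^sub>R y)) \<bullet> (x - y)" by linarith
  qed
  moreover have "loc_unif w v"
    unfolding loc_unif_def
  proof (intro allI impI)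
    fix K :: "'a set" assume K: "compact K"
    have 1: "uniform_limit K (\<lambda>k. mollify (e k) v) v sequentially"
      using loc_unif_mollify[OF convex_UNIV_continuous[OF v]] K by (simp add: loc_unif_def e_def)
    have "bounded ((\<lambda>x. x \<bullet> x) ` K)"
      by (intro compact_imp_bounded compact_continuous_image K continuous_intros)
    then obtain C where C: "\<And>x. x \<in> K \<Longrightarrow> x \<bullet> x \<le> C" "0 < C"
      unfolding bounded_pos by (metis abs_le_D1 image_eqI real_norm_def)
    have 2: "uniform_limit K (\<lambda>k x. e k * (x \<bullet> x)) (\<lambda>x. 0) sequentially"
      unfolding uniform_limit_iff
    proof (intro allI impI)
      fix d :: real assume "0 < d"
      have "(\<lambda>k. e k * C) \<longlonglongrightarrow> 0"
        using tendsto_mult_left_zero[OF LIMSEQ_inverse_real_of_nat, of C] by (simp add: e_def inverse_eq_divide)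
      then have "\<forall>\<^sub>F k in sequentially. e k * C < d"
        using \<open>0 < d\<close> by (rule order_tendstoD(2))
      then show "\<forall>\<^sub>F k in sequentially. \<forall>x\<in>K. dist (e k * (x \<bullet> x)) 0 < d"
      proof eventually_elim
        case (elim k)
        have "e k * (x \<bullet> x) < d" if "x \<in> K" for x
          using mult_left_mono[OF C(1)[OF that], of "e k"] elim e[of k] by linarith
        then show ?case using e[of k] by (simp add: dist_real_def abs_mult)
      qed
    qed
    show "uniform_limit K w v sequentially"
      using uniform_limit_add[OF 1 2] by (simp add: w_def[abs_def])
  qed
  ultimately show ?thesis by (intro exI conjI allI)
qed

lemma loc_unif_lincomb:
  fixes v :: "'k \<Rightarrow> 'a::euclidean_space \<Rightarrow> real"
  assumes "finite I" "\<And>i. i \<in> I \<Longrightarrow> loc_unif (w i) (v i)"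
  shows "loc_unif (\<lambda>k x. \<Sum>i\<in>I. lam i * w i k x) (\<lambda>x. \<Sum>i\<in>I. lam i * v i x)"
  unfolding loc_unif_def
proof (intro allI impI)
  fix K :: "'a set" assume K: "compact K"
  have lim: "uniform_limit K (\<lambda>k x. lam i * w i k x) (\<lambda>x. lam i * v i x) sequentially" if "i \<in> I" for i
    using assms(2)[OF that] K unfolding loc_unif_def
    by (intro bounded_linear.uniform_limit[OF bounded_linear_mult_right]) auto
  have "uniform_limit K (\<lambda>k x. \<Sum>i\<in>J. lam i * w i k x) (\<lambda>x. \<Sum>i\<in>J. lam i * v i x) sequentially"
    if "finite J" "J \<subseteq> I" for J
    using that
  proof (induction J rule: finite_induct)
    case (insert i J)
    then show ?case using lim[of i] by (simp add: uniform_limit_add)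
  qed (simp add: uniform_limit_const)
  then show "uniform_limit K (\<lambda>k x. \<Sum>i\<in>I. lam i * w i k x) (\<lambda>x. \<Sum>i\<in>I. lam i * v i x) sequentially"
    using assms(1) by blast
qed

text \<open>With a positive coefficient the combined gradient is injective and
  \<open>MA_measure_C2\<close> applies. If all coefficients vanish, both sides are 0.\<close>

lemma MA_measure_strong_C2_lincomb:
  fixes v :: "'k \<Rightarrow> real^'n::{finite,wellorder} \<Rightarrow> real"
  assumes I: "finite I" and v: "\<And>i. i \<in> I \<Longrightarrow> strong_C2 (v i) (g i) (H i)"
    and lam: "\<And>i. i \<in> I \<Longrightarrow> 0 \<le> lam i" and \<phi>: "test_fun \<phi>"
  shows "(\<lambda>x. det (\<Sum>i\<in>I. lam i *\<^sub>R matrix (H i x)) * \<phi> x) integrable_on UNIV \<and>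
    integral\<^sup>L (MA_measure (\<lambda>x. \<Sum>i\<in>I. lam i * v i x)) \<phi> =
         integral UNIV (\<lambda>x. det (\<Sum>i\<in>I. lam i *\<^sub>R matrix (H i x)) * \<phi> x)"
proof (cases "\<exists>i\<in>I. lam i \<noteq> 0")
  case False
  have "det (0 :: real^'n::_^'n::_) = 0" by (simp add: det_def zero_power)
  moreover have "(\<lambda>x. \<Sum>i\<in>I. lam i * v i x) = (\<lambda>x. 0)" "(\<Sum>i\<in>I. lam i *\<^sub>R matrix (H i x)) = 0" for x
    using False by (auto intro!: sum.neutral)
  moreover have "\<phi> \<in> borel_measurable borel"
    using \<phi> by (auto simp: test_fun_def intro: borel_measurable_continuous_onI)
  ultimately show ?thesis by (simp add: MA_measure_zero integrable_0)
next
  case True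
  then obtain j where j: "j \<in> I" "lam j > 0" using lam by force
  define G where "G x = (\<Sum>i\<in>I. lam i *\<^sub>R g i x)" for x
  have vc: "convex_on UNIV (v i)" and vd: "C2_data (v i) (g i) (H i)"
    and vm: "x \<noteq> y \<Longrightarrow> 0 < (g i x - g i y) \<bullet> (x - y)" if "i \<in> I" for i x y
    using v[OF that] by (auto simp: strong_C2_def)
  have C: "C2_data (\<lambda>x. \<Sum>i\<in>I. lam i * v i x) G (\<lambda>x h. \<Sum>i\<in>I. lam i *\<^sub>R H i x h)"
    unfolding C2_data_def
  proof (intro conjI allI)
    fix x h l
    have "((\<lambda>x. \<Sum>i\<in>I. lam i * v i x) has_derivative (\<lambda>h. \<Sum>i\<in>I. lam i * (g i x \<bullet> h))) (at x)"
      using vd by (intro has_derivative_sum has_derivative_mult_right) (auto simp: C2_data_def)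
    then show "((\<lambda>x. \<Sum>i\<in>I. lam i * v i x) has_derivative (\<lambda>h. G x \<bullet> h)) (at x)"
      by (simp add: G_def inner_sum_left)
    show "(G has_derivative (\<lambda>h. \<Sum>i\<in>I. lam i *\<^sub>R H i x h)) (at x)"
      unfolding G_def[abs_def]
      using vd by (intro has_derivative_sum has_derivative_scaleR_right) (auto simp: C2_data_def)
    show "(\<Sum>i\<in>I. lam i *\<^sub>R H i x h) \<bullet> l = h \<bullet> (\<Sum>i\<in>I. lam i *\<^sub>R H i x l)"
      using vd by (auto simp: C2_data_def inner_sum_left inner_sum_right intro!: sum.cong)
  qed
  have "inj G"
  proof (rule injI, rule ccontr)
    fix x y assume xy: "G x = G y" "x \<noteq> y"
    have "0 < (\<Sum>i\<in>I. lam i * ((g i x - g i y) \<bullet> (x - y)))"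
    proof (rule sum_pos2[OF I j(1)])
      show "0 < lam j * ((g j x - g j y) \<bullet> (x - y))" using j vm[OF j(1) xy(2)] by simp
      show "0 \<le> lam i * ((g i x - g i y) \<bullet> (x - y))" if "i \<in> I" for i
        using lam[OF that] vm[OF that xy(2)] by simp
    qed
    also have "\<dots> = (G x - G y) \<bullet> (x - y)"
      by (simp add: G_def inner_sum_left sum_subtractf[symmetric] flip: scaleR_diff_right)
    finally show False using xy(1) by simp
  qed
  moreover have "matrix (\<lambda>h. \<Sum>i\<in>I. lam i *\<^sub>R H i x h) = (\<Sum>i\<in>I. lam i *\<^sub>R matrix (H i x))" for x
    by (simp add: matrix_def vec_eq_iff)
  ultimately show ?thesis
    using MA_measure_C2[OF convex_on_lincomb[OF vc lam convex_UNIV] C _ \<phi>] by simp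
qed

text \<open>Weak convergence reduces this to twice differentiable functions, where the measures have the
  Hessian determinants as densities.\<close>
theorem MA_measure_det_inequality:
  fixes v :: "'k \<Rightarrow> real^'n::{finite,wellorder} \<Rightarrow> real" and L :: "'j \<Rightarrow> 'k \<Rightarrow> real"
  assumes I: "finite I" and J: "finite J"
    and v: "\<And>i. i \<in> I \<Longrightarrow> convex_on UNIV (v i)" and L: "\<And>j i. j \<in> J \<Longrightarrow> i \<in> I \<Longrightarrow> 0 \<le> L j i"
    and det: "\<And>A :: 'k \<Rightarrow> real^'n::_^'n::_. (\<And>i. i \<in> I \<Longrightarrow> psd (A i)) \<Longrightarrow> 0 \<le> (\<Sum>j\<in>J. c j * det (\<Sum>i\<in>I. L j i *\<^sub>R A i))"
    and B: "B \<in> sets borel" "bounded B"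
  shows "0 \<le> (\<Sum>j\<in>J. c j * MA_real (\<lambda>x. \<Sum>i\<in>I. L j i * v i x) B)"
proof (rule signed_MA_nonneg[OF J _ _ B])
  show "convex_on UNIV (\<lambda>x. \<Sum>i\<in>I. L j i * v i x)" if "j \<in> J" for j
    by (rule convex_on_lincomb[OF v L[OF that] convex_UNIV])
  fix \<phi> :: "real^'n::_ \<Rightarrow> real" assume \<phi>: "test_fun \<phi>"
  have "\<forall>i\<in>I. \<exists>w g H. (\<forall>k. strong_C2 (w k) (g k) (H k)) \<and> loc_unif w (v i)"
    using strong_C2_approx[OF v] by blast
  then obtain w g H where w: "\<And>i k. i \<in> I \<Longrightarrow> strong_C2 (w i k) (g i k) (H i k)"
    and lim: "\<And>i. i \<in> I \<Longrightarrow> loc_unif (w i) (v i)" by metis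
  have wc: "convex_on UNIV (w i k)" and wd: "C2_data (w i k) (g i k) (H i k)" if "i \<in> I" for i k
    using w[OF that] by (auto simp: strong_C2_def)
  obtain K where K: "compact K" "\<And>x. x \<notin> K \<Longrightarrow> \<phi> x = 0" and c\<phi>: "continuous_on UNIV \<phi>" and pos: "\<And>x. 0 \<le> \<phi> x"
    using \<phi> by (auto simp: test_fun_def)
  have "(\<lambda>k. \<Sum>j\<in>J. c j * integral\<^sup>L (MA_measure (\<lambda>x. \<Sum>i\<in>I. L j i * w i k x)) \<phi>) \<longlonglongrightarrow>
      (\<Sum>j\<in>J. c j * integral\<^sup>L (MA_measure (\<lambda>x. \<Sum>i\<in>I. L j i * v i x)) \<phi>)"
  proof (intro tendsto_sum tendsto_mult tendsto_const)
    fix j assume j: "j \<in> J"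
    show "(\<lambda>k. integral\<^sup>L (MA_measure (\<lambda>x. \<Sum>i\<in>I. L j i * w i k x)) \<phi>) \<longlonglongrightarrow>
        integral\<^sup>L (MA_measure (\<lambda>x. \<Sum>i\<in>I. L j i * v i x)) \<phi>"
      by (rule MA_measure_weak_convergence[OF loc_unif_lincomb[OF I lim]
            convex_on_lincomb[OF v L[OF j] convex_UNIV] convex_on_lincomb[OF wc L[OF j] convex_UNIV] c\<phi> K])
  qed
  moreover have "0 \<le> (\<Sum>j\<in>J. c j * integral\<^sup>L (MA_measure (\<lambda>x. \<Sum>i\<in>I. L j i * w i k x)) \<phi>)" for k
  proof -
    define D where "D j x = det (\<Sum>i\<in>I. L j i *\<^sub>R matrix (H i k x)) * \<phi> x" for j x
    have D: "D j integrable_on UNIV"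
      "integral\<^sup>L (MA_measure (\<lambda>x. \<Sum>i\<in>I. L j i * w i k x)) \<phi> = integral UNIV (D j)" if "j \<in> J" for j
      using MA_measure_strong_C2_lincomb[of I "\<lambda>i. w i k" "\<lambda>i. g i k" "\<lambda>i. H i k" "L j" \<phi>, OF I w L[OF that] \<phi>]
      by (auto simp: D_def[abs_def])
    have "(\<Sum>j\<in>J. c j * integral\<^sup>L (MA_measure (\<lambda>x. \<Sum>i\<in>I. L j i * w i k x)) \<phi>) = (\<Sum>j\<in>J. integral UNIV (\<lambda>x. c j * D j x))"
      using D by (simp add: integral_mult_right)
    also have "\<dots> = integral UNIV (\<lambda>x. \<Sum>j\<in>J. c j * D j x)"
      by (rule integral_sum[symmetric, OF J]) (intro integrable_on_mult_right D(1))
    also have "\<dots> \<ge> 0"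
    proof (rule integral_nonneg)
      show "(\<lambda>x. \<Sum>j\<in>J. c j * D j x) integrable_on UNIV"
        by (intro integrable_sum J integrable_on_mult_right D(1))
      fix x
      \<comment> \<open>The matrix inequality enters here, applied at each point to the
        Hessians.\<close>
      have "0 \<le> (\<Sum>j\<in>J. c j * det (\<Sum>i\<in>I. L j i *\<^sub>R matrix (H i k x)))"
        by (rule det) (rule C2_hessian_psd[OF wc wd])
      then have "0 \<le> (\<Sum>j\<in>J. c j * det (\<Sum>i\<in>I. L j i *\<^sub>R matrix (H i k x))) * \<phi> x"
        using pos by simp
      then show "0 \<le> (\<Sum>j\<in>J. c j * D j x)" by (simp add: D_def sum_distrib_right mult.assoc)
    qed
    finally show ?thesis .
  qed
  ultimately show "0 \<le> (\<Sum>j\<in>J. c j * integral\<^sup>L (MA_measure (\<lambda>x. \<Sum>i\<in>I. L j i * v i x)) \<phi>)"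
    by (intro LIMSEQ_le_const) auto
qed

subsection \<open>Isometries and coordinates\<close>

lemma linear_borel_measurable:
  fixes L :: "'a::euclidean_space \<Rightarrow> 'b::euclidean_space"
  assumes "linear L" shows "L \<in> borel_measurable borel"
  using assms linear_conv_bounded_linear[of L] linear_continuous_on[of L]
  by (intro borel_measurable_continuous_onI) blast

lemma isometry_bij:
  fixes L :: "'a::euclidean_space \<Rightarrow> 'b::euclidean_space"
  assumes L: "linear L" "\<And>x. norm (L x) = norm x" and dim: "DIM('a) = DIM('b)"
  shows "bij L"
proof -
  have inj: "inj L" using L linear_injective_0 norm_eq_zero by metis
  have "dim (range L) = DIM('b)"
    using dim_image_eq[OF L(1), of UNIV] inj dim by (simp add: dim_UNIV)
  then have "span (range L) = UNIV" by (simp add: dim_eq_full)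
  then have "surj L" using span_eq_iff[of "range L"] linear_subspace_image[OF L(1) subspace_UNIV] by simp
  then show ?thesis using inj by (simp add: bij_def)
qed

text \<open>Balls are preserved with their volume, and by Vitali's covering theorem they determine
  the measure of open sets.\<close>
lemma distr_lborel_isometry:
  fixes L :: "'a::euclidean_space \<Rightarrow> 'b::euclidean_space"
  assumes L: "linear L" "\<And>x. norm (L x) = norm x" and dim: "DIM('a) = DIM('b)"
  shows "distr lborel borel L = lborel"
proof (rule lborel_eqI[symmetric])
  have "bij L" by (rule isometry_bij[OF assms])
  define M where "M = inv L"
  have LM: "L (M y) = y" and iL: "M (L x) = x" for x y
    using \<open>bij L\<close> by (simp_all add: M_def bij_def surj_f_inv_f)
  have dL: "dist (L x) (L y) = dist x y" for x y
    using L(2)[of "x - y"] by (simp add: dist_norm linear_diff[OF L(1)])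
  have dM: "dist (M x) (M y) = dist x y" for x y using dL[of "M x" "M y"] by (simp add: LM)
  have Lm: "L \<in> borel_measurable borel"
    by (rule linear_borel_measurable[OF L(1)])
  have ball: "L -` ball c r = ball (M c) r" for c r
    using dL LM by (auto simp: mem_ball) (metis dL LM)+
  have eball: "emeasure lborel (L -` ball c r) = emeasure lborel (ball c r)" for c r
  proof (cases "0 \<le> r")
    case True
    then show ?thesis unfolding ball by (simp add: emeasure_ball dim)
  next
    case False
    then have e: "ball (M c) r = {}" "ball c r = {}" by auto
    show ?thesis unfolding ball e by simp
  qed
  \<comment> \<open>Needed for the part of an open set that the covering balls miss; the inverse of
    \<open>L\<close> is an isometry, hence Lipschitz.\<close>
  have neg: "negligible (L -` N)" if N: "negligible N" for N
  proof -
    have "negligible (M ` N)"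
      by (rule negligible_locally_Lipschitz_image[OF _ N])
         (auto simp: dim intro!: exI[of _ UNIV] exI[of _ 1] simp: dM[unfolded dist_norm])
    moreover have "L -` N = M ` N" using LM iL by (auto simp: image_iff) metis
    ultimately show ?thesis by simp
  qed
  have open_eq: "emeasure lborel (L -` U) = emeasure lborel U" if U: "open U" for U
  proof -
    \<comment> \<open>The balls inside \<open>U\<close>, as pairs of centre and radius. Each point
      of \<open>U\<close> lies in such balls of arbitrarily small radius, as a Vitali covering
      requires.\<close>
    define K where "K = {(c, r). 0 < r \<and> ball c r \<subseteq> U}"
    have cov: "\<exists>i. i \<in> K \<and> x \<in> ball (fst i) (snd i) \<and> snd i < d" if "x \<in> U" "0 < d" for x d
    proof -
      obtain e where e: "e > 0" "ball x e \<subseteq> U" using U \<open>x \<in> U\<close> openE by blast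
      have "ball x (min e (d/2)) \<subseteq> U" using e(2) by auto
      then show ?thesis using e \<open>0 < d\<close> by (intro exI[of _ "(x, min e (d/2))"]) (auto simp: K_def)
    qed
    obtain C where C: "countable C" "C \<subseteq> K"
      "pairwise (\<lambda>i j. disjnt (ball (fst i) (snd i)) (ball (fst j) (snd j))) C"
      "negligible (U - (\<Union>i\<in>C. ball (fst i) (snd i)))"
      using Vitali_covering_theorem_balls[of U K fst snd, OF cov] by blast
    define V where "V = (\<Union>i\<in>C. ball (fst i) (snd i))"
    have "ball (fst i) (snd i) \<subseteq> U" if "i \<in> C" for i
    proof -
      have "i \<in> K" using C(2) that by blast
      then show ?thesis unfolding K_def by (cases i) simp
    qed
    then have V: "V \<subseteq> U" "open V" "negligible (U - V)" using C(4) by (auto simp: V_def)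
    have dj: "disjoint_family_on (\<lambda>i. ball (fst i) (snd i)) C"
      using C(3) by (auto simp: disjoint_family_on_def pairwise_def disjnt_def)
    then have dj': "disjoint_family_on (\<lambda>i. L -` ball (fst i) (snd i)) C"
      unfolding disjoint_family_on_def by (metis vimage_Int vimage_empty)
    have sb: "L -` A \<in> sets borel" if "A \<in> sets borel" for A
      using measurable_sets[OF Lm that] by simp
    have "emeasure lborel (L -` V) = (\<integral>\<^sup>+i. emeasure lborel (L -` ball (fst i) (snd i)) \<partial>count_space C)"
      unfolding V_def vimage_UN using C(1) dj' sb by (intro emeasure_UN_countable) auto
    also have "\<dots> = (\<integral>\<^sup>+i. emeasure lborel (ball (fst i) (snd i)) \<partial>count_space C)" by (simp add: eball)
    also have "\<dots> = emeasure lborel V"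
      unfolding V_def using C(1) dj by (intro emeasure_UN_countable[symmetric]) auto
    finally have eqV: "emeasure lborel (L -` V) = emeasure lborel V" .
    have add: "emeasure lborel A = emeasure lborel W" if "W \<subseteq> A" "negligible (A - W)" "A \<in> sets borel" "W \<in> sets borel" for A W :: "'c::euclidean_space set"
    proof -
      have "A - W \<in> null_sets lborel"
        using that by (simp add: negligible_iff_null_sets null_sets_completion_iff)
      then have "emeasure lborel (A - (A - W)) = emeasure lborel A" using that by (intro emeasure_Diff_null_set) auto
      moreover have "A - (A - W) = W" using that(1) by blast
      ultimately show ?thesis by simp
    qed
    have "emeasure lborel U = emeasure lborel V" using V U by (intro add) auto
    moreover have "emeasure lborel (L -` U) = emeasure lborel (L -` V)"
      using V U neg[OF V(3)] sb by (intro add) (auto simp: vimage_Diff)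
    ultimately show ?thesis using eqV by simp
  qed
  show "emeasure (distr lborel borel L) (box l u) = ennreal (\<Prod>b\<in>Basis. (u - l) \<bullet> b)"
    if "\<And>b. b \<in> Basis \<Longrightarrow> l \<bullet> b \<le> u \<bullet> b" for l u
  proof -
    have "emeasure (distr lborel borel L) (box l u) = emeasure lborel (L -` box l u)"
      using Lm by (subst emeasure_distr) auto
    also have "\<dots> = emeasure lborel (box l u)" by (rule open_eq[OF open_box])
    also have "\<dots> = ennreal (\<Prod>b\<in>Basis. (u - l) \<bullet> b)" by (rule emeasure_lborel_box[OF that])
    finally show ?thesis .
  qed
qed simp

lemma emeasure_lebesgue_isometry:
  fixes L :: "'a::euclidean_space \<Rightarrow> 'b::euclidean_space"
  assumes L: "linear L" "\<And>x. norm (L x) = norm x" and dim: "DIM('a) = DIM('b)"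
    and S: "S \<in> sets lebesgue"
  shows "emeasure lebesgue (L -` S) = emeasure lebesgue S"
proof -
  have Lm: "L \<in> lborel \<rightarrow>\<^sub>M lborel"
    using linear_borel_measurable[OF L(1)] by simp
  have "distr lborel lborel L = lborel"
    using distr_lborel_isometry[OF L dim] by (simp cong: distr_cong)
  then have d: "distr lebesgue lborel L = lborel" by (simp add: distr_completion[OF Lm])
  have Lm1: "L \<in> lebesgue \<rightarrow>\<^sub>M lborel" by (rule measurable_completion[OF Lm])
  have e: "distr lebesgue lebesgue L = lebesgue"
    using completion.completion_distr_eq[OF Lm1] by (simp add: d)
  have Lm': "L \<in> lebesgue \<rightarrow>\<^sub>M lebesgue"
    by (rule completion.measurable_completion2[OF Lm1]) (simp add: d)
  have "emeasure lebesgue S = emeasure (distr lebesgue lebesgue L) S" by (simp add: e)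
  also have "\<dots> = emeasure lebesgue (L -` S)" using S Lm' by (subst emeasure_distr) auto
  finally show ?thesis by simp
qed

lemma subdiff_isometry:
  fixes L :: "'a::euclidean_space \<Rightarrow> 'b::euclidean_space"
  assumes L: "linear L" "\<And>x. norm (L x) = norm x" and dim: "DIM('a) = DIM('b)"
  shows "z \<in> subdiff (v \<circ> L) b \<longleftrightarrow> L z \<in> subdiff v (L b)"
proof -
  have inner: "L x \<bullet> L y = x \<bullet> y" for x y
    using L by (simp add: dot_norm linear_add[OF L(1), symmetric])
  have "surj L" using isometry_bij[OF assms] by (simp add: bij_def)
  then have "(\<forall>y. v (L b) + L z \<bullet> (y - L b) \<le> v y) \<longleftrightarrow> (\<forall>y. v (L b) + L z \<bullet> (L y - L b) \<le> v (L y))"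
    by (metis surjD)
  also have "\<dots> \<longleftrightarrow> (\<forall>y. v (L b) + z \<bullet> (y - b) \<le> v (L y))"
    by (simp add: inner linear_diff[OF L(1), symmetric])
  finally show ?thesis by (simp add: subdiff_def)
qed

lemma convex_on_linear_comp:
  fixes L :: "'a::real_vector \<Rightarrow> 'b::real_vector"
  assumes "convex_on UNIV v" "linear L"
  shows "convex_on UNIV (v \<circ> L)"
proof
  fix t :: real and x y :: 'a assume "0 < t" "t < 1"
  then show "(v \<circ> L) ((1 - t) *\<^sub>R x + t *\<^sub>R y) \<le> (1 - t) * (v \<circ> L) x + t * (v \<circ> L) y"
    using convex_onD[OF assms(1), of t "L x" "L y"]
    by (simp add: linear_add[OF assms(2)] linear_scale[OF assms(2)])
qed simp

lemma MA_measure_isometry: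
  fixes L :: "'a::euclidean_space \<Rightarrow> 'b::euclidean_space"
  assumes L: "linear L" "\<And>x. norm (L x) = norm x" and dim: "DIM('a) = DIM('b)"
    and v: "convex_on UNIV v" and B: "B \<in> sets borel"
  shows "emeasure (MA_measure (v \<circ> L)) (L -` B) = emeasure (MA_measure v) B"
proof -
  have Lm: "L \<in> borel_measurable borel"
    by (rule linear_borel_measurable[OF L(1)])
  have B': "L -` B \<in> sets borel" using measurable_sets[OF Lm B] by simp
  have surj: "surj L" using isometry_bij[OF L dim] by (simp add: bij_def)
  have "subd (v \<circ> L) (L -` B) = L -` subd v B"
  proof (rule set_eqI)
    fix z
    have "(\<exists>b. L b \<in> B \<and> L z \<in> subdiff v (L b)) \<longleftrightarrow> (\<exists>c. c \<in> B \<and> L z \<in> subdiff v c)"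
      using surj unfolding surj_def by metis
    then show "z \<in> subd (v \<circ> L) (L -` B) \<longleftrightarrow> z \<in> L -` subd v B"
      by (simp add: subd_def subdiff_isometry[OF L dim] Bex_def)
  qed
  then show ?thesis
    using emeasure_lebesgue_isometry[OF L dim subd_lebesgue[OF v B]]
      emeasure_MA_measure[OF v B] emeasure_MA_measure[OF convex_on_linear_comp[OF v L(1)] B']
    by (simp add: MA_def subd_def)
qed

text \<open>The change of variables theorem is only available on \<^typ>\<open>real^'n\<close>; this index type provides
  coordinates on an arbitrary Euclidean space.\<close>
typedef (overloaded) ('a::euclidean_space) basis_idx = "Basis :: 'a set"
  using nonempty_Basis by blast

lemma bij_Rep_basis_idx: "bij_betw Rep_basis_idx (UNIV :: 'a::euclidean_space basis_idx set) Basis"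
  unfolding bij_betw_def inj_def
  using type_definition.Rep_range[OF type_definition_basis_idx] by (simp add: Rep_basis_idx_inject)

instance basis_idx :: (euclidean_space) finite
proof
  show "finite (UNIV :: 'a basis_idx set)"
    using bij_betw_finite[OF bij_Rep_basis_idx] by simp
qed

text \<open>The order pulled back along this numbering provides the sort \<open>wellorder\<close>
  that \<open>MA_measure_C2\<close> asks of its index type.\<close>

definition basis_num :: "'a::euclidean_space basis_idx \<Rightarrow> nat" where
  "basis_num = (SOME f. inj f)"

lemma inj_basis_num: "inj (basis_num :: 'a::euclidean_space basis_idx \<Rightarrow> nat)"
proof -
  have "\<exists>f :: 'a basis_idx \<Rightarrow> nat. inj f"
    using finite_imp_inj_to_nat_seg[OF finite[of "UNIV :: 'a basis_idx set"]] by blast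
  then show ?thesis unfolding basis_num_def by (rule someI_ex)
qed

instantiation basis_idx :: (euclidean_space) wellorder
begin

definition "x \<le> y \<longleftrightarrow> basis_num x \<le> basis_num (y :: 'a basis_idx)"
definition "x < y \<longleftrightarrow> basis_num x < basis_num (y :: 'a basis_idx)"

instance
proof
  fix P :: "'a basis_idx \<Rightarrow> bool" and a
  assume P: "\<And>x. (\<And>y. y < x \<Longrightarrow> P y) \<Longrightarrow> P x"
  show "P a"
  proof (induction "basis_num a" arbitrary: a rule: less_induct)
    case less
    then show ?case using P by (simp add: less_basis_idx_def)
  qed
qed (use inj_basis_num in \<open>auto simp: less_eq_basis_idx_def less_basis_idx_def inj_def\<close>)

end

definition from_coords :: "real ^ ('a::euclidean_space basis_idx) \<Rightarrow> 'a" where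
  "from_coords x = (\<Sum>b\<in>UNIV. x $ b *\<^sub>R Rep_basis_idx b)"

lemma linear_from_coords: "linear from_coords"
  by (rule linearI) (simp_all add: from_coords_def algebra_simps sum.distrib scaleR_sum_right)

lemma norm_from_coords: "norm (from_coords x :: 'a::euclidean_space) = norm x"
proof -
  have orth: "Rep_basis_idx b \<bullet> (Rep_basis_idx c :: 'a) = (if b = c then 1 else 0)" for b c
    using Rep_basis_idx[of b] Rep_basis_idx[of c] by (simp add: inner_Basis Rep_basis_idx_inject)
  have "from_coords x \<bullet> (from_coords x :: 'a) = x \<bullet> x"
    by (simp add: from_coords_def inner_sum_left inner_sum_right inner_vec_def orth
        if_distrib[of "\<lambda>t. _ * t"] cong: if_cong)
  then show ?thesis by (simp add: norm_eq_sqrt_inner)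
qed

lemma card_basis_idx: "CARD('a::euclidean_space basis_idx) = DIM('a)"
  using bij_betw_same_card[OF bij_Rep_basis_idx] .

lemma DIM_coords: "DIM(real ^ ('a::euclidean_space basis_idx)) = DIM('a)"
  by (simp add: card_basis_idx)

subsection \<open>The polar form of the Monge--Ampere measure\<close>

text \<open>The polarization formula solved for the mixed term: on bounded Borel sets every mixed
  measure must have this value (\<open>is_mixed_MA_polar\<close>).\<close>

definition polar_MA :: "('a::euclidean_space \<Rightarrow> real) list \<Rightarrow> 'a set \<Rightarrow> real" where
  "polar_MA vs B = (\<Sum>S\<in>Pow {..<DIM('a)}. (-1) ^ (DIM('a) - card S) *
      MA_real (\<lambda>x. \<Sum>i\<in>S. (vs ! i) x) B) / fact DIM('a)"

lemma MA_measure_det_inequality_coords: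
  fixes v :: "'k \<Rightarrow> 'a::euclidean_space \<Rightarrow> real" and L :: "'j \<Rightarrow> 'k \<Rightarrow> real"
  assumes I: "finite I" and J: "finite J"
    and v: "\<And>i. i \<in> I \<Longrightarrow> convex_on UNIV (v i)" and L: "\<And>j i. j \<in> J \<Longrightarrow> i \<in> I \<Longrightarrow> 0 \<le> L j i"
    and det: "\<And>A :: 'k \<Rightarrow> real^('a basis_idx)^('a basis_idx). (\<And>i. i \<in> I \<Longrightarrow> psd (A i)) \<Longrightarrow> 0 \<le> (\<Sum>j\<in>J. c j * det (\<Sum>i\<in>I. L j i *\<^sub>R A i))"
    and B: "B \<in> sets borel" "bounded B"
  shows "0 \<le> (\<Sum>j\<in>J. c j * MA_real (\<lambda>x. \<Sum>i\<in>I. L j i * v i x) B)"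
proof -
  let ?f = "from_coords :: real ^ ('a basis_idx) \<Rightarrow> 'a"
  have fm: "?f \<in> borel_measurable borel"
    by (rule linear_borel_measurable[OF linear_from_coords])
  have B': "?f -` B \<in> sets borel" using measurable_sets[OF fm B(1)] by simp
  have bB': "bounded (?f -` B)"
  proof -
    obtain r where "\<And>x. x \<in> B \<Longrightarrow> norm x \<le> r" using B(2) by (auto simp: bounded_iff)
    then show ?thesis unfolding bounded_iff by (metis norm_from_coords vimageE)
  qed
  have "0 \<le> (\<Sum>j\<in>J. c j * MA_real (\<lambda>x. \<Sum>i\<in>I. L j i * (v i \<circ> ?f) x) (?f -` B))"
    by (rule MA_measure_det_inequality[OF I J convex_on_linear_comp[OF v linear_from_coords] L det B' bB'])
  moreover have "MA_real (\<lambda>x. \<Sum>i\<in>I. L j i * (v i \<circ> ?f) x) (?f -` B) =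
      MA_real (\<lambda>x. \<Sum>i\<in>I. L j i * v i x) B" if "j \<in> J" for j
  proof -
    have "convex_on UNIV (\<lambda>x. \<Sum>i\<in>I. L j i * v i x)" by (rule convex_on_lincomb[OF v L[OF that] convex_UNIV])
    from MA_measure_isometry[OF linear_from_coords norm_from_coords DIM_coords this B(1)]
    show ?thesis by (simp add: measure_def comp_def)
  qed
  ultimately show ?thesis by simp
qed

lemma sum_of_bool_scaleR:
  fixes f :: "nat \<Rightarrow> 'v::real_vector"
  assumes "S \<subseteq> {..<m}"
  shows "(\<Sum>i<m. of_bool (i \<in> S) *\<^sub>R f i) = (\<Sum>i\<in>S. f i)"
proof -
  have "(\<Sum>i<m. of_bool (i \<in> S) *\<^sub>R f i) = (\<Sum>i\<in>{i\<in>{..<m}. i \<in> S}. f i)"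
    by (subst sum.inter_filter) (auto intro!: sum.cong)
  also have "{i\<in>{..<m}. i \<in> S} = S" using assms by auto
  finally show ?thesis .
qed

text \<open>The matching combination of determinants is a factorial times a mixed discriminant of
  positive semidefinite matrices. Membership in \<open>S\<close> is written as a 0-1 coefficient to
  fit the transfer principle.\<close>

lemma polar_MA_nonneg:
  fixes vs :: "('a::euclidean_space \<Rightarrow> real) list"
  assumes vs: "length vs = DIM('a)" "\<And>v. v \<in> set vs \<Longrightarrow> convex_on UNIV v"
    and B: "B \<in> sets borel" "bounded B"
  shows "0 \<le> polar_MA vs B"
proof -
  let ?n = "DIM('a)"
  have "0 \<le> (\<Sum>S\<in>Pow {..<?n}. (-1) ^ (?n - card S) *
      MA_real (\<lambda>x. \<Sum>i<?n. of_bool (i \<in> S) * (vs ! i) x) B)"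
  proof (rule MA_measure_det_inequality_coords[OF _ _ _ _ _ B])
    fix A :: "nat \<Rightarrow> real^('a basis_idx)^('a basis_idx)"
    assume A: "\<And>i. i \<in> {..<?n} \<Longrightarrow> psd (A i)"
    have "(\<Sum>S\<in>Pow {..<?n}. (-1) ^ (?n - card S) * det (\<Sum>i<?n. of_bool (i \<in> S) *\<^sub>R A i)) =
        (\<Sum>S\<in>Pow {..<?n}. (-1) ^ (?n - card S) * det (\<Sum>i\<in>S. map A [0..<?n] ! i))"
    proof (rule sum.cong[OF refl])
      fix S assume "S \<in> Pow {..<?n}"
      then have S: "S \<subseteq> {..<?n}" by simp
      have "(\<Sum>i\<in>S. map A [0..<?n] ! i) = (\<Sum>i\<in>S. A i)" using S by (intro sum.cong) auto
      then show "(-1) ^ (?n - card S) * det (\<Sum>i<?n. of_bool (i \<in> S) *\<^sub>R A i) =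
          (-1) ^ (?n - card S) * det (\<Sum>i\<in>S. map A [0..<?n] ! i)"
        by (simp only: sum_of_bool_scaleR[OF S])
    qed
    also have "\<dots> = fact ?n * mixed_disc (map A [0..<?n])"
      using det_polarization[of "map A [0..<?n]"] by (simp add: card_basis_idx)
    also have "\<dots> \<ge> 0" using A by (intro mult_nonneg_nonneg mixed_disc_nonneg) (auto simp: card_basis_idx)
    finally show "0 \<le> (\<Sum>S\<in>Pow {..<?n}. (-1) ^ (?n - card S) * det (\<Sum>i<?n. of_bool (i \<in> S) *\<^sub>R A i))" .
  qed (use vs in auto)
  also have "\<dots> = (\<Sum>S\<in>Pow {..<?n}. (-1) ^ (?n - card S) * MA_real (\<lambda>x. \<Sum>i\<in>S. (vs ! i) x) B)"
  proof (rule sum.cong[OF refl])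
    fix S assume "S \<in> Pow {..<?n}"
    then have "(\<lambda>x. \<Sum>i<?n. of_bool (i \<in> S) * (vs ! i) x) = (\<lambda>x. \<Sum>i\<in>S. (vs ! i) x)"
      using sum_of_bool_scaleR[of S ?n "\<lambda>i. (vs ! i) _"] by auto
    then show "(-1) ^ (?n - card S) * MA_real (\<lambda>x. \<Sum>i<?n. of_bool (i \<in> S) * (vs ! i) x) B =
      (-1) ^ (?n - card S) * MA_real (\<lambda>x. \<Sum>i\<in>S. (vs ! i) x) B" by simp
  qed
  finally show ?thesis by (simp add: polar_MA_def)
qed

text \<open>A sum over list positions becomes a sum over values with multiplicities, the form in
  which the transfer principle takes its functions.\<close>

lemma sum_count_scaleR:
  fixes f :: "nat \<Rightarrow> 'v::real_vector"
  assumes "finite S" "\<And>j. j \<in> S \<Longrightarrow> is ! j < m"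
  shows "(\<Sum>i<m. real (card {j \<in> S. is ! j = i}) *\<^sub>R f i) = (\<Sum>j\<in>S. f (is ! j))"
proof -
  have "real (card {j \<in> S. is ! j = i}) *\<^sub>R f i = (\<Sum>j\<in>{j \<in> S. is ! j = i}. f (is ! j))" for i
    by (simp add: sum_constant_scaleR)
  then show ?thesis using sum.group[of S "{..<m}" "(!) is" "\<lambda>j. f (is ! j)"] assms by auto
qed

lemma measure_MA_expansion:
  fixes v :: "nat \<Rightarrow> 'a::euclidean_space \<Rightarrow> real"
  assumes v: "\<And>i. i < m \<Longrightarrow> convex_on UNIV (v i)" and lam: "\<And>i. i < m \<Longrightarrow> 0 \<le> lam i"
    and B: "B \<in> sets borel" "bounded B"
  shows "MA_real (\<lambda>x. \<Sum>i<m. lam i * v i x) B =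
    (\<Sum>is\<in>idx_lists DIM('a) {..<m}. prod_list (map lam is) * polar_MA (map v is) B)"
proof -
  let ?n = "DIM('a)"
  \<comment> \<open>\<open>None\<close> stands for the left side of the expansion,
    \<open>Some (is, S)\<close> for the summand \<open>S\<close> in the polar form of the list
    \<open>is\<close>. A function that is repeated in the list enters \<open>L\<close> with its
    multiplicity.\<close>
  define J where "J = insert None (Some ` (idx_lists ?n {..<m} \<times> Pow {..<?n}))"
  define L where "L j i = (case j of None \<Rightarrow> lam i | Some (is, S) \<Rightarrow> real (card {k \<in> S. is ! k = i}))" for j i
  define c where "c j = (case j of None \<Rightarrow> 1 | Some (is, S) \<Rightarrow> - (prod_list (map lam is) * (-1) ^ (?n - card S) / fact ?n))"
    for j :: "(nat list \<times> nat set) option"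
  have J: "finite J" by (simp add: J_def)
  have sumJ: "(\<Sum>j\<in>J. c j * h j) = h None - (\<Sum>is\<in>idx_lists ?n {..<m}. prod_list (map lam is) *
      ((\<Sum>S\<in>Pow {..<?n}. (-1) ^ (?n - card S) * h (Some (is, S))) / fact ?n))" for h :: "_ \<Rightarrow> real"
  proof -
    have "(\<Sum>j\<in>J. c j * h j) = h None + (\<Sum>x\<in>idx_lists ?n {..<m} \<times> Pow {..<?n}. c (Some x) * h (Some x))"
      unfolding J_def by (subst sum.insert) (auto simp: c_def sum.reindex)
    also have "(\<Sum>x\<in>idx_lists ?n {..<m} \<times> Pow {..<?n}. c (Some x) * h (Some x)) =
       (\<Sum>is\<in>idx_lists ?n {..<m}. \<Sum>S\<in>Pow {..<?n}. c (Some (is, S)) * h (Some (is, S)))"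
      by (simp add: sum.cartesian_product)
    also have "\<dots> = - (\<Sum>is\<in>idx_lists ?n {..<m}. prod_list (map lam is) *
      ((\<Sum>S\<in>Pow {..<?n}. (-1) ^ (?n - card S) * h (Some (is, S))) / fact ?n))"
      by (simp add: c_def sum_negf[symmetric] sum_distrib_left sum_divide_distrib mult.assoc)
    finally show ?thesis by simp
  qed
  have idx: "is ! j < m" if "is \<in> idx_lists ?n {..<m}" "j < ?n" for "is" j
    using that by (auto simp: idx_lists_def) (metis lessThan_iff nth_mem subsetD)
  have LSome: "(\<Sum>i<m. L (Some (is, S)) i *\<^sub>R f i) = (\<Sum>j\<in>S. f (is ! j))"
    if "is \<in> idx_lists ?n {..<m}" "S \<in> Pow {..<?n}" for "is" S and f :: "nat \<Rightarrow> 'v::real_vector"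
    unfolding L_def using that idx[OF that(1)] finite_subset[of S "{..<?n}"]
    by (simp, intro sum_count_scaleR) auto
  have det: "(\<Sum>j\<in>J. c j * det (\<Sum>i<m. L j i *\<^sub>R A i)) = 0" for A :: "nat \<Rightarrow> real^('a basis_idx)^('a basis_idx)"
  proof -
    have "(\<Sum>S\<in>Pow {..<?n}. (-1) ^ (?n - card S) * det (\<Sum>i<m. L (Some (is, S)) i *\<^sub>R A i)) = fact ?n * mixed_disc (map A is)"
      if i: "is \<in> idx_lists ?n {..<m}" for "is"
    proof -
      have len: "length is = ?n" using i by (simp add: idx_lists_def)
      have "(\<Sum>S\<in>Pow {..<?n}. (-1) ^ (?n - card S) * det (\<Sum>i<m. L (Some (is, S)) i *\<^sub>R A i)) =
         (\<Sum>S\<in>Pow {..<?n}. (-1) ^ (?n - card S) * det (\<Sum>i\<in>S. map A is ! i))"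
      proof (rule sum.cong[OF refl])
        fix S assume S: "S \<in> Pow {..<?n}"
        have "(\<Sum>i\<in>S. map A is ! i) = (\<Sum>i\<in>S. A (is ! i))" using S len by (intro sum.cong) auto
        then show "(-1) ^ (?n - card S) * det (\<Sum>i<m. L (Some (is, S)) i *\<^sub>R A i) =
           (-1) ^ (?n - card S) * det (\<Sum>i\<in>S. map A is ! i)"
          by (simp only: LSome[OF i S])
      qed
      also have "\<dots> = fact ?n * mixed_disc (map A is)"
        using det_polarization[of "map A is"] len by (simp add: card_basis_idx)
      finally show ?thesis .
    qed
    then have "(\<Sum>j\<in>J. c j * det (\<Sum>i<m. L j i *\<^sub>R A i)) = det (\<Sum>i<m. L None i *\<^sub>R A i) -
        (\<Sum>is\<in>idx_lists ?n {..<m}. prod_list (map lam is) * mixed_disc (map A is))"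
      by (simp add: sumJ)
    also have "\<dots> = 0" using det_sum_expansion[where lam = lam and A = A and m = m] by (simp add: L_def card_basis_idx)
    finally show ?thesis .
  qed
  have Lpos: "0 \<le> L j i" if "i < m" for j i using lam[OF that] by (auto simp: L_def split: option.split)
  let ?h = "\<lambda>j. MA_real (\<lambda>x. \<Sum>i<m. L j i * v i x) B"
  \<comment> \<open>The combination of determinants is zero, so the inequality may be used both with
    \<open>c\<close> and with \<open>- c\<close>.\<close>
  have "0 \<le> (\<Sum>j\<in>J. c j * ?h j)"
    by (rule MA_measure_det_inequality_coords[OF _ J _ _ _ B]) (use v Lpos det in auto)
  moreover have "0 \<le> (\<Sum>j\<in>J. - c j * ?h j)"
    by (rule MA_measure_det_inequality_coords[OF _ J _ _ _ B]) (use v Lpos det in \<open>auto simp: sum_negf\<close>)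
  ultimately have "(\<Sum>j\<in>J. c j * ?h j) = 0" by (simp add: sum_negf)
  then have "?h None = (\<Sum>is\<in>idx_lists ?n {..<m}. prod_list (map lam is) *
      ((\<Sum>S\<in>Pow {..<?n}. (-1) ^ (?n - card S) * ?h (Some (is, S))) / fact ?n))"
    unfolding sumJ by simp
  also have "\<dots> = (\<Sum>is\<in>idx_lists ?n {..<m}. prod_list (map lam is) * polar_MA (map v is) B)"
  proof (rule sum.cong[OF refl])
    fix "is" assume i: "is \<in> idx_lists ?n {..<m}"
    then have len: "length is = ?n" by (simp add: idx_lists_def)
    have "?h (Some (is, S)) = MA_real (\<lambda>x. \<Sum>i\<in>S. (map v is ! i) x) B" if S: "S \<in> Pow {..<?n}" for S
    proof -
      have "(\<Sum>i<m. L (Some (is, S)) i * v i x) = (\<Sum>i\<in>S. (map v is ! i) x)" for x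
      proof -
        have "(\<Sum>i\<in>S. (map v is ! i) x) = (\<Sum>i\<in>S. v (is ! i) x)" using S len by (intro sum.cong) auto
        then show ?thesis using LSome[OF i S, of "\<lambda>i. v i x"] by simp
      qed
      then show ?thesis by simp
    qed
    then show "prod_list (map lam is) * ((\<Sum>S\<in>Pow {..<?n}. (-1) ^ (?n - card S) * ?h (Some (is, S))) / fact ?n) =
       prod_list (map lam is) * polar_MA (map v is) B"
      by (simp add: polar_MA_def)
  qed
  finally show ?thesis by (simp add: L_def)
qed

subsection \<open>Existence and uniqueness of the mixed measure\<close>

text \<open>Shells partition the space into bounded Borel sets. Being described by the norm, they
  are pulled back to shells by linear isometries.\<close>

definition shell :: "nat \<Rightarrow> 'a::euclidean_space set" where
  "shell j = {x. real j \<le> norm x \<and> norm x < real (Suc j)}"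

lemma shell_borel [measurable]: "shell j \<in> sets borel"
  unfolding shell_def by measurable

lemma bounded_shell: "bounded (B \<inter> shell j)"
  by (rule boundedI[of _ "real (Suc j)"]) (auto simp: shell_def)

lemma disjoint_shell: "disjoint_family (\<lambda>j. B \<inter> shell j)"
proof -
  have "i = j" if "x \<in> shell i" "x \<in> shell j" for i j and x :: 'a
    using that by (auto simp: shell_def)
  then show ?thesis by (auto simp: disjoint_family_on_def)
qed

lemma UN_shell [simp]: "(\<Union>j. shell j) = (UNIV :: 'a::euclidean_space set)"
proof -
  have "x \<in> shell (nat \<lfloor>norm x\<rfloor>)" for x :: 'a by (auto simp: shell_def) linarith
  then show ?thesis by blast
qed

lemma suminf_shell:
  assumes "sets M = sets borel" "B \<in> sets borel"
  shows "(\<Sum>j. emeasure M (B \<inter> shell j)) = emeasure M B"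
proof -
  have "range (\<lambda>j. B \<inter> shell j) \<subseteq> sets M"
    unfolding assms(1) using sets.Int[OF assms(2) shell_borel] by blast
  from suminf_emeasure[OF this disjoint_shell] show ?thesis by simp
qed

definition admissible :: "('a::euclidean_space \<Rightarrow> real) list \<Rightarrow> bool" where
  "admissible vs \<longleftrightarrow> length vs = DIM('a) \<and> (\<forall>v\<in>set vs. convex_on UNIV v)"

text \<open>A bounded union keeps every term of the alternating sum finite, so the individual series
  can be combined with signs.\<close>

lemma polar_MA_sums:
  fixes vs :: "('a::euclidean_space \<Rightarrow> real) list"
  assumes vs: "admissible vs"
    and A: "range A \<subseteq> sets borel" "disjoint_family A" "bounded (\<Union>i. A i)"
  shows "(\<lambda>i. polar_MA vs (A i)) sums polar_MA vs (\<Union>i. A i)"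
proof -
  have "(\<lambda>i. MA_real (\<lambda>x. \<Sum>k\<in>S. (vs ! k) x) (A i)) sums
      MA_real (\<lambda>x. \<Sum>k\<in>S. (vs ! k) x) (\<Union>i. A i)" if "S \<in> Pow {..<DIM('a)}" for S
  proof (rule measure_UNION[OF _ A(2)])
    have "convex_on UNIV (\<lambda>x. \<Sum>k\<in>S. 1 * (vs ! k) x)"
      using vs that by (intro convex_on_lincomb) (auto simp: admissible_def)
    then show "emeasure (MA_measure (\<lambda>x. \<Sum>k\<in>S. (vs ! k) x)) (\<Union>i. A i) \<noteq> \<infinity>"
      using emeasure_MA_measure_finite[OF _ A(3), of "\<lambda>x. \<Sum>k\<in>S. (vs ! k) x"] by simp
  qed (use A(1) in simp)
  then show ?thesis
    unfolding polar_MA_def by (intro sums_divide sums_sum sums_mult) auto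
qed

lemma suminf_polar_MA:
  fixes vs :: "('a::euclidean_space \<Rightarrow> real) list"
  assumes vs: "admissible vs"
    and A: "range A \<subseteq> sets borel" "disjoint_family A" "bounded (\<Union>i. A i)"
  shows "(\<Sum>i. ennreal (polar_MA vs (A i))) = ennreal (polar_MA vs (\<Union>i. A i))"
proof (rule suminf_ennreal_eq[OF _ polar_MA_sums[OF assms]])
  fix i
  have "bounded (A i)" using A(3) by (rule bounded_subset) blast
  then show "0 \<le> polar_MA vs (A i)"
    using vs A(1) by (intro polar_MA_nonneg) (auto simp: admissible_def)
qed

text \<open>The polar form is an alternating sum and makes sense only on bounded sets, where no infinite
  values occur; hence the summation over shells.\<close>
definition mixed_MA_measure :: "('a::euclidean_space \<Rightarrow> real) list \<Rightarrow> 'a measure" where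
  "mixed_MA_measure vs = (if admissible vs
     then measure_of UNIV (sets borel) (\<lambda>B. \<Sum>j. ennreal (polar_MA vs (B \<inter> shell j)))
     else null_measure borel)"

lemma sets_mixed_MA_measure [simp]: "sets (mixed_MA_measure vs) = sets borel"
  using sets.sigma_sets_eq[of borel] by (auto simp: mixed_MA_measure_def)

lemma suminf_swap_ennreal: "(\<Sum>i. \<Sum>j. f i j :: ennreal) = (\<Sum>j. \<Sum>i. f i j)"
  using nn_integral_suminf[of "\<lambda>i j. f i j" "count_space UNIV"]
  by (simp add: nn_integral_count_space_nat)

text \<open>Countable additivity is the exchange of two series of nonnegative terms, one over the
  pieces and one over the shells.\<close>

lemma emeasure_mixed_MA_measure:
  fixes vs :: "('a::euclidean_space \<Rightarrow> real) list"
  assumes vs: "admissible vs" and B: "B \<in> sets borel"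
  shows "emeasure (mixed_MA_measure vs) B = (\<Sum>j. ennreal (polar_MA vs (B \<inter> shell j)))"
proof -
  have ca: "countably_additive (sets borel) (\<lambda>B. \<Sum>j. ennreal (polar_MA vs (B \<inter> shell j)))"
  proof (rule countably_additiveI)
    fix A :: "nat \<Rightarrow> 'a set" assume A: "range A \<subseteq> sets borel" "disjoint_family A"
    have "(\<Sum>i. ennreal (polar_MA vs (A i \<inter> shell j))) = ennreal (polar_MA vs ((\<Union>i. A i) \<inter> shell j))" for j
    proof -
      have "bounded (\<Union>i. A i \<inter> shell j)" using bounded_shell[of "\<Union>i. A i" j] by simp
      then have "(\<Sum>i. ennreal (polar_MA vs (A i \<inter> shell j))) = ennreal (polar_MA vs (\<Union>i. A i \<inter> shell j))"
        using A by (intro suminf_polar_MA[OF vs]) (auto simp: disjoint_family_on_def)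
      then show ?thesis by simp
    qed
    then show "(\<Sum>i. \<Sum>j. ennreal (polar_MA vs (A i \<inter> shell j))) = (\<Sum>j. ennreal (polar_MA vs ((\<Union>i. A i) \<inter> shell j)))"
      by (subst suminf_swap_ennreal) simp
  qed
  have sa: "sigma_algebra UNIV (sets (borel :: 'a measure))"
    using sets.sigma_algebra_axioms[of "borel :: 'a measure"] by simp
  have "polar_MA vs {} = 0" by (simp add: polar_MA_def)
  then have pos: "positive (sets borel) (\<lambda>B. \<Sum>j. ennreal (polar_MA vs (B \<inter> shell j)))"
    by (simp add: positive_def)
  show ?thesis
    using emeasure_measure_of_sigma[OF sa pos ca B] vs by (simp add: mixed_MA_measure_def)
qed

lemma emeasure_mixed_MA_measure_bounded:
  assumes vs: "admissible vs" and B: "B \<in> sets borel" "bounded B"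
  shows "emeasure (mixed_MA_measure vs) B = ennreal (polar_MA vs B)"
proof -
  have "range (\<lambda>j. B \<inter> shell j) \<subseteq> sets borel" using B by auto
  from suminf_polar_MA[OF vs this disjoint_shell] B(2) show ?thesis
    by (simp add: emeasure_mixed_MA_measure[OF vs B(1)])
qed

lemma admissible_map: "is \<in> idx_lists DIM('a) {..<m} \<Longrightarrow> (\<And>i. i < m \<Longrightarrow> convex_on UNIV (vs i)) \<Longrightarrow>
    admissible (map vs is :: ('a::euclidean_space \<Rightarrow> real) list)"
  by (auto simp: admissible_def idx_lists_def)

lemma MA_expansion:
  fixes v :: "nat \<Rightarrow> 'a::euclidean_space \<Rightarrow> real"
  assumes v: "\<And>i. i < m \<Longrightarrow> convex_on UNIV (v i)" and lam: "\<And>i. i < m \<Longrightarrow> 0 \<le> lam i"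
    and B: "B \<in> sets borel"
  shows "MA (\<lambda>x. \<Sum>i<m. lam i * v i x) B =
    (\<Sum>is\<in>idx_lists DIM('a) {..<m}. ennreal (prod_list (map lam is)) * emeasure (mixed_MA_measure (map v is)) B)"
proof -
  let ?I = "idx_lists DIM('a) {..<m}"
  let ?w = "\<lambda>x. \<Sum>i<m. lam i * v i x"
  have w: "convex_on UNIV ?w" using v lam by (intro convex_on_lincomb) auto
  have pl: "0 \<le> prod_list (map lam is)" if "is \<in> ?I" for "is"
    using that lam by (intro prod_list_nonneg) (auto simp: idx_lists_def)
  have bdd: "emeasure (MA_measure ?w) C = (\<Sum>is\<in>?I. ennreal (prod_list (map lam is)) * emeasure (mixed_MA_measure (map v is)) C)"
    if C: "C \<in> sets borel" "bounded C" for C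
  proof -
    have p: "0 \<le> polar_MA (map v is) C" if "is \<in> ?I" for "is"
    proof -
      have "admissible (map v is)" using that v by (rule admissible_map)
      then show ?thesis using C by (intro polar_MA_nonneg) (auto simp: admissible_def)
    qed
    have "emeasure (MA_measure ?w) C = ennreal (MA_real ?w C)"
      using emeasure_MA_measure_finite[OF w C(2)] by (intro emeasure_eq_ennreal_measure) auto
    also have "\<dots> = ennreal (\<Sum>is\<in>?I. prod_list (map lam is) * polar_MA (map v is) C)"
      by (subst measure_MA_expansion[OF v lam C]) auto
    also have "\<dots> = (\<Sum>is\<in>?I. ennreal (prod_list (map lam is) * polar_MA (map v is) C))"
      using pl p by (intro sum_ennreal[symmetric]) auto
    also have "\<dots> = (\<Sum>is\<in>?I. ennreal (prod_list (map lam is)) * emeasure (mixed_MA_measure (map v is)) C)"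
      using pl p by (intro sum.cong refl)
        (simp add: ennreal_mult emeasure_mixed_MA_measure_bounded[OF admissible_map[OF _ v] C])
    finally show ?thesis .
  qed
  have "MA ?w B = (\<Sum>j. emeasure (MA_measure ?w) (B \<inter> shell j))"
    by (simp add: suminf_shell B emeasure_MA_measure[OF w])
  also have "\<dots> = (\<Sum>j. \<Sum>is\<in>?I. ennreal (prod_list (map lam is)) * emeasure (mixed_MA_measure (map v is)) (B \<inter> shell j))"
    using B by (intro suminf_cong bdd bounded_shell) auto
  also have "\<dots> = (\<Sum>is\<in>?I. \<Sum>j. ennreal (prod_list (map lam is)) * emeasure (mixed_MA_measure (map v is)) (B \<inter> shell j))"
    by (intro suminf_sum) simp
  also have "\<dots> = (\<Sum>is\<in>?I. ennreal (prod_list (map lam is)) * emeasure (mixed_MA_measure (map v is)) B)"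
    by (simp add: suminf_shell B)
  finally show ?thesis .
qed

text \<open>A permutation of the list acts on the index sets \<open>S\<close> and preserves their
  cardinalities, hence the signs.\<close>

lemma polar_MA_mset:
  fixes vs ws :: "('a::euclidean_space \<Rightarrow> real) list"
  assumes m: "mset vs = mset ws" and len: "length ws = DIM('a)"
  shows "polar_MA vs B = polar_MA ws B"
proof -
  obtain p where p: "p permutes {..<length ws}" "permute_list p ws = vs"
    using mset_eq_permutation[OF m] by blast
  have inj: "inj p" using p(1) by (rule permutes_inj)
  have im: "p ` {..<DIM('a)} = {..<DIM('a)}" using p(1) len by (simp add: permutes_image)
  show ?thesis unfolding polar_MA_def
  proof (rule arg_cong[where f = "\<lambda>t. t / _"], rule sum.reindex_bij_witness[where i = "\<lambda>S. inv p ` S" and j = "\<lambda>S. p ` S"])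
    fix S assume S: "S \<in> Pow {..<DIM('a)}"
    show "inv p ` p ` S = S" using inj by (simp add: image_comp)
    show "p ` inv p ` S = S" using permutes_surj[OF p(1)] by (simp add: image_f_inv_f)
    show "p ` S \<in> Pow {..<DIM('a)}" using S im by blast
    show "inv p ` S \<in> Pow {..<DIM('a)}"
      using S permutes_image[OF permutes_inv[OF p(1)]] len by auto
    have "(\<Sum>i\<in>p ` S. (ws ! i) x) = (\<Sum>i\<in>S. (vs ! i) x)" for x
    proof -
      have "(\<Sum>i\<in>p ` S. (ws ! i) x) = (\<Sum>i\<in>S. (ws ! p i) x)"
        by (subst sum.reindex) (auto intro: inj_on_subset[OF inj])
      also have "\<dots> = (\<Sum>i\<in>S. (vs ! i) x)"
      proof (rule sum.cong[OF refl])
        fix i assume "i \<in> S"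
        then have "i < length ws" using S len by auto
        then show "(ws ! p i) x = (vs ! i) x" using permute_list_nth[OF p(1)] p(2) by metis
      qed
      finally show ?thesis .
    qed
    moreover have "card (p ` S) = card S" by (rule card_image[OF inj_on_subset[OF inj subset_UNIV]])
    ultimately show "(-1) ^ (DIM('a) - card (p ` S)) * MA_real (\<lambda>x. \<Sum>i\<in>p ` S. (ws ! i) x) B =
        (-1) ^ (DIM('a) - card S) * MA_real (\<lambda>x. \<Sum>i\<in>S. (vs ! i) x) B"
      by simp
  qed
qed

theorem is_mixed_MA_mixed_MA_measure: "is_mixed_MA (mixed_MA_measure :: ('a::euclidean_space \<Rightarrow> real) list \<Rightarrow> 'a measure)"
  unfolding is_mixed_MA_def
proof (intro conjI allI impI ballI)
  fix vs :: "('a \<Rightarrow> real) list"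
  show "sets (mixed_MA_measure vs) = sets borel" by simp
  show "mixed_MA_measure vs = null_measure borel" if "\<not> (length vs = DIM('a) \<and> (\<forall>v\<in>set vs. convex_on UNIV v))"
    using that by (auto simp: mixed_MA_measure_def admissible_def)
next
  fix vs ws :: "('a \<Rightarrow> real) list" assume m: "mset vs = mset ws"
  then have "admissible vs \<longleftrightarrow> admissible ws"
    using mset_eq_setD[OF m] mset_eq_length[OF m] by (simp add: admissible_def)
  moreover have "polar_MA vs = polar_MA ws" if "admissible ws"
    using polar_MA_mset[OF m] that by (auto simp: admissible_def)
  ultimately show "mixed_MA_measure vs = mixed_MA_measure ws" by (simp add: mixed_MA_measure_def)
next
  fix m and vs :: "nat \<Rightarrow> 'a \<Rightarrow> real" and lam :: "nat \<Rightarrow> real" and B :: "'a set"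
  assume "\<forall>i<m. convex_on UNIV (vs i) \<and> 0 \<le> lam i" "B \<in> sets borel"
  then show "MA (\<lambda>x. \<Sum>i<m. lam i * vs i x) B =
      (\<Sum>is\<in>{is. length is = DIM('a) \<and> set is \<subseteq> {..<m}}.
        ennreal (prod_list (map lam is)) * emeasure (mixed_MA_measure (map vs is)) B)"
    using MA_expansion[of m vs lam B] by (simp add: idx_lists_def)
qed

text \<open>By polarization, a mixed measure is determined by the Monge--Ampere measures of sums.\<close>
lemma is_mixed_MA_polar:
  fixes F :: "('a::euclidean_space \<Rightarrow> real) list \<Rightarrow> 'a measure"
  assumes F: "is_mixed_MA F" and vs: "admissible vs" and B: "B \<in> sets borel" "bounded B"
  shows "emeasure (F vs) B = ennreal (polar_MA vs B)"
proof -
  let ?n = "DIM('a)"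
  let ?f = "\<lambda>is. F (map ((!) vs) is)"
  have len: "length vs = ?n" and cv: "\<And>i. i < ?n \<Longrightarrow> convex_on UNIV (vs ! i)"
    using vs by (auto simp: admissible_def)
  have "\<forall>us ws. mset us = mset ws \<longrightarrow> F us = F ws"
    by (rule F[unfolded is_mixed_MA_def, THEN conjunct2, THEN conjunct2, THEN conjunct1])
  then have sym: "F us = F ws" if "mset us = mset ws" for us ws using that by blast
  have ex: "MA (\<lambda>x. \<Sum>i<?n. lam i * (vs ! i) x) B =
      (\<Sum>is\<in>idx_lists ?n {..<?n}. ennreal (prod_list (map lam is)) * emeasure (?f is) B)"
    if "\<And>i. i < ?n \<Longrightarrow> 0 \<le> lam i" for lam :: "nat \<Rightarrow> real"
  proof -
    have "\<forall>i<?n. convex_on UNIV (vs ! i) \<and> 0 \<le> lam i" using cv that by blast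
    with F[unfolded is_mixed_MA_def, THEN conjunct2, THEN conjunct2, THEN conjunct2] B(1)
    show ?thesis unfolding idx_lists_def by blast
  qed
  have conv: "convex_on UNIV (\<lambda>x. \<Sum>i\<in>S. (vs ! i) x)" if "S \<subseteq> {..<?n}" for S
    using convex_on_lincomb[of S UNIV "(!) vs" "\<lambda>_. 1"] cv that by auto
  \<comment> \<open>With all coefficients 1, each mixed measure is a summand of the Monge--Ampere
    measure of the sum, which is finite on bounded sets.\<close>
  have fin: "emeasure (?f is) B < \<infinity>" if i: "is \<in> idx_lists ?n {..<?n}" for "is"
  proof -
    have "emeasure (?f is) B \<le> (\<Sum>is\<in>idx_lists ?n {..<?n}. ennreal (prod_list (map (\<lambda>_. 1) is)) * emeasure (?f is) B)"
      using i by (intro order_trans[OF _ member_le_sum[of "is"]]) (auto simp: prod_list_replicate map_replicate_const)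
    also have "\<dots> = MA (\<lambda>x. \<Sum>i<?n. (vs ! i) x) B" by (subst ex[symmetric]) auto
    also have "\<dots> < \<infinity>"
      using emeasure_MA_measure[OF conv[OF order_refl] B(1)] emeasure_MA_measure_finite[OF conv[OF order_refl] B(2)] by simp
    finally show ?thesis .
  qed
  define c where "c is = measure (?f is) B" for "is"
  have c: "emeasure (?f is) B = ennreal (c is)" if "is \<in> idx_lists ?n {..<?n}" for "is"
    using fin[OF that] unfolding c_def by (intro emeasure_eq_ennreal_measure) auto
  have sub: "MA_real (\<lambda>x. \<Sum>i\<in>S. (vs ! i) x) B = (\<Sum>is\<in>idx_lists ?n S. c is)"
    if S: "S \<in> Pow {..<?n}" for S
  proof -
    \<comment> \<open>Coefficients 0 and 1 reduce the expansion to the lists with entries in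
      \<open>S\<close>.\<close>
    have "(\<lambda>x. \<Sum>i<?n. of_bool (i \<in> S) * (vs ! i) x) = (\<lambda>x. \<Sum>i\<in>S. (vs ! i) x)"
      using sum_of_bool_scaleR[of S ?n "\<lambda>i. (vs ! i) _"] S by auto
    then have "MA (\<lambda>x. \<Sum>i\<in>S. (vs ! i) x) B =
      (\<Sum>is\<in>idx_lists ?n {..<?n}. ennreal (prod_list (map (\<lambda>i. of_bool (i \<in> S)) is)) * emeasure (?f is) B)"
      using ex[of "\<lambda>i. of_bool (i \<in> S)"] by simp
    also have "\<dots> = (\<Sum>is\<in>idx_lists ?n {..<?n}. if set is \<subseteq> S then ennreal (c is) else 0)"
    proof (rule sum.cong[OF refl])
      fix "is" assume "is \<in> idx_lists ?n {..<?n}"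
      moreover have "prod_list (map (\<lambda>i. of_bool (i \<in> S)) is) = (of_bool (set is \<subseteq> S) :: real)"
        by (induction "is") auto
      ultimately show "ennreal (prod_list (map (\<lambda>i. of_bool (i \<in> S)) is)) * emeasure (?f is) B =
          (if set is \<subseteq> S then ennreal (c is) else 0)" using c by simp
    qed
    also have "\<dots> = (\<Sum>is | is \<in> idx_lists ?n {..<?n} \<and> set is \<subseteq> S. ennreal (c is))"
      by (simp add: sum.inter_filter)
    also have "{is. is \<in> idx_lists ?n {..<?n} \<and> set is \<subseteq> S} = idx_lists ?n S"
      using S by (auto simp: idx_lists_def)
    also have "(\<Sum>is\<in>idx_lists ?n S. ennreal (c is)) = ennreal (\<Sum>is\<in>idx_lists ?n S. c is)"
      by (intro sum_ennreal) (simp add: c_def)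
    finally have "emeasure (MA_measure (\<lambda>x. \<Sum>i\<in>S. (vs ! i) x)) B = ennreal (\<Sum>is\<in>idx_lists ?n S. c is)"
      using emeasure_MA_measure[OF conv B(1)] S by simp
    then show ?thesis by (simp add: measure_def sum_nonneg c_def)
  qed
  have "(\<Sum>S\<in>Pow {..<?n}. (-1) ^ (?n - card S) * MA_real (\<lambda>x. \<Sum>i\<in>S. (vs ! i) x) B)
      = (\<Sum>S\<in>Pow {..<?n}. (-1) ^ (?n - card S) * (\<Sum>is\<in>idx_lists ?n S. c is))"
    using sub by simp
  also have "\<dots> = fact ?n * c [0..<?n]"
  proof (rule polarization)
    fix "is" js :: "nat list" assume "mset is = mset js"
    then show "c is = c js" unfolding c_def using sym[of "map ((!) vs) is" "map ((!) vs) js"] by simp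
  qed
  finally have "polar_MA vs B = c [0..<?n]" by (simp add: polar_MA_def)
  moreover have "map ((!) vs) [0..<?n] = vs" using len map_nth[of vs] by simp
  moreover have "[0..<?n] \<in> idx_lists ?n {..<?n}" by (auto simp: idx_lists_def)
  ultimately show ?thesis using c[of "[0..<?n]"] by simp
qed

text \<open>Shells reduce the equality to bounded sets, where both measures are given by the polar
  form.\<close>

lemma is_mixed_MA_unique:
  fixes F :: "('a::euclidean_space \<Rightarrow> real) list \<Rightarrow> 'a measure"
  assumes F: "is_mixed_MA F"
  shows "F = mixed_MA_measure"
proof
  fix vs :: "('a \<Rightarrow> real) list"
  have sF: "sets (F vs) = sets borel" using F unfolding is_mixed_MA_def by (elim conjE allE)
  show "F vs = mixed_MA_measure vs"
  proof (cases "admissible vs")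
    case False
    moreover have "\<forall>us. \<not> admissible us \<longrightarrow> F us = null_measure borel"
      using F unfolding is_mixed_MA_def admissible_def by (elim conjE)
    ultimately have "F vs = null_measure borel" by simp
    then show ?thesis using False by (simp add: mixed_MA_measure_def)
  next
    case True
    show ?thesis
    proof (rule measure_eqI)
      fix B assume "B \<in> sets (F vs)"
      then have B: "B \<in> sets borel" using sF by simp
      have "emeasure (F vs) B = (\<Sum>j. emeasure (F vs) (B \<inter> shell j))" by (simp add: suminf_shell[OF sF B])
      also have "\<dots> = (\<Sum>j. ennreal (polar_MA vs (B \<inter> shell j)))"
        using B by (intro suminf_cong is_mixed_MA_polar[OF F True] bounded_shell) auto
      also have "\<dots> = emeasure (mixed_MA_measure vs) B" by (rule emeasure_mixed_MA_measure[OF True B, symmetric])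
      finally show "emeasure (F vs) B = emeasure (mixed_MA_measure vs) B" .
    qed (simp add: sF)
  qed
qed

theorem mixed_MA_eq: "mixed_MA = mixed_MA_measure"
  unfolding mixed_MA_def
  by (rule the_equality[of is_mixed_MA, OF is_mixed_MA_mixed_MA_measure is_mixed_MA_unique])

subsection \<open>Adding a ramp function\<close>

text \<open>The inequality gives \<open>u y - z \<bullet> y\<close> a local minimum at
  \<open>b\<close>, which is global by convexity. Near a point off the hyperplane the ramp may thus
  be replaced by its linear expression.\<close>

lemma subdiff_local:
  fixes u :: "'a::euclidean_space \<Rightarrow> real"
  assumes u: "convex_on UNIV u" and U: "open U" "b \<in> U"
    and le: "\<And>y. y \<in> U \<Longrightarrow> u b + z \<bullet> (y - b) \<le> u y"
  shows "z \<in> subdiff u b"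
proof -
  obtain r where r: "r > 0" "ball b r \<subseteq> U" using U openE by blast
  define f where "f y = u y - z \<bullet> y" for y
  have "convex_on UNIV f"
    unfolding f_def
    by (intro convex_on_diff u) (auto simp: concave_on_def convex_on_def inner_add_right algebra_simps)
  moreover have "\<forall>y\<in>ball b r. f b \<le> f y"
  proof
    fix y assume "y \<in> ball b r"
    then have "u b + z \<bullet> (y - b) \<le> u y" using r(2) by (intro le) auto
    then show "f b \<le> f y" by (simp add: f_def inner_diff_right)
  qed
  ultimately have "\<forall>y\<in>UNIV. f b \<le> f y"
    using convex_local_global_minimum[OF r(1), of UNIV f b] by simp
  then show ?thesis by (auto simp: subdiff_iff_minimum f_def)
qed

lemma convex_on_pos_part_inner: "convex_on UNIV (\<lambda>x::'a::euclidean_space. max 0 (x \<bullet> e))"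
proof
  fix t :: real and x y :: 'a assume t: "0 < t" "t < 1"
  have "(1 - t) * (x \<bullet> e) \<le> (1 - t) * max 0 (x \<bullet> e)" "t * (y \<bullet> e) \<le> t * max 0 (y \<bullet> e)"
    using t by (auto intro!: mult_left_mono)
  moreover have "0 \<le> (1 - t) * max 0 (x \<bullet> e)" "0 \<le> t * max 0 (y \<bullet> e)" using t by auto
  ultimately show "max 0 (((1 - t) *\<^sub>R x + t *\<^sub>R y) \<bullet> e) \<le> (1 - t) * max 0 (x \<bullet> e) + t * max 0 (y \<bullet> e)"
    by (simp add: inner_add_left)
qed simp

text \<open>Around \<open>b\<close> the ramp vanishes, which suffices by
  \<open>subdiff_local\<close>. The other inclusion holds because the ramp is nonnegative and
  vanishes at \<open>b\<close>.\<close>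

lemma subdiff_pos_part_neg_side:
  assumes v: "convex_on UNIV v" and b: "b \<bullet> e < 0"
  shows "subdiff (\<lambda>x. v x + max 0 (x \<bullet> e)) b = subdiff v b"
proof (rule set_eqI, rule iffI)
  fix z assume z: "z \<in> subdiff (\<lambda>x. v x + max 0 (x \<bullet> e)) b"
  show "z \<in> subdiff v b"
  proof (rule subdiff_local[OF v])
    show "open {x. x \<bullet> e < 0}" by (auto intro!: open_Collect_less continuous_intros)
    show "b \<in> {x. x \<bullet> e < 0}" using b by simp
    fix y assume "y \<in> {x. x \<bullet> e < 0}"
    then show "v b + z \<bullet> (y - b) \<le> v y" using subdiffD[OF z, of y] b by simp
  qed
next
  fix z assume z: "z \<in> subdiff v b"
  have "v b + max 0 (b \<bullet> e) + z \<bullet> (y - b) \<le> v y + max 0 (y \<bullet> e)" for y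
    using subdiffD[OF z, of y] b by simp
  then show "z \<in> subdiff (\<lambda>x. v x + max 0 (x \<bullet> e)) b" by (simp add: subdiff_def)
qed

text \<open>Around \<open>b\<close> the ramp is the linear form \<open>x \<bullet> e\<close>, whose
  gradient is \<open>e\<close>. The other inclusion holds because the ramp dominates this form
  everywhere, with equality at \<open>b\<close>.\<close>

lemma subdiff_pos_part_pos_side:
  assumes v: "convex_on UNIV v" and b: "b \<bullet> e > 0"
  shows "subdiff (\<lambda>x. v x + max 0 (x \<bullet> e)) b = (+) e ` subdiff v b"
proof -
  have "z \<in> subdiff (\<lambda>x. v x + max 0 (x \<bullet> e)) b \<longleftrightarrow> z - e \<in> subdiff v b" for z
  proof
    assume z: "z \<in> subdiff (\<lambda>x. v x + max 0 (x \<bullet> e)) b"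
    show "z - e \<in> subdiff v b"
    proof (rule subdiff_local[OF v])
      show "open {x. x \<bullet> e > 0}" by (auto intro!: open_Collect_less continuous_intros)
      show "b \<in> {x. x \<bullet> e > 0}" using b by simp
      fix y assume "y \<in> {x. x \<bullet> e > 0}"
      then show "v b + (z - e) \<bullet> (y - b) \<le> v y"
        using subdiffD[OF z, of y] b
        by (simp add: inner_diff_left inner_diff_right inner_commute)
    qed
  next
    assume z: "z - e \<in> subdiff v b"
    have "v b + max 0 (b \<bullet> e) + z \<bullet> (y - b) \<le> v y + max 0 (y \<bullet> e)" for y
    proof -
      have "(z - e) \<bullet> (y - b) = z \<bullet> (y - b) - y \<bullet> e + b \<bullet> e"
        by (simp add: inner_diff_left inner_diff_right inner_commute)
      then show ?thesis using subdiffD[OF z, of y] b by simp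
    qed
    then show "z \<in> subdiff (\<lambda>x. v x + max 0 (x \<bullet> e)) b" by (simp add: subdiff_def)
  qed
  moreover have "z \<in> (+) e ` A \<longleftrightarrow> z - e \<in> A" for z and A :: "'a set"
  proof
    show "z - e \<in> A \<Longrightarrow> z \<in> (+) e ` A" by (rule image_eqI[of _ _ "z - e"]) simp_all
  qed auto
  ultimately show ?thesis by blast
qed

lemma emeasure_MA_off_hyperplane:
  assumes v: "convex_on UNIV v" and B: "B \<in> sets borel"
  shows "B \<subseteq> {x. x \<bullet> e < 0} \<Longrightarrow> emeasure (MA_measure (\<lambda>x. v x + max 0 (x \<bullet> e))) B = emeasure (MA_measure v) B"
    and "B \<subseteq> {x. x \<bullet> e > 0} \<Longrightarrow> emeasure (MA_measure (\<lambda>x. v x + max 0 (x \<bullet> e))) B = emeasure (MA_measure v) B"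
proof -
  have vh: "convex_on UNIV (\<lambda>x. v x + max 0 (x \<bullet> e))"
    by (intro convex_on_add v convex_on_pos_part_inner)
  note em = emeasure_MA_measure[OF vh B] emeasure_MA_measure[OF v B]
  show "emeasure (MA_measure (\<lambda>x. v x + max 0 (x \<bullet> e))) B = emeasure (MA_measure v) B" if "B \<subseteq> {x. x \<bullet> e < 0}"
  proof -
    have "(\<Union>b\<in>B. subdiff (\<lambda>x. v x + max 0 (x \<bullet> e)) b) = (\<Union>b\<in>B. subdiff v b)"
      using that subdiff_pos_part_neg_side[OF v] by (intro SUP_cong) auto
    then show ?thesis unfolding em MA_def by simp
  qed
  show "emeasure (MA_measure (\<lambda>x. v x + max 0 (x \<bullet> e))) B = emeasure (MA_measure v) B" if "B \<subseteq> {x. x \<bullet> e > 0}"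
  proof -
    have "(\<Union>b\<in>B. subdiff (\<lambda>x. v x + max 0 (x \<bullet> e)) b) = (\<Union>b\<in>B. (+) e ` subdiff v b)"
      using that subdiff_pos_part_pos_side[OF v] by (intro SUP_cong) auto
    also have "\<dots> = (\<lambda>x. 1 *\<^sub>R x + e) ` (\<Union>b\<in>B. subdiff v b)" by (auto simp: add.commute)
    finally show ?thesis
      unfolding em MA_def using emeasure_lebesgue_affine[of 1 e "\<Union>b\<in>B. subdiff v b"] by simp
  qed
qed

text \<open>\<open>T\<close> presents the hyperplane as a Euclidean space in its own right, with its
  own Lebesgue measure and Monge--Ampere measures.\<close>

locale hyperplane_chart =
  fixes e :: "'a::euclidean_space" and T :: "'b::euclidean_space \<Rightarrow> 'a"
  assumes dim: "DIM('a) = DIM('b) + 1" and e: "norm e = 1"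
    and lin: "linear T" and iso: "\<And>z. norm (T z) = norm z" and rng: "range T = {x. x \<bullet> e = 0}"
begin

definition chart :: "'b \<times> real \<Rightarrow> 'a" where "chart p = T (fst p) + snd p *\<^sub>R e"

lemma T_e [simp]: "T z \<bullet> e = 0" "e \<bullet> T z = 0"
  using rng by (auto simp: inner_commute)

lemma e_e [simp]: "e \<bullet> e = 1"
  using e by (simp add: norm_eq_1)

lemma T_inner [simp]: "T x \<bullet> T y = x \<bullet> y"
  using iso by (simp add: dot_norm linear_add[OF lin, symmetric])

lemma linear_chart: "linear chart"
  by (rule linearI) (simp_all add: chart_def linear_add[OF lin] linear_scale[OF lin] algebra_simps)

lemma norm_chart: "norm (chart p) = norm p"
proof -
  have "chart p \<bullet> chart p = p \<bullet> p"
    by (simp add: chart_def inner_add_left inner_add_right inner_prod_def)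
  then show ?thesis by (simp add: norm_eq_sqrt_inner)
qed

lemma dim_chart: "DIM('b \<times> real) = DIM('a)"
  using dim by simp

lemma chart_surj: obtains y s where "x = chart (y, s)"
  using isometry_bij[OF linear_chart norm_chart dim_chart] by (metis bij_pointE prod.collapse)

lemma T_measurable: "T \<in> borel_measurable borel"
  by (rule linear_borel_measurable[OF lin])

lemma T_continuous: "continuous_on S T"
  using lin linear_conv_bounded_linear[of T] linear_continuous_on[of T] by blast

lemma T_vimage_borel: "B \<in> sets borel \<Longrightarrow> T -` B \<in> sets borel"
  using measurable_sets[OF T_measurable] by simp

lemma T_vimage_bounded: "bounded B \<Longrightarrow> bounded (T -` B)"
  unfolding bounded_iff by (metis iso vimageE)

lemma compact_T_vimage: "compact K \<Longrightarrow> compact (T -` K)"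
  using closed_vimage[OF compact_imp_closed T_continuous] T_vimage_bounded[OF compact_imp_bounded]
  by (simp add: compact_eq_bounded_closed)

text \<open>Difference quotients in the normal coordinate \<open>s\<close>, after removal of the
  tangential slope \<open>z\<close>. Positive \<open>s\<close> bound the normal part of a
  subgradient from above, negative \<open>s\<close> from below.\<close>

definition slopes :: "('a \<Rightarrow> real) \<Rightarrow> 'b \<Rightarrow> 'b \<Rightarrow> (real \<Rightarrow> bool) \<Rightarrow> real set" where
  "slopes v b z P = {(v (chart (y, s)) - v (T b) - z \<bullet> (y - b)) / s | y s. P s}"

text \<open>The subgradient inequality at \<open>chart (y, s)\<close> is split by the sign of
  \<open>s\<close>. For \<open>s = 0\<close> it concerns the restriction \<open>v \<circ> T\<close>
  alone; otherwise division by \<open>s\<close> isolates \<open>t\<close>.\<close>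

lemma chart_mem_subdiff_iff:
  "chart (z, t) \<in> subdiff v (T b) \<longleftrightarrow> z \<in> subdiff (v \<circ> T) b \<and>
     (\<forall>u\<in>slopes v b z (\<lambda>s. 0 < s). t \<le> u) \<and> (\<forall>l\<in>slopes v b z (\<lambda>s. s < 0). l \<le> t)"
proof -
  have inn: "chart (z, t) \<bullet> (chart (y, s) - T b) = z \<bullet> (y - b) + t * s" for y s
    by (simp add: chart_def inner_add_left inner_add_right inner_diff_left inner_diff_right)
  have "chart (z, t) \<in> subdiff v (T b) \<longleftrightarrow> (\<forall>y s. v (T b) + (z \<bullet> (y - b) + t * s) \<le> v (chart (y, s)))"
    unfolding subdiff_def mem_Collect_eq inn[symmetric] by (metis chart_surj)
  also have "\<dots> \<longleftrightarrow> (\<forall>y. v (T b) + z \<bullet> (y - b) \<le> v (T y)) \<and>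
     (\<forall>y s. 0 < s \<longrightarrow> t \<le> (v (chart (y, s)) - v (T b) - z \<bullet> (y - b)) / s) \<and>
     (\<forall>y s. s < 0 \<longrightarrow> (v (chart (y, s)) - v (T b) - z \<bullet> (y - b)) / s \<le> t)" (is "?L \<longleftrightarrow> ?R1 \<and> ?R2 \<and> ?R3")
  proof -
    have p: "(v (T b) + (z \<bullet> (y - b) + t * s) \<le> v (chart (y, s))) \<longleftrightarrow> t \<le> (v (chart (y, s)) - v (T b) - z \<bullet> (y - b)) / s"
      if "0 < s" for y s using that by (auto simp: le_divide_eq)
    have n: "(v (T b) + (z \<bullet> (y - b) + t * s) \<le> v (chart (y, s))) \<longleftrightarrow> (v (chart (y, s)) - v (T b) - z \<bullet> (y - b)) / s \<le> t"
      if "s < 0" for y s using that by (auto simp: divide_le_eq)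
    have o: "v (T b) + (z \<bullet> (y - b) + t * 0) \<le> v (chart (y, 0)) \<longleftrightarrow> v (T b) + z \<bullet> (y - b) \<le> v (T y)" for y
      by (simp add: chart_def)
    have "?L \<longleftrightarrow> (\<forall>y. v (T b) + (z \<bullet> (y - b) + t * 0) \<le> v (chart (y, 0))) \<and>
       (\<forall>y s. 0 < s \<longrightarrow> v (T b) + (z \<bullet> (y - b) + t * s) \<le> v (chart (y, s))) \<and>
       (\<forall>y s. s < 0 \<longrightarrow> v (T b) + (z \<bullet> (y - b) + t * s) \<le> v (chart (y, s)))"
      by (metis linorder_less_linear)
    also have "\<dots> \<longleftrightarrow> ?R1 \<and> ?R2 \<and> ?R3" using p n unfolding o by simp
    finally show ?thesis .
  qed
  also have "?R1 \<longleftrightarrow> z \<in> subdiff (v \<circ> T) b" by (simp add: subdiff_def)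
  also have "?R2 \<longleftrightarrow> (\<forall>u\<in>slopes v b z (\<lambda>s. 0 < s). t \<le> u)" by (auto simp: slopes_def)
  also have "?R3 \<longleftrightarrow> (\<forall>l\<in>slopes v b z (\<lambda>s. s < 0). l \<le> t)" by (auto simp: slopes_def)
  finally show ?thesis .
qed

text \<open>The segment between the two points on opposite sides crosses the hyperplane at some
  \<open>T w\<close>. Convexity bounds \<open>v (T w)\<close> from above, and the subgradient
  \<open>z\<close> of the restriction bounds it from below.\<close>

lemma slopes_le:
  assumes v: "convex_on UNIV v" and z: "z \<in> subdiff (v \<circ> T) b"
    and l: "l \<in> slopes v b z (\<lambda>s. s < 0)" and u: "u \<in> slopes v b z (\<lambda>s. 0 < s)"
  shows "l \<le> u"
proof -
  define f where "f p = v (chart p) - v (T b) - z \<bullet> (fst p - b)" for p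
  obtain y s where u: "0 < s" "u = f (y, s) / s" using u by (auto simp: slopes_def f_def)
  obtain y' s' where l: "s' < 0" "l = f (y', s') / s'" using l by (auto simp: slopes_def f_def)
  \<comment> \<open>The parameter at which the normal coordinates \<open>s\<close> and
    \<open>s'\<close> cancel.\<close>
  define t where "t = s / (s - s')"
  have d: "s - s' > 0" using u l by simp
  have t: "0 \<le> t" "t \<le> 1" using u l d by (auto simp: t_def divide_le_eq)
  have t0: "(1 - t) * s + t * s' = 0" using d by (simp add: t_def field_simps)
  define w where "w = (1 - t) *\<^sub>R y + t *\<^sub>R y'"
  have c: "(1 - t) *\<^sub>R chart (y, s) + t *\<^sub>R chart (y', s') = T w"
  proof -
    have "T w = (1 - t) *\<^sub>R T y + t *\<^sub>R T y'"
      by (simp only: w_def linear_add[OF lin] linear_scale[OF lin])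
    then have "(1 - t) *\<^sub>R chart (y, s) + t *\<^sub>R chart (y', s') = T w + ((1 - t) * s + t * s') *\<^sub>R e"
      by (simp add: chart_def algebra_simps)
    then show ?thesis by (simp add: t0)
  qed
  have "v (T w) \<le> (1 - t) * v (chart (y, s)) + t * v (chart (y', s'))"
    using convex_onD[OF v t(1) t(2), of "chart (y, s)" "chart (y', s')"] by (simp add: c)
  moreover have "v (T b) + z \<bullet> (w - b) \<le> v (T w)" using subdiffD[OF z, of w] by simp
  moreover have "z \<bullet> (w - b) = (1 - t) * (z \<bullet> (y - b)) + t * (z \<bullet> (y' - b))"
    by (simp add: w_def inner_diff_right inner_add_right algebra_simps)
  ultimately have "0 \<le> (1 - t) * f (y, s) + t * f (y', s')"
    by (simp add: f_def algebra_simps)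
  then have "0 \<le> (s - s') * ((1 - t) * f (y, s) + t * f (y', s'))" using d by simp
  also have "\<dots> = - s' * f (y, s) + s * f (y', s')"
  proof -
    have "(s - s') * t = s" using d by (simp add: t_def)
    then have "(s - s') * (1 - t) = - s'" by (simp add: algebra_simps)
    then show ?thesis using \<open>(s - s') * t = s\<close> by (simp add: distrib_left flip: mult.assoc)
  qed
  finally show ?thesis
    unfolding u l using u(1) l(1) by (simp add: divide_le_eq le_divide_eq mult.commute)
qed

lemma slopes_nonempty: "slopes v b z (\<lambda>s. 0 < s) \<noteq> {}" "slopes v b z (\<lambda>s. s < 0) \<noteq> {}"
  unfolding slopes_def by (auto intro: exI[of _ 1] exI[of _ "-1"])

text \<open>At \<open>chart (y, s)\<close> the ramp is \<open>max 0 s\<close>; divided by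
  \<open>s\<close> this is 1 for positive and 0 for negative \<open>s\<close>.\<close>

lemma slopes_add_pos_part:
  "slopes (\<lambda>x. v x + max 0 (x \<bullet> e)) b z (\<lambda>s. 0 < s) = (\<lambda>u. u + 1) ` slopes v b z (\<lambda>s. 0 < s)"
  "slopes (\<lambda>x. v x + max 0 (x \<bullet> e)) b z (\<lambda>s. s < 0) = slopes v b z (\<lambda>s. s < 0)"
proof -
  have ce: "chart (y, s) \<bullet> e = s" for y s by (simp add: chart_def inner_add_left)
  have pos: "(v (chart (y, s)) + max 0 (chart (y, s) \<bullet> e) - (v (T b) + max 0 (T b \<bullet> e)) - z \<bullet> (y - b)) / s
      = (v (chart (y, s)) - v (T b) - z \<bullet> (y - b)) / s + 1" if "0 < s" for y s
    using that by (simp add: ce field_simps)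
  have neg: "v (chart (y, s)) + max 0 (chart (y, s) \<bullet> e) - (v (T b) + max 0 (T b \<bullet> e)) - z \<bullet> (y - b)
      = v (chart (y, s)) - v (T b) - z \<bullet> (y - b)" if "s < 0" for y s
    using that by (simp add: ce)
  show "slopes (\<lambda>x. v x + max 0 (x \<bullet> e)) b z (\<lambda>s. 0 < s) = (\<lambda>u. u + 1) ` slopes v b z (\<lambda>s. 0 < s)"
  proof -
    have "{f y s |y s. P s} = k ` {g y s |y s. P s}"
      if fg: "\<And>y s. P s \<Longrightarrow> f y s = k (g y s)" for f g :: "'b \<Rightarrow> real \<Rightarrow> real" and k P
    proof (intro set_eqI iffI)
      fix q assume "q \<in> {f y s |y s. P s}"
      then obtain y s where "P s" "q = f y s" by blast
      then show "q \<in> k ` {g y s |y s. P s}" using fg[of s y] by blast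
    next
      fix q assume "q \<in> k ` {g y s |y s. P s}"
      then obtain y s where "P s" "q = k (g y s)" by blast
      then have "P s" "q = f y s" using fg[of s y] by simp_all
      then show "q \<in> {f y s |y s. P s}" by blast
    qed
    then show ?thesis unfolding slopes_def by this (rule pos)
  qed
  show "slopes (\<lambda>x. v x + max 0 (x \<bullet> e)) b z (\<lambda>s. s < 0) = slopes v b z (\<lambda>s. s < 0)"
    unfolding slopes_def by (intro Collect_cong ex_cong1) (auto simp: ce)
qed

text \<open>Adding \<^term>\<open>\<lambda>x. max 0 (x \<bullet> e)\<close> moves the upper endpoint of the fibre up by one and keeps the lower one.\<close>
lemma emeasure_fibre:
  assumes v: "convex_on UNIV v" and z: "z \<in> subdiff (v \<circ> T) b"
  shows "emeasure lborel {t. chart (z, t) \<in> subdiff (\<lambda>x. v x + max 0 (x \<bullet> e)) (T b)} =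
    emeasure lborel {t. chart (z, t) \<in> subdiff v (T b)} + 1"
proof -
  define U where "U = slopes v b z (\<lambda>s. 0 < s)"
  define L where "L = slopes v b z (\<lambda>s. s < 0)"
  have ne: "U \<noteq> {}" "L \<noteq> {}" using slopes_nonempty by (auto simp: U_def L_def)
  have LU: "l \<le> u" if "l \<in> L" "u \<in> U" for l u
    using slopes_le[OF v z] that by (auto simp: U_def L_def)
  obtain l0 u0 where lu0: "l0 \<in> L" "u0 \<in> U" using ne by blast
  have bU: "bdd_below U" by (rule bdd_belowI[of _ l0]) (rule LU[OF lu0(1)])
  have bL: "bdd_above L" by (rule bdd_aboveI[of _ u0]) (rule LU[OF _ lu0(2)])
  have "Sup L \<le> Inf U" by (intro cSup_least cInf_greatest ne LU)
  have lower: "(\<forall>l\<in>L. l \<le> t) \<longleftrightarrow> Sup L \<le> t" and upper: "(\<forall>u\<in>U. t \<le> u) \<longleftrightarrow> t \<le> Inf U" for t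
    using cSup_le_iff[OF ne(2) bL, of t] le_cInf_iff[OF ne(1) bU, of t] by auto
  have "{t. chart (z, t) \<in> subdiff v (T b)} = {Sup L..Inf U}"
    unfolding chart_mem_subdiff_iff U_def[symmetric] L_def[symmetric] using z by (auto simp: lower upper)
  moreover have "{t. chart (z, t) \<in> subdiff (\<lambda>x. v x + max 0 (x \<bullet> e)) (T b)} = {Sup L..Inf U + 1}"
  proof -
    have "(\<lambda>x. v x + max 0 (x \<bullet> e)) \<circ> T = v \<circ> T" by (simp add: fun_eq_iff)
    moreover have "(\<forall>u\<in>U. t \<le> u + 1) \<longleftrightarrow> t \<le> Inf U + 1" for t using upper[of "t - 1"] by (simp add: algebra_simps)
    ultimately show ?thesis
      unfolding chart_mem_subdiff_iff slopes_add_pos_part U_def[symmetric] L_def[symmetric]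
      using z by (auto simp: lower)
  qed
  ultimately show ?thesis
    using \<open>Sup L \<le> Inf U\<close> by (simp add: ennreal_plus[symmetric] del: ennreal_plus flip: ennreal_1)
qed

text \<open>Fubini in the coordinates \<open>chart\<close>. Compactness of \<open>K\<close> makes
  the set of slopes compact, hence Borel, so that it can be cut into fibres directly.\<close>

lemma emeasure_MA_hyperplane_compact:
  assumes v: "convex_on UNIV v" and K: "compact K" "K \<subseteq> {x. x \<bullet> e = 0}"
  shows "emeasure (MA_measure (\<lambda>x. v x + max 0 (x \<bullet> e))) K =
     emeasure (MA_measure v) K + emeasure (MA_measure (v \<circ> T)) (T -` K)"
proof -
  let ?vh = "\<lambda>x. v x + max 0 (x \<bullet> e)"
  have vh: "convex_on UNIV ?vh" by (intro convex_on_add v convex_on_pos_part_inner)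
  have vT: "convex_on UNIV (v \<circ> T)" by (rule convex_on_linear_comp[OF v lin])
  have K': "compact (T -` K)" by (rule compact_T_vimage[OF K(1)])
  have KT: "K = T ` (T -` K)" using K(2) by (simp add: image_vimage_eq rng inf_absorb1)
  have cm: "chart \<in> borel_measurable borel"
    by (rule linear_borel_measurable[OF linear_chart])
  have fub: "emeasure (MA_measure u) K = (\<integral>\<^sup>+z. emeasure lborel {t. chart (z, t) \<in> subd u K} \<partial>lborel)"
    "(\<lambda>z. emeasure lborel {t. chart (z, t) \<in> subd u K}) \<in> borel_measurable lborel"
    if u: "convex_on UNIV u" for u
  proof -
    have c: "compact (subd u K)" by (rule subd_compact[OF u K(1)])
    then have cb: "subd u K \<in> sets borel" by (rule borel_compact)
    have pre: "chart -` subd u K \<in> sets (lborel \<Otimes>\<^sub>M lborel)"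
      unfolding lborel_prod sets_lborel using measurable_sets[OF cm cb] by simp
    have "emeasure (MA_measure u) K = emeasure lebesgue (subd u K)"
      using emeasure_MA_measure[OF u borel_compact[OF K(1)]] by (simp add: MA_def subd_def)
    also have "\<dots> = emeasure lborel (subd u K)" using cb by (simp add: emeasure_completion)
    also have "\<dots> = emeasure (distr lborel borel chart) (subd u K)"
      by (simp add: distr_lborel_isometry[OF linear_chart norm_chart dim_chart])
    also have "\<dots> = emeasure lborel (chart -` subd u K)" using cm cb by (subst emeasure_distr) auto
    also have "\<dots> = emeasure (lborel \<Otimes>\<^sub>M lborel) (chart -` subd u K)" by (simp add: lborel_prod)
    also have "\<dots> = (\<integral>\<^sup>+z. emeasure lborel (Pair z -` (chart -` subd u K)) \<partial>lborel)"
      by (rule lborel.emeasure_pair_measure_alt[OF pre])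
    finally show "emeasure (MA_measure u) K = (\<integral>\<^sup>+z. emeasure lborel {t. chart (z, t) \<in> subd u K} \<partial>lborel)"
      by (simp add: vimage_def)
    show "(\<lambda>z. emeasure lborel {t. chart (z, t) \<in> subd u K}) \<in> borel_measurable lborel"
      using lborel.measurable_emeasure_Pair[OF pre] by (simp add: vimage_def)
  qed
  define D where "D = subd (v \<circ> T) (T -` K)"
  have "compact D" unfolding D_def by (rule subd_compact[OF vT K'])
  then have Db: "D \<in> sets borel" by (rule borel_compact)
  \<comment> \<open>For such \<open>z\<close> at most one point of the hyperplane contributes, so
    the fibre is a single interval as in \<open>emeasure_fibre\<close>, or empty if
    \<open>z \<notin> D\<close>.\<close>
  have "AE z in lborel. z \<notin> multi_subd (v \<circ> T)"
    using negligible_multi_subd[OF vT] AE_not_in[of "multi_subd (v \<circ> T)" lebesgue]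
    by (simp add: negligible_iff_null_sets AE_completion_iff)
  then have "AE z in lborel. emeasure lborel {t. chart (z, t) \<in> subd ?vh K} =
      emeasure lborel {t. chart (z, t) \<in> subd v K} + indicator D z"
  proof eventually_elim
    case (elim z)
    have fib: "chart (z, t) \<in> subd u K \<longleftrightarrow> (\<exists>b. T b \<in> K \<and> chart (z, t) \<in> subdiff u (T b))" for t u
      by (subst KT) (auto simp: subd_def)
    have vhT: "?vh \<circ> T = v \<circ> T" by (simp add: fun_eq_iff)
    show ?case
    proof (cases "z \<in> D")
      case False
      have no: "\<not> chart (z, t) \<in> subd u K" if "u \<circ> T = v \<circ> T" for t u
      proof
        assume "chart (z, t) \<in> subd u K"
        then obtain b where "T b \<in> K" "chart (z, t) \<in> subdiff u (T b)" unfolding fib by blast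
        then have "z \<in> D" using that by (auto simp: chart_mem_subdiff_iff D_def subd_def)
        then show False using False by simp
      qed
      have "{t. chart (z, t) \<in> subd ?vh K} = {}" "{t. chart (z, t) \<in> subd v K} = {}"
        using no[OF vhT] no[OF refl] by blast+
      then show ?thesis using False by simp
    next
      case True
      then obtain b where b: "T b \<in> K" "z \<in> subdiff (v \<circ> T) b" by (auto simp: D_def subd_def)
      have uniq: "c = b" if "z \<in> subdiff (v \<circ> T) c" for c
        using elim that b(2) unfolding multi_subd_def by blast
      have eq: "{t. chart (z, t) \<in> subd u K} = {t. chart (z, t) \<in> subdiff u (T b)}" if "u \<circ> T = v \<circ> T" for u
        using b(1) uniq unfolding fib chart_mem_subdiff_iff that by blast
      show ?thesis using emeasure_fibre[OF v b(2)] True by (simp add: eq[OF vhT] eq[OF refl])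
    qed
  qed
  then have "emeasure (MA_measure ?vh) K = (\<integral>\<^sup>+z. emeasure lborel {t. chart (z, t) \<in> subd v K} + indicator D z \<partial>lborel)"
    unfolding fub(1)[OF vh] by (rule nn_integral_cong_AE)
  also have "\<dots> = (\<integral>\<^sup>+z. emeasure lborel {t. chart (z, t) \<in> subd v K} \<partial>lborel) + (\<integral>\<^sup>+z. indicator D z \<partial>lborel)"
    using fub(2)[OF v] Db by (intro nn_integral_add) auto
  also have "\<dots> = emeasure (MA_measure v) K + emeasure lborel D"
    using fub(1)[OF v] Db by simp
  also have "emeasure lborel D = emeasure (MA_measure (v \<circ> T)) (T -` K)"
    using emeasure_MA_measure[OF vT borel_compact[OF K']] Db
    by (simp add: MA_def D_def subd_def emeasure_completion)
  finally show ?thesis .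
qed

text \<open>One compact set approximates \<open>B\<close> from inside for all three measures at
  once, and for compact sets the identity is known.\<close>

lemma measure_MA_hyperplane:
  assumes v: "convex_on UNIV v" and B: "B \<in> sets borel" "bounded B" "B \<subseteq> {x. x \<bullet> e = 0}"
  shows "MA_real (\<lambda>x. v x + max 0 (x \<bullet> e)) B =
     MA_real v B + MA_real (v \<circ> T) (T -` B)"
proof -
  let ?vh = "\<lambda>x. v x + max 0 (x \<bullet> e)"
  have vh: "convex_on UNIV ?vh" by (intro convex_on_add v convex_on_pos_part_inner)
  have vT: "convex_on UNIV (v \<circ> T)" by (rule convex_on_linear_comp[OF v lin])
  have cpt: "MA_real ?vh K = MA_real v K + MA_real (v \<circ> T) (T -` K)"
    if K: "compact K" "K \<subseteq> {x. x \<bullet> e = 0}" for K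
    using emeasure_MA_hyperplane_compact[OF v K] emeasure_MA_measure_finite[OF v compact_imp_bounded[OF K(1)]]
      emeasure_MA_measure_finite[OF vT T_vimage_bounded[OF compact_imp_bounded[OF K(1)]]]
    by (simp add: measure_def enn2real_plus)
  have "\<bar>MA_real ?vh B - (MA_real v B + MA_real (v \<circ> T) (T -` B))\<bar> \<le> 0 + d" if d: "0 < d" for d
  proof -
    have d3: "0 < d / 3" using d by simp
    obtain K1 where K1: "K1 \<subseteq> B" "compact K1" "\<And>K'. K1 \<subseteq> K' \<Longrightarrow> K' \<subseteq> B \<Longrightarrow> compact K' \<Longrightarrow>
        \<bar>MA_real ?vh K' - MA_real ?vh B\<bar> < d / 3"
      using MA_measure_inner_regular[OF vh B(1,2) d3] by blast
    obtain K2 where K2: "K2 \<subseteq> B" "compact K2" "\<And>K'. K2 \<subseteq> K' \<Longrightarrow> K' \<subseteq> B \<Longrightarrow> compact K' \<Longrightarrow>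
        \<bar>MA_real v K' - MA_real v B\<bar> < d / 3"
      using MA_measure_inner_regular[OF v B(1,2) d3] by blast
    obtain K3 where K3: "K3 \<subseteq> T -` B" "compact K3" "\<And>K'. K3 \<subseteq> K' \<Longrightarrow> K' \<subseteq> T -` B \<Longrightarrow> compact K' \<Longrightarrow>
        \<bar>MA_real (v \<circ> T) K' - MA_real (v \<circ> T) (T -` B)\<bar> < d / 3"
      using MA_measure_inner_regular[OF vT T_vimage_borel[OF B(1)] T_vimage_bounded[OF B(2)] d3] by blast
    \<comment> \<open>\<open>K3\<close> lies in the parameter space of the hyperplane, so its image
      is taken.\<close>
    define K where "K = K1 \<union> K2 \<union> T ` K3"
    have K: "compact K" "K \<subseteq> B"
      using K1(1,2) K2(1,2) K3(1,2) compact_continuous_image[OF T_continuous K3(2)]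
      by (auto simp: K_def intro!: compact_Un)
    have TK: "compact (T -` K)" by (rule compact_T_vimage[OF K(1)])
    have "MA_real ?vh K = MA_real v K + MA_real (v \<circ> T) (T -` K)"
      using K B(3) by (intro cpt) auto
    moreover have "\<bar>MA_real ?vh K - MA_real ?vh B\<bar> < d / 3"
      using K by (intro K1(3)) (auto simp: K_def)
    moreover have "\<bar>MA_real v K - MA_real v B\<bar> < d / 3"
      using K by (intro K2(3)) (auto simp: K_def)
    moreover have "\<bar>MA_real (v \<circ> T) (T -` K) - MA_real (v \<circ> T) (T -` B)\<bar> < d / 3"
      using K TK by (intro K3(3)) (auto simp: K_def)
    ultimately show ?thesis by linarith
  qed
  then have "\<bar>MA_real ?vh B - (MA_real v B + MA_real (v \<circ> T) (T -` B))\<bar> \<le> 0"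
    by (rule field_le_epsilon)
  then show ?thesis by simp
qed

text \<open>Off the hyperplane the two measures agree; on it they differ by that of the restriction.\<close>
lemma measure_MA_add_pos_part:
  assumes v: "convex_on UNIV v" and B: "B \<in> sets borel" "bounded B"
  shows "MA_real (\<lambda>x. v x + max 0 (x \<bullet> e)) B =
     MA_real v B + MA_real (v \<circ> T) (T -` B)"
proof -
  let ?vh = "\<lambda>x. v x + max 0 (x \<bullet> e)"
  have vh: "convex_on UNIV ?vh" by (intro convex_on_add v convex_on_pos_part_inner)
  define N Z P where "N = B \<inter> {x. x \<bullet> e < 0}" and "Z = B \<inter> {x. x \<bullet> e = 0}" and "P = B \<inter> {x. x \<bullet> e > 0}"
  have sets: "N \<in> sets borel" "Z \<in> sets borel" "P \<in> sets borel"
    unfolding N_def Z_def P_def using B(1) by measurable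
  have bdd: "bounded N" "bounded Z" "bounded P"
    using B(2) by (auto simp: N_def Z_def P_def intro: bounded_subset)
  have split: "MA_real u B = MA_real u N + MA_real u Z + MA_real u P"
    if u: "convex_on UNIV u" for u
  proof -
    have fin: "emeasure (MA_measure u) A \<noteq> \<infinity>" if "bounded A" for A
      using emeasure_MA_measure_finite[OF u that] by simp
    have "B = (N \<union> Z) \<union> P" by (auto simp: N_def Z_def P_def)
    moreover have "MA_real u ((N \<union> Z) \<union> P) = MA_real u (N \<union> Z) + MA_real u P"
      using sets bdd by (intro measure_Union fin) (auto simp: N_def Z_def P_def)
    moreover have "MA_real u (N \<union> Z) = MA_real u N + MA_real u Z"
      using sets bdd by (intro measure_Union fin) (auto simp: N_def Z_def P_def)
    ultimately show ?thesis by simp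
  qed
  have "MA_real ?vh N = MA_real v N"
    using emeasure_MA_off_hyperplane(1)[OF v sets(1), of e] by (simp add: N_def measure_def)
  moreover have "MA_real ?vh P = MA_real v P"
    using emeasure_MA_off_hyperplane(2)[OF v sets(3), of e] by (simp add: P_def measure_def)
  moreover have "MA_real ?vh Z = MA_real v Z + MA_real (v \<circ> T) (T -` Z)"
    using sets bdd by (intro measure_MA_hyperplane v) (auto simp: Z_def)
  moreover have "T -` Z = T -` B" by (auto simp: Z_def)
  ultimately show ?thesis unfolding split[OF vh] split[OF v] by simp
qed

text \<open>Position \<open>DIM('b)\<close> holds the ramp. Each \<open>S\<close> without it is
  paired with \<open>insert DIM('b) S\<close>, which has the opposite sign, and the difference is
  the measure of the restricted sum. The factor \<open>DIM('a)\<close> is the quotient of the two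
  factorials.\<close>

lemma polar_MA_segment:
  assumes vs: "length vs = DIM('b)" "\<And>v. v \<in> set vs \<Longrightarrow> convex_on UNIV v"
    and B: "B \<in> sets borel" "bounded B"
  shows "real DIM('a) * polar_MA (vs @ [\<lambda>x. max 0 (x \<bullet> e)]) B = polar_MA (map (\<lambda>v. v \<circ> T) vs) (T -` B)"
proof -
  let ?n = "DIM('b)" and ?h = "\<lambda>x. max 0 (x \<bullet> e)"
  let ?ws = "vs @ [?h]"
  define m where "m S = MA_real (\<lambda>x. \<Sum>i\<in>S. (?ws ! i) x) B" for S
  have fin: "finite S" if "S \<in> Pow {..<?n}" for S using that finite_subset by auto
  have step: "m (insert ?n S) - m S = MA_real (\<lambda>x. \<Sum>i\<in>S. (map (\<lambda>v. v \<circ> T) vs ! i) x) (T -` B)"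
    if S: "S \<in> Pow {..<?n}" for S
  proof -
    have nS: "?n \<notin> S" using S by auto
    have eq: "(\<Sum>i\<in>S. (?ws ! i) x) = (\<Sum>i\<in>S. (vs ! i) x)" for x
      using S vs(1) by (intro sum.cong refl) (auto simp: nth_append)
    have "(\<Sum>i\<in>insert ?n S. (?ws ! i) x) = (\<Sum>i\<in>S. (vs ! i) x) + max 0 (x \<bullet> e)" for x
      unfolding sum.insert[OF fin[OF S] nS] eq by (simp add: nth_append vs(1))
    then have "m (insert ?n S) = MA_real (\<lambda>x. (\<Sum>i\<in>S. (vs ! i) x) + max 0 (x \<bullet> e)) B"
      by (simp add: m_def)
    also have "\<dots> = MA_real (\<lambda>x. \<Sum>i\<in>S. (vs ! i) x) B + MA_real ((\<lambda>x. \<Sum>i\<in>S. (vs ! i) x) \<circ> T) (T -` B)"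
    proof (rule measure_MA_add_pos_part[OF _ B])
      show "convex_on UNIV (\<lambda>x. \<Sum>i\<in>S. (vs ! i) x)"
      proof -
        have "convex_on UNIV (vs ! i)" if "i \<in> S" for i using S that vs(1) by (intro vs(2)) auto
        from convex_on_lincomb[of S UNIV "(!) vs" "\<lambda>_. 1", OF this] show ?thesis by simp
      qed
    qed
    also have "MA_real (\<lambda>x. \<Sum>i\<in>S. (vs ! i) x) B = m S" by (simp add: m_def eq)
    also have "(\<lambda>x. \<Sum>i\<in>S. (vs ! i) x) \<circ> T = (\<lambda>x. \<Sum>i\<in>S. (map (\<lambda>v. v \<circ> T) vs ! i) x)"
    proof
      fix x
      show "((\<lambda>x. \<Sum>i\<in>S. (vs ! i) x) \<circ> T) x = (\<Sum>i\<in>S. (map (\<lambda>v. v \<circ> T) vs ! i) x)"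
        unfolding comp_def using S vs(1) by (intro sum.cong refl) auto
    qed
    finally show ?thesis by simp
  qed
  have inj: "inj_on (insert ?n) (Pow {..<?n})" by (rule inj_onI) (metis PowD insert_ident lessThan_iff less_irrefl subsetD)
  have "(\<Sum>S\<in>Pow {..<Suc ?n}. (-1) ^ (Suc ?n - card S) * m S) =
     (\<Sum>S\<in>Pow {..<?n}. (-1) ^ (Suc ?n - card S) * m S) + (\<Sum>S\<in>insert ?n ` Pow {..<?n}. (-1) ^ (Suc ?n - card S) * m S)"
    unfolding lessThan_Suc Pow_insert by (rule sum.union_disjoint) auto
  also have "(\<Sum>S\<in>insert ?n ` Pow {..<?n}. (-1) ^ (Suc ?n - card S) * m S) = (\<Sum>S\<in>Pow {..<?n}. (-1) ^ (?n - card S) * m (insert ?n S))"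
  proof (subst sum.reindex[OF inj], rule sum.cong[OF refl])
    fix S assume S: "S \<in> Pow {..<?n}"
    have "card (insert ?n S) = Suc (card S)" using S fin[OF S] by (intro card_insert_disjoint) auto
    then show "((\<lambda>S. (-1) ^ (Suc ?n - card S) * m S) \<circ> insert ?n) S = (-1) ^ (?n - card S) * m (insert ?n S)" by simp
  qed
  \<comment> \<open>The exponent counts from \<open>Suc ?n\<close>, so the sets without the ramp
    change sign; \<open>card S \<le> ?n\<close> guards the truncated subtraction.\<close>
  also have "(\<Sum>S\<in>Pow {..<?n}. (-1) ^ (Suc ?n - card S) * m S) = (\<Sum>S\<in>Pow {..<?n}. - ((-1) ^ (?n - card S) * m S))"
  proof (rule sum.cong[OF refl])
    fix S assume "S \<in> Pow {..<?n}"
    then have "card S \<le> ?n" using card_mono[of "{..<?n}" S] by simp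
    then show "(-1) ^ (Suc ?n - card S) * m S = - ((-1) ^ (?n - card S) * m S)" by (simp add: Suc_diff_le)
  qed
  also have "(\<Sum>S\<in>Pow {..<?n}. - ((-1) ^ (?n - card S) * m S)) + (\<Sum>S\<in>Pow {..<?n}. (-1) ^ (?n - card S) * m (insert ?n S))
      = (\<Sum>S\<in>Pow {..<?n}. (-1) ^ (?n - card S) * (m (insert ?n S) - m S))"
    by (simp add: sum.distrib[symmetric] right_diff_distrib)
  also have "\<dots> = fact ?n * polar_MA (map (\<lambda>v. v \<circ> T) vs) (T -` B)"
    using step by (simp add: polar_MA_def)
  finally have "(\<Sum>S\<in>Pow {..<DIM('a)}. (-1) ^ (DIM('a) - card S) * m S) = fact ?n * polar_MA (map (\<lambda>v. v \<circ> T) vs) (T -` B)"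
    by (simp add: dim)
  then have "polar_MA ?ws B = fact ?n * polar_MA (map (\<lambda>v. v \<circ> T) vs) (T -` B) / fact DIM('a)"
    by (simp add: polar_MA_def m_def)
  moreover have "fact DIM('a) = real DIM('a) * fact ?n" by (simp add: dim)
  moreover have "real DIM('a) > 0" by simp
  ultimately show ?thesis by (simp add: field_simps)
qed

text \<open>The identity for bounded sets is summed over the shells, which correspond in the two
  spaces because \<open>T\<close> preserves norms.\<close>

theorem mixed_MA_segment:
  assumes vs: "length vs = DIM('b)" "\<And>v. v \<in> set vs \<Longrightarrow> convex_on UNIV v" and B: "B \<in> sets borel"
  shows "of_nat DIM('a) * emeasure (mixed_MA (vs @ [\<lambda>x. max 0 (x \<bullet> e)])) B
    = emeasure (mixed_MA (map (\<lambda>v. v \<circ> T) vs)) (T -` B)"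
proof -
  let ?ws = "vs @ [\<lambda>x. max 0 (x \<bullet> e)]" and ?us = "map (\<lambda>v. v \<circ> T) vs"
  have a: "admissible ?ws" using vs dim convex_on_pos_part_inner by (auto simp: admissible_def)
  have b: "admissible ?us" using vs convex_on_linear_comp[OF _ lin] by (auto simp: admissible_def)
  have sh: "T -` shell j = shell j" for j by (auto simp: shell_def iso)
  have "of_nat DIM('a) * ennreal (polar_MA ?ws (B \<inter> shell j)) = ennreal (polar_MA ?us (T -` B \<inter> shell j))" for j
  proof -
    have "of_nat DIM('a) * ennreal (polar_MA ?ws (B \<inter> shell j)) = ennreal (real DIM('a) * polar_MA ?ws (B \<inter> shell j))"
      by (simp add: ennreal_mult' ennreal_of_nat_eq_real_of_nat)
    also have "real DIM('a) * polar_MA ?ws (B \<inter> shell j) = polar_MA ?us (T -` (B \<inter> shell j))"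
      using B by (intro polar_MA_segment vs bounded_shell) auto
    finally show ?thesis by (simp add: sh)
  qed
  then show ?thesis
    by (simp add: mixed_MA_eq emeasure_mixed_MA_measure[OF a B] emeasure_mixed_MA_measure[OF b T_vimage_borel[OF B]]
        flip: ennreal_suminf_cmult)
qed

end

subsection \<open>Conjugates\<close>

text \<open>Lower semicontinuity gives every point a neighbourhood with a finite lower bound, and
  finitely many of these cover \<open>K\<close>.\<close>

lemma lsc_bounded_below_on_compact:
  fixes u :: "'a::euclidean_space \<Rightarrow> ereal"
  assumes lsc: "lsc_fun u" and ninf: "\<And>x. u x \<noteq> -\<infinity>" and K: "compact K"
  shows "\<exists>m::real. \<forall>x\<in>K. ereal m \<le> u x"
proof -
  have "\<exists>U m. open U \<and> y \<in> U \<and> (\<forall>x\<in>U. ereal m \<le> u x)" for y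
  proof -
    have "\<exists>m. ereal m < u y"
    proof (cases "u y")
      case (real r)
      then show ?thesis by (intro exI[of _ "r - 1"]) simp
    qed (use ninf[of y] in auto)
    then obtain m where m: "ereal m < u y" by blast
    also have "u y \<le> Liminf (at y) u" using lsc by (simp add: lsc_fun_def)
    finally have "\<forall>\<^sub>F x in at y. ereal m < u x" by (rule less_LiminfD)
    then obtain U where U: "open U" "y \<in> U" "\<And>x. x \<in> U \<Longrightarrow> x \<noteq> y \<Longrightarrow> ereal m < u x"
      unfolding eventually_at_topological by blast
    \<comment> \<open>The filter \<open>at y\<close> leaves out \<open>y\<close> itself, where the
      bound holds by the choice of \<open>m\<close>.\<close>
    have "ereal m \<le> u x" if "x \<in> U" for x using U(3)[OF that] m by (cases "x = y") (auto intro: less_imp_le)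
    then show ?thesis using U by blast
  qed
  then obtain U m where U: "\<And>y. open (U y)" "\<And>y. y \<in> U y" "\<And>y x. x \<in> U y \<Longrightarrow> ereal (m y) \<le> u x" by metis
  obtain F where F: "F \<subseteq> K" "finite F" "K \<subseteq> (\<Union>y\<in>F. U y)"
  proof (rule compactE_image[OF K, of K U])
    show "K \<subseteq> (\<Union>y\<in>K. U y)" using U(2) by blast
  qed (use U(1) in auto)
  show ?thesis
  proof (cases "F = {}")
    case True
    then show ?thesis using F by auto
  next
    case False
    have "ereal (Min (m ` F)) \<le> u x" if x: "x \<in> K" for x
    proof -
      obtain y where y: "y \<in> F" "x \<in> U y" using F(3) x by blast
      have "ereal (Min (m ` F)) \<le> ereal (m y)" using F(2) y by simp
      then show ?thesis using U(3)[OF y(2)] by (rule order_trans)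
    qed
    then show ?thesis by blast
  qed
qed

text \<open>A point where \<open>u\<close> is finite bounds the conjugate from below. For the upper
  bound, superlinear growth makes \<open>x \<bullet> y - u y\<close> negative for large
  \<open>y\<close>, and on the remaining ball \<open>u\<close> is bounded below.\<close>

lemma conjugate_finite:
  fixes u :: "'a::euclidean_space \<Rightarrow> ereal"
  assumes u: "conv_sc u"
  shows "\<bar>conjugate u x\<bar> \<noteq> \<infinity>"
proof -
  have lsc: "lsc_fun u" and ninf: "\<And>x. u x \<noteq> -\<infinity>" and "\<exists>x. u x \<noteq> \<infinity>"
    and lim: "((\<lambda>x. u x / ereal (norm x)) \<longlongrightarrow> \<infinity>) at_infinity"
    using u by (auto simp: conv_sc_def)
  then obtain y0 where "u y0 \<noteq> \<infinity>" by blast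
  then obtain a where a: "u y0 = ereal a" using ninf[of y0] by (cases "u y0") auto
  have "ereal (x \<bullet> y0 - a) \<le> conjugate u x"
    unfolding conjugate_def by (rule SUP_upper2[of y0]) (simp_all add: a)
  then have low: "conjugate u x \<noteq> -\<infinity>" by auto
  have "\<forall>\<^sub>F y in at_infinity. ereal (norm x) < u y / ereal (norm y)"
    using lim by (rule order_tendstoD(1)) simp
  then obtain R where R: "\<And>y. R \<le> norm y \<Longrightarrow> ereal (norm x) < u y / ereal (norm y)"
    unfolding eventually_at_infinity by blast
  \<comment> \<open>The 1 keeps \<open>y = 0\<close> out of the outer region, where
    \<open>u y\<close> is divided by \<open>norm y\<close>.\<close>
  define r where "r = max R 1"
  obtain m where m: "\<And>y. y \<in> cball 0 r \<Longrightarrow> ereal m \<le> u y"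
    using lsc_bounded_below_on_compact[OF lsc ninf compact_cball] by blast
  define C where "C = max 0 (norm x * r - m)"
  have "ereal (x \<bullet> y) - u y \<le> ereal C" for y
  proof (cases "u y")
    case (real b)
    show ?thesis
    proof (cases "norm y \<le> r")
      case True
      have "x \<bullet> y \<le> norm x * norm y" by (rule norm_cauchy_schwarz)
      also have "\<dots> \<le> norm x * r" using True by (intro mult_left_mono) auto
      finally have "x \<bullet> y - b \<le> norm x * r - m" using m[of y] True real by simp
      then have "x \<bullet> y - b \<le> C" by (simp add: C_def)
      then show ?thesis by (simp add: real)
    next
      case False
      then have ny: "0 < norm y" "R \<le> norm y" by (auto simp: r_def)
      have "norm x < b / norm y" using R[OF ny(2)] ny(1) by (simp add: real)
      then have "norm x * norm y < b" using ny(1) by (simp add: less_divide_eq)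
      moreover have "x \<bullet> y \<le> norm x * norm y" by (rule norm_cauchy_schwarz)
      ultimately have "x \<bullet> y - b \<le> C" by (simp add: C_def)
      then show ?thesis by (simp add: real)
    qed
  qed (use ninf[of y] in auto)
  then have "conjugate u x \<le> ereal C" unfolding conjugate_def by (intro SUP_least) auto
  then have "conjugate u x \<noteq> \<infinity>" by auto
  then show ?thesis using low by (cases "conjugate u x") auto
qed

lemma conjugate_convex:
  fixes u :: "'a::euclidean_space \<Rightarrow> ereal"
  assumes u: "conv_sc u"
  shows "convex_on UNIV (\<lambda>x. real_of_ereal (conjugate u x))"
proof
  define v where "v x = real_of_ereal (conjugate u x)" for x
  have v: "conjugate u x = ereal (v x)" for x
    using conjugate_finite[OF u, of x] by (simp add: v_def ereal_real)
  fix t :: real and x y :: 'a assume t: "0 < t" "t < 1"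
  have "ereal (((1 - t) *\<^sub>R x + t *\<^sub>R y) \<bullet> p) - u p \<le> ereal ((1 - t) * v x + t * v y)" for p
  proof (cases "u p")
    case (real a)
    have "ereal (x \<bullet> p) - u p \<le> conjugate u x" "ereal (y \<bullet> p) - u p \<le> conjugate u y"
      unfolding conjugate_def by (rule SUP_upper, simp)+
    then have "x \<bullet> p - a \<le> v x" "y \<bullet> p - a \<le> v y" by (simp_all add: real v)
    then have "(1 - t) * (x \<bullet> p - a) \<le> (1 - t) * v x" "t * (y \<bullet> p - a) \<le> t * v y"
      using t by (auto intro!: mult_left_mono)
    then show ?thesis by (simp add: real inner_add_left algebra_simps)
  qed (use u in \<open>auto simp: conv_sc_def\<close>)
  then have "conjugate u ((1 - t) *\<^sub>R x + t *\<^sub>R y) \<le> ereal ((1 - t) * v x + t * v y)"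
    unfolding conjugate_def[of u "(1 - t) *\<^sub>R x + t *\<^sub>R y"] by (intro SUP_least) auto
  then show "real_of_ereal (conjugate u ((1 - t) *\<^sub>R x + t *\<^sub>R y)) \<le>
      (1 - t) * real_of_ereal (conjugate u x) + t * real_of_ereal (conjugate u y)"
    by (simp add: v)
qed simp

lemma conjugate_ind_segment:
  "conjugate (ind_conv (closed_segment 0 e)) x = ereal (max 0 (x \<bullet> e))"
proof (rule antisym)
  show "conjugate (ind_conv (closed_segment 0 e)) x \<le> ereal (max 0 (x \<bullet> e))"
    unfolding conjugate_def
  proof (rule SUP_least)
    fix y
    show "ereal (x \<bullet> y) - ind_conv (closed_segment 0 e) y \<le> ereal (max 0 (x \<bullet> e))"
    proof (cases "y \<in> closed_segment 0 e")
      case True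
      then obtain s where s: "0 \<le> s" "s \<le> 1" "y = s *\<^sub>R e" by (auto simp: in_segment)
      have "s * (x \<bullet> e) \<le> s * max 0 (x \<bullet> e)" using s by (intro mult_left_mono) auto
      also have "\<dots> \<le> 1 * max 0 (x \<bullet> e)" using s by (intro mult_right_mono) auto
      finally have "s * (x \<bullet> e) \<le> max 0 (x \<bullet> e)" by simp
      moreover have "ereal (x \<bullet> y) - ind_conv (closed_segment 0 e) y = ereal (s * (x \<bullet> e))"
        using True s by (simp add: ind_conv_def)
      ultimately show ?thesis by (simp only: ereal_less_eq(3))
    qed (simp add: ind_conv_def)
  qed
  have "ereal (x \<bullet> y) \<le> conjugate (ind_conv (closed_segment 0 e)) x" if "y \<in> closed_segment 0 e" for y
    unfolding conjugate_def by (rule SUP_upper2[of y]) (use that in \<open>auto simp: ind_conv_def\<close>)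
  from this[of 0] this[of e] show "ereal (max 0 (x \<bullet> e)) \<le> conjugate (ind_conv (closed_segment 0 e)) x"
    by (auto simp: max_def zero_ereal_def)
qed

context hyperplane_chart
begin

text \<open>Since \<open>T z\<close> is orthogonal to \<open>e\<close>, the product
  \<open>T z \<bullet> chart (y, t)\<close> equals \<open>z \<bullet> y\<close> for every
  \<open>t\<close>. The infimum over \<open>t\<close> therefore merges with the supremum over
  \<open>y\<close> into a supremum over all points.\<close>

lemma conjugate_proj: "conjugate (proj_perp e u \<circ> T) z = conjugate u (T z)"
proof -
  have "conjugate (proj_perp e u \<circ> T) z = (SUP y. SUP t. ereal (z \<bullet> y) - u (chart (y, t)))"
    unfolding conjugate_def proj_perp_def comp_def chart_def fst_conv snd_conv
    by (subst SUP_ereal_minus_right) auto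
  also have "\<dots> = (SUP x. ereal (T z \<bullet> x) - u x)"
  proof (rule antisym)
    show "(SUP y. SUP t. ereal (z \<bullet> y) - u (chart (y, t))) \<le> (SUP x. ereal (T z \<bullet> x) - u x)"
    proof (intro SUP_least)
      fix y t
      show "ereal (z \<bullet> y) - u (chart (y, t)) \<le> (SUP x. ereal (T z \<bullet> x) - u x)"
        by (rule SUP_upper2[of "chart (y, t)"]) (simp_all add: chart_def inner_add_right)
    qed
    show "(SUP x. ereal (T z \<bullet> x) - u x) \<le> (SUP y. SUP t. ereal (z \<bullet> y) - u (chart (y, t)))"
    proof (rule SUP_least)
      fix x
      obtain y t where x: "x = chart (y, t)" by (rule chart_surj)
      show "ereal (T z \<bullet> x) - u x \<le> (SUP y. SUP t. ereal (z \<bullet> y) - u (chart (y, t)))"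
        unfolding x by (rule SUP_upper2[of y], simp, rule SUP_upper2[of t]) (simp_all add: chart_def inner_add_right)
    qed
  qed
  finally show ?thesis by (simp add: conjugate_def)
qed

end

theorem theorem4p12:
  fixes e :: "'a::euclidean_space" and T :: "'b::euclidean_space \<Rightarrow> 'a"
    and us :: "('a \<Rightarrow> ereal) list" and B :: "'a set"
  assumes "DIM('a) = DIM('b) + 1" and "DIM('a) \<ge> 2"
    and "norm e = 1"
    and "linear T" and "\<And>z. norm (T z) = norm z" and "range T = {x. x \<bullet> e = 0}"
    and "length us = DIM('a) - 1" and "\<forall>u\<in>set us. conv_sc u"
    and "B \<in> sets borel"
  shows "of_nat DIM('a) * MA_conj (us @ [ind_conv (closed_segment 0 e)]) B
         = MA_conj (map (\<lambda>u. proj_perp e u \<circ> T) us) (T -` (B \<inter> {x. x \<bullet> e = 0}))"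
proof -
  interpret hyperplane_chart e T
    using assms(1,3-6) by (rule hyperplane_chart.intro)
  define vs where "vs = map (\<lambda>u x. real_of_ereal (conjugate u x)) us"
  have vs: "length vs = DIM('b)" "\<And>v. v \<in> set vs \<Longrightarrow> convex_on UNIV v"
    using assms(1,7,8) conjugate_convex by (auto simp: vs_def)
  have "map (\<lambda>u x. real_of_ereal (conjugate u x)) (us @ [ind_conv (closed_segment 0 e)]) = vs @ [\<lambda>x. max 0 (x \<bullet> e)]"
    by (simp only: vs_def map_append list.map conjugate_ind_segment real_of_ereal.simps(1))
  \<comment> \<open>The projections enter only through their conjugates, which are the conjugates of
    the original functions restricted to the hyperplane.\<close>
  moreover have "map (\<lambda>u x. real_of_ereal (conjugate u x)) (map (\<lambda>u. proj_perp e u \<circ> T) us) = map (\<lambda>v. v \<circ> T) vs"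
    by (simp add: vs_def conjugate_proj fun_eq_iff)
  moreover have "T -` (B \<inter> {x. x \<bullet> e = 0}) = T -` B" using rng by auto
  ultimately show ?thesis
    unfolding MA_conj_def using mixed_MA_segment[OF vs assms(9)] by simp
qed

end
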